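(* Let $d\ge 1$ and, for every $h\in(0,1)$, let $B=B^{(h)}:(h\mathbb{Z})^d\to\mathbb{R}^d$ and $V=V^{(h)}:(h\mathbb{Z})^d\to\mathbb{R}$ be given, bounded uniformly in $h$, i.e. there is $M<\infty$ with $|B^{(h)}(n)|\le M$ and $|V^{(h)}(n)|\le M$ for all $h\in(0,1)$ and all $n\in(h\mathbb{Z})^d$. Let $P_h$ be the associated discrete magnetic Schrödinger operator. Then there exist constants $h_0,\delta_0\in(0,1)$, $c_1,c_2>0$, $\tau_0>1$ and $C>0$ (independent of $h$, $\tau$ and $u$) such that for all $h\in(0,h_0)$, all $\tau\in(\tau_0,\delta_0h^{-1})$ and all $u:(h\mathbb{Z})^d\to\mathbb{R}$ with $P_hu=0$ in $B_4$ it holds that $$\|u\|_{L^2(B_1)}\le C\left(e^{c_1\tau}\|u\|_{L^2(B_{1/2})}+e^{-c_2\tau}\|u\|_{L^2(B_2)}\right).$$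
   Context: For $h>0$ and $f:(h\mathbb{Z})^d\to\mathbb{R}$, with $e_j$ the $j$-th unit vector, set $D^h_{\pm,j}f(n):=\pm(f(n\pm he_j)-f(n))$ and $\Delta_df(n):=\sum_{j=1}^dD^h_{-,j}D^h_{+,j}f(n)=\sum_{j=1}^d\big(f(n+he_j)+f(n-he_j)-2f(n)\big)$ (the non-normalized discrete Laplacian). The discrete magnetic Schrödinger operator is $$P_hf(n):=h^{-2}\Delta_df(n)+h^{-1}\sum_{j=1}^dB_j(n)D^h_{+,j}f(n)+V(n)f(n),\qquad B=(B_1,\dots,B_d).$$ For $r>0$, $B_r:=B_r(0)\cap(h\mathbb{Z})^d$, where $B_r(0)$ is the Euclidean ball in $\mathbb{R}^d$ of radius $r$ centred at $0$ (the set $B_r$ is not to be confused with the components $B_j$ of the field $B$). All $L^2$ norms are $L^2$ norms on the lattice: $\|u\|_{L^2(B_r)}^2=\sum_{n\in B_r}|u(n)|^2$. *)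

theory Defs
  imports "HOL-Analysis.Analysis"
begin

(* The dimension d is CARD('n). A function on the lattice is represented by a function on all of
   real^'n; the values off the lattice are never used. *)

definition lattice :: "real \<Rightarrow> (real ^ 'n::finite) set" where
  "lattice h = {x. \<forall>j. \<exists>k::int. x $ j = h * of_int k}"

definition lattice_ball :: "real \<Rightarrow> real \<Rightarrow> (real ^ 'n::finite) set" where
  "lattice_ball h r = ball 0 r \<inter> lattice h"

definition fwd_diff :: "real \<Rightarrow> 'n \<Rightarrow> (real ^ 'n::finite \<Rightarrow> real) \<Rightarrow> real ^ 'n \<Rightarrow> real" where
  "fwd_diff h j f n = f (n + h *\<^sub>R axis j 1) - f n"

definition bwd_diff :: "real \<Rightarrow> 'n \<Rightarrow> (real ^ 'n::finite \<Rightarrow> real) \<Rightarrow> real ^ 'n \<Rightarrow> real" where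
  "bwd_diff h j f n = - (f (n - h *\<^sub>R axis j 1) - f n)"

definition discrete_laplacian :: "real \<Rightarrow> (real ^ 'n::finite \<Rightarrow> real) \<Rightarrow> real ^ 'n \<Rightarrow> real" where
  "discrete_laplacian h f n = (\<Sum>j\<in>UNIV. bwd_diff h j (fwd_diff h j f) n)"

definition magnetic_schroedinger ::
  "real \<Rightarrow> (real ^ 'n::finite \<Rightarrow> real ^ 'n) \<Rightarrow> (real ^ 'n \<Rightarrow> real)
    \<Rightarrow> (real ^ 'n \<Rightarrow> real) \<Rightarrow> real ^ 'n \<Rightarrow> real" where
  "magnetic_schroedinger h B V f n =
     discrete_laplacian h f n / h\<^sup>2 + (\<Sum>j\<in>UNIV. B n $ j * fwd_diff h j f n) / h + V n * f n"

lemma discrete_laplacian_eq: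
  "discrete_laplacian h f n =
     (\<Sum>j\<in>UNIV. f (n + h *\<^sub>R axis j 1) + f (n - h *\<^sub>R axis j 1) - 2 * f n)"
  by (simp add: discrete_laplacian_def bwd_diff_def fwd_diff_def)

(* Hence sums over lattice balls, and so the L2_set norms, are never the default value 0
   of a sum over an infinite set. *)
lemma finite_lattice_ball:
  assumes "h > 0"
  shows "finite (lattice_ball h r :: (real ^ 'n::finite) set)"
proof -
  define K where "K = {- \<lceil>r / h\<rceil>..\<lceil>r / h\<rceil>}"
  have "lattice_ball h r \<subseteq> (\<lambda>k::'n \<Rightarrow> int. \<chi> j. h * of_int (k j)) ` (UNIV \<rightarrow>\<^sub>E K)"
  proof
    fix x :: "real ^ 'n"
    assume "x \<in> lattice_ball h r"
    then have nx: "norm x < r" and "\<forall>j. \<exists>k::int. x $ j = h * of_int k"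
      by (auto simp: lattice_ball_def lattice_def)
    then obtain k :: "'n \<Rightarrow> int" where k: "x $ j = h * of_int (k j)" for j
      by metis
    have "k j \<in> K" for j
    proof -
      have "\<bar>h * of_int (k j)\<bar> < r"
        using component_le_norm_cart[of x j] nx k by simp
      then have "\<bar>of_int (k j)\<bar> < r / h"
        using assms by (simp add: abs_mult pos_less_divide_eq mult.commute)
      then have "of_int \<bar>k j\<bar> \<le> (of_int \<lceil>r / h\<rceil> :: real)"
        using le_of_int_ceiling[of "r / h"] by linarith
      then show ?thesis
        unfolding K_def of_int_le_iff by auto
    qed
    moreover have "x = (\<chi> j. h * of_int (k j))"
      by (simp add: vec_eq_iff k)
    ultimately show "x \<in> (\<lambda>k. \<chi> j. h * of_int (k j)) ` (UNIV \<rightarrow>\<^sub>E K)"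
      by auto
  qed
  moreover have "finite (UNIV \<rightarrow>\<^sub>E K :: ('n \<Rightarrow> int) set)"
    by (intro finite_PiE) (auto simp: K_def)
  ultimately show ?thesis
    by (meson finite_imageI finite_subset)
qed

end

theory Submission
  imports Defs
begin

text \<open>
  The proof is a Carleman estimate with the weight \<open>\<phi> x = exp (- 20 \<bar>x\<bar>\<^sup>2)\<close>. Conjugating the discrete
  Laplacian with \<open>exp (\<tau> \<phi>)\<close> gives \<open>S + A\<close>, where the edge coefficients of the symmetric part \<open>S\<close> are
  hyperbolic cosines, and those of the antisymmetric part \<open>A\<close> hyperbolic sines, of differences of \<open>\<tau> \<phi>\<close>.
  By the addition theorems the commutator form \<open>2 \<langle>S f, A f\<rangle>\<close> is an exact sum over pairs of
  directions whose coefficients contain only the mixed second differences of \<open>\<tau> \<phi>\<close>, and for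
  \<open>\<tau> h \<le> \<epsilon>\<close> it agrees up to a relative error \<open>O(\<epsilon>)\<close> with its continuous counterpart
  \<open>4 \<tau> \<phi>''(\<nabla>f, \<nabla>f) + 4 \<tau>\<^sup>3 \<phi>''(\<nabla>\<phi>, \<nabla>\<phi>) f\<^sup>2\<close>. Subtracting \<open>\<langle>S f, \<tau> g f\<rangle>\<close> with \<open>g = 240 \<phi>\<close> makes both terms
  positive away from the origin. The estimate is applied to a solution that is cut off near the
  spheres of radius 0.35 and 1.55; the first order terms created by the cutoff are controlled by a
  Caccioppoli inequality.
\<close>

section \<open>Sums over the lattice and the conjugated Laplacian\<close>

text \<open>For a weight \<open>exp (- \<lambda> * |x|^2)\<close> the Hessian is negative in
  directions orthogonal to x, where it equals \<open>- 2 * \<lambda> * \<phi>\<close>. A multiplier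
  \<open>g = \<gamma> * \<phi>\<close> repairs the gradient form once \<gamma> > 8 * \<lambda>, but
  it costs positivity of the zeroth order form, which becomes \<open>4 * \<lambda>^2 * |x|^2 * (16 *
  \<lambda>^2 * |x|^2 - 8 * \<lambda> - \<gamma>) * \<phi>^3\<close>. With \<gamma> = 12 * \<lambda>
  it is positive for |x|^2 > 5 / (4 * \<lambda>); \<lambda> = 20 makes this |x| > 1/4 and leaves
  room for the inner cutoff inside the ball of radius 1/2. The exponential gain comes from three
  values of the weight only: at most 1 everywhere, at least exp (-20) on the unit ball, and at most
  exp (-39.2) from radius 1.4 on, which contains the outer cutoff region. The two limits on \<tau>
  play different parts. \<tau> * h \<le> \<epsilon> keeps the increments of the weight along an edge
  small, so that hyperbolic functions can be expanded; \<tau> \<ge> 1 / \<epsilon> lets terms with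
  one power of \<tau> less, including those of B and V, be absorbed.\<close>

definition step :: "real \<Rightarrow> 'n \<Rightarrow> real ^ 'n::finite" where
  "step h j = h *\<^sub>R axis j 1"

lemma fwd_diff_step: "fwd_diff h j f n = f (n + step h j) - f n"
  by (simp add: fwd_diff_def step_def)

lemma norm_step [simp]: "norm (step h j) = \<bar>h\<bar>"
  by (simp add: step_def)

lemma lattice_add: "x \<in> lattice h \<Longrightarrow> y \<in> lattice h \<Longrightarrow> x + y \<in> lattice h"
  unfolding lattice_def by simp (metis distrib_left of_int_add)

lemma lattice_uminus: "x \<in> lattice h \<Longrightarrow> - x \<in> lattice h"
  unfolding lattice_def by simp (metis mult_minus_right of_int_minus)

lemma lattice_diff: "x \<in> lattice h \<Longrightarrow> y \<in> lattice h \<Longrightarrow> x - y \<in> lattice h"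
  using lattice_add[of x h "- y"] lattice_uminus[of y h] by simp

lemma step_in_lattice: "step h j \<in> lattice h"
proof -
  have "\<exists>k::int. step h j $ i = h * of_int k" for i
    by (rule exI[of _ "if i = j then 1 else 0"]) (simp add: step_def axis_def)
  then show ?thesis by (simp add: lattice_def)
qed

lemmas lattice_intros = lattice_add lattice_diff lattice_uminus step_in_lattice

text \<open>The window of radius 3 is a finite substitute for the whole lattice: a shift by at most
  1/2 gains or loses only points of norm at least 5/2, where \<open>F\<close> vanishes. All
  summations by parts reduce to this.\<close>

lemma sum_lattice_translate:
  fixes v :: "real ^ 'n::finite" and F :: "real ^ 'n \<Rightarrow> real"
  assumes h: "h > 0" and v: "v \<in> lattice h" "norm v \<le> 1/2"
    and F: "\<And>n. n \<in> lattice h \<Longrightarrow> 5/2 \<le> norm n \<Longrightarrow> F n = 0"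
  shows "(\<Sum>n\<in>lattice_ball h 3. F (n + v)) = (\<Sum>n\<in>lattice_ball h 3. F n)"
proof -
  let ?L = "lattice_ball h 3 :: (real ^ 'n) set"
  let ?M = "(\<lambda>n. n + v) ` ?L"
  have "(\<Sum>n\<in>?L. F (n + v)) = (\<Sum>n\<in>?M. F n)"
    by (simp add: sum.reindex)
  also have "\<dots> = (\<Sum>n\<in>?M \<inter> ?L. F n)"
  proof (intro sum.mono_neutral_right ballI)
    fix n assume n: "n \<in> ?M - ?M \<inter> ?L"
    then obtain m where "m \<in> ?L" "n = m + v" by blast
    then have "n \<in> lattice h" using v by (auto simp: lattice_ball_def intro: lattice_add)
    with n show "F n = 0" by (intro F) (auto simp: lattice_ball_def)
  qed (auto simp: finite_lattice_ball[OF h])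
  also have "\<dots> = (\<Sum>n\<in>?L. F n)"
  proof (intro sum.mono_neutral_left ballI)
    fix n assume n: "n \<in> ?L - ?M \<inter> ?L"
    then have "n - v \<notin> ?L" by (metis DiffE IntI diff_add_cancel imageI)
    moreover have "n \<in> lattice h" using n by (auto simp: lattice_ball_def)
    moreover have "n - v \<in> lattice h" using \<open>n \<in> lattice h\<close> v by (auto intro: lattice_diff)
    ultimately have "3 \<le> norm (n - v)" by (auto simp: lattice_ball_def)
    also have "\<dots> \<le> norm n + norm v" by (rule norm_triangle_ineq4)
    finally show "F n = 0" using F v \<open>n \<in> lattice h\<close> by auto
  qed (auto simp: finite_lattice_ball[OF h])
  finally show ?thesis .
qed

section \<open>Hyperbolic addition formulas on a lattice square\<close>

lemma sinh_diff_prod: "sinh x - sinh y = 2 * cosh ((x + y) / 2) * sinh ((x - y) / (2::real))"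
proof -
  define m w where "m = (x + y) / 2" and "w = (x - y) / 2"
  have "x = m + w" "y = m - w" by (auto simp: m_def w_def field_simps)
  then show ?thesis unfolding m_def[symmetric] w_def[symmetric] by (simp add: sinh_add sinh_diff)
qed

lemma cosh_diff_prod: "cosh x - cosh y = 2 * sinh ((x + y) / 2) * sinh ((x - y) / (2::real))"
proof -
  define m w where "m = (x + y) / 2" and "w = (x - y) / 2"
  have "x = m + w" "y = m - w" by (auto simp: m_def w_def field_simps)
  then show ?thesis unfolding m_def[symmetric] w_def[symmetric] by (simp add: cosh_add cosh_diff)
qed

text \<open>\<open>a\<close>, \<open>b\<close>, \<open>c\<close>, \<open>d\<close> are the weights
  at the corners n, n + e_j, n + e_k, n + e_j + e_k of a lattice square. The product formula for
  differences of sinh extracts from both coefficients the same factor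
  \<open>sinh (d + a - b - c)\<close>, which vanishes for affine weights: this is the discrete trace
  of the commutator seeing only second derivatives.\<close>

lemma hyperbolic_symmetrization:
  fixes a b c d x y :: real
  shows "(cosh (d - c) * sinh (d - b) - cosh (b - a) * sinh (c - a)) * x
       + (cosh (d - c) * sinh (c - a) - cosh (b - a) * sinh (d - b)) * y
       + ((cosh (d - b) * sinh (d - c) - cosh (c - a) * sinh (b - a)) * x
       + (cosh (d - b) * sinh (b - a) - cosh (c - a) * sinh (d - c)) * y)
      = 2 * (sinh (d + a - b - c) * (cosh (d - a) * x - cosh (c - b) * y))"
proof -
  have "cosh (d - c) * sinh (d - b) + cosh (d - b) * sinh (d - c) = sinh ((d - c) + (d - b))"
    "cosh (b - a) * sinh (c - a) + cosh (c - a) * sinh (b - a) = sinh ((b - a) + (c - a))"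
    unfolding sinh_add by (simp_all add: ac_simps)
  moreover have "sinh ((d - c) + (d - b)) - sinh ((b - a) + (c - a)) = 2 * cosh (d - a) * sinh (d + a - b - c)"
    unfolding sinh_diff_prod by (rule arg_cong2[of _ _ _ _ "\<lambda>x y. 2 * cosh x * sinh y"]) (auto simp: field_simps)
  moreover have "cosh (d - c) * sinh (c - a) - cosh (c - a) * sinh (d - c) = sinh ((c - a) - (d - c))"
     "cosh (d - b) * sinh (b - a) - cosh (b - a) * sinh (d - b) = sinh ((b - a) - (d - b))"
    unfolding sinh_diff by (simp_all add: ac_simps)
  moreover have "sinh ((b - a) - (d - b)) + sinh ((c - a) - (d - c)) = - 2 * cosh (c - b) * sinh (d + a - b - c)"
  proof -
    have "((b - a) - (d - b) + - ((c - a) - (d - c))) / 2 = - (c - b)"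
      "((b - a) - (d - b) - - ((c - a) - (d - c))) / 2 = - (d + a - b - c)"
      by (simp_all add: field_simps)
    then show ?thesis
      using sinh_diff_prod[of "(b - a) - (d - b)" "- ((c - a) - (d - c))"]
      by (simp only: sinh_minus cosh_minus)
  qed
  ultimately have "(cosh (d - c) * sinh (d - b) + cosh (d - b) * sinh (d - c)
      - (cosh (b - a) * sinh (c - a) + cosh (c - a) * sinh (b - a))) = 2 * cosh (d - a) * sinh (d + a - b - c)"
    "(cosh (d - c) * sinh (c - a) - cosh (c - a) * sinh (d - c)) +
      (cosh (d - b) * sinh (b - a) - cosh (b - a) * sinh (d - b)) = - 2 * cosh (c - b) * sinh (d + a - b - c)"
    by linarith+
  then have "(cosh (d - c) * sinh (d - b) + cosh (d - b) * sinh (d - c)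
      - (cosh (b - a) * sinh (c - a) + cosh (c - a) * sinh (b - a))) * x +
    ((cosh (d - c) * sinh (c - a) - cosh (c - a) * sinh (d - c)) +
      (cosh (d - b) * sinh (b - a) - cosh (b - a) * sinh (d - b))) * y
   = 2 * cosh (d - a) * sinh (d + a - b - c) * x - 2 * cosh (c - b) * sinh (d + a - b - c) * y"
    by simp
  then show ?thesis by (simp add: algebra_simps)
qed

section \<open>The symmetric and antisymmetric parts of the conjugated Laplacian\<close>

definition sym_part :: "real \<Rightarrow> (real ^ 'n::finite \<Rightarrow> real) \<Rightarrow> (real ^ 'n \<Rightarrow> real) \<Rightarrow> real ^ 'n \<Rightarrow> real" where
  "sym_part h a f n = (\<Sum>j\<in>UNIV. cosh (a (n + step h j) - a n) * f (n + step h j)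
     + cosh (a n - a (n - step h j)) * f (n - step h j) - 2 * f n)"

definition asym_part :: "real \<Rightarrow> (real ^ 'n::finite \<Rightarrow> real) \<Rightarrow> (real ^ 'n \<Rightarrow> real) \<Rightarrow> real ^ 'n \<Rightarrow> real" where
  "asym_part h a f n = (\<Sum>j\<in>UNIV. sinh (a n - a (n - step h j)) * f (n - step h j)
     - sinh (a (n + step h j) - a n) * f (n + step h j))"

text \<open>With f = exp a * v a neighbour p contributes \<open>exp (a n - a p) * f p\<close>, and
  \<open>exp (- y) = cosh y - sinh y\<close>. Increments are always taken in the positive direction,
  so seen from its two ends an edge has equal cosh coefficients and opposite sinh
  coefficients.\<close>

lemma conjugated_laplacian:
  "exp (a n) * discrete_laplacian h v n =
    sym_part h a (\<lambda>n. exp (a n) * v n) n + asym_part h a (\<lambda>n. exp (a n) * v n) n"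
proof -
  have "exp (a n) * (v p + v m - 2 * v n) =
     cosh (a p - a n) * (exp (a p) * v p) + cosh (a n - a m) * (exp (a m) * v m) - 2 * (exp (a n) * v n)
     + (sinh (a n - a m) * (exp (a m) * v m) - sinh (a p - a n) * (exp (a p) * v p))" for p m
  proof -
    have "cosh (a p - a n) - sinh (a p - a n) = exp (a n - a p)"
      "cosh (a n - a m) + sinh (a n - a m) = exp (a n - a m)"
      by (simp_all add: cosh_minus_sinh cosh_plus_sinh)
    moreover have "exp (a n - a p) * exp (a p) = exp (a n)" "exp (a n - a m) * exp (a m) = exp (a n)"
      by (simp_all flip: exp_add)
    ultimately have "exp (a n) = (cosh (a p - a n) - sinh (a p - a n)) * exp (a p)"
      "exp (a n) = (cosh (a n - a m) + sinh (a n - a m)) * exp (a m)"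
      by simp_all
    then have "exp (a n) * v p = (cosh (a p - a n) - sinh (a p - a n)) * exp (a p) * v p"
      "exp (a n) * v m = (cosh (a n - a m) + sinh (a n - a m)) * exp (a m) * v m"
      by simp_all
    then show ?thesis by (simp add: algebra_simps)
  qed
  then show ?thesis
    unfolding sym_part_def asym_part_def discrete_laplacian_eq step_def[symmetric]
    by (simp add: sum_distrib_left flip: sum.distrib)
qed

text \<open>The radii are nested to leave room for shifts: \<open>f\<close> lives inside radius 2,
  products with up to two steps of length \<open>h\<close> vanish beyond 5/2, and sums run over
  radius 3.\<close>

locale supported_function =
  fixes h :: real and f :: "real ^ 'n::finite \<Rightarrow> real"
  assumes h_pos: "0 < h" and h_small: "h \<le> 1/10"
    and f_supp: "n \<in> lattice h \<Longrightarrow> 2 \<le> norm n \<Longrightarrow> f n = 0"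
begin

abbreviation "L \<equiv> lattice_ball h 3 :: (real ^ 'n) set"

lemma f_zero:
  assumes "n \<in> lattice h" "w \<in> lattice h" "norm w \<le> 1/2" "5/2 \<le> norm n"
  shows "f (n + w) = 0"
proof -
  have "norm n \<le> norm (n + w) + norm w" using norm_triangle_ineq4[of "n+w" w] by simp
  then show ?thesis using assms by (intro f_supp lattice_add) auto
qed

lemma norm_step2: "norm (step h j + step h k :: real ^ 'n) \<le> 1/2" "norm (step h j - step h k :: real ^ 'n) \<le> 1/2"
  using norm_triangle_ineq[of "step h j" "step h k :: real ^ 'n"]
  norm_triangle_ineq4[of "step h j" "step h k :: real ^ 'n"] h_pos h_small by auto

lemma f_zeros:
  assumes "n \<in> lattice h" "5/2 \<le> norm n"
  shows "f n = 0" "f (n + step h j) = 0" "f (n - step h j) = 0"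
    "f (n + step h j + step h k) = 0" "f (n + step h j - step h k) = 0"
    "f (n - step h j + step h k) = 0"
proof -
  show "f n = 0" using assms by (intro f_supp) auto
  show "f (n + step h j) = 0" using assms h_pos h_small by (intro f_zero step_in_lattice) auto
  show "f (n - step h j) = 0" using assms h_pos h_small f_zero[of n "- step h j"] by (auto intro: lattice_intros)
  show "f (n + step h j + step h k) = 0" using assms norm_step2(1)[of j k] f_zero[of n "step h j + step h k"]
    by (auto intro: lattice_intros simp: add.assoc)
  show "f (n + step h j - step h k) = 0" using assms norm_step2(2)[of j k] f_zero[of n "step h j - step h k"]
    by (auto intro: lattice_intros simp: algebra_simps)
  show "f (n - step h j + step h k) = 0" using assms norm_step2(2)[of k j] f_zero[of n "step h k - step h j"]
    by (auto intro: lattice_intros simp: algebra_simps)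
qed

lemma sum_shift:
  assumes "\<And>n. n \<in> lattice h \<Longrightarrow> 5/2 \<le> norm n \<Longrightarrow> F n = (0::real)"
  shows "(\<Sum>n\<in>L. F (n + step h j)) = (\<Sum>n\<in>L. F n)"
  using h_pos h_small by (intro sum_lattice_translate assms step_in_lattice) auto

lemma sum_shift2:
  assumes "\<And>n. n \<in> lattice h \<Longrightarrow> 5/2 \<le> norm n \<Longrightarrow> F n = (0::real)"
  shows "(\<Sum>n\<in>L. F (n + step h j + step h k)) = (\<Sum>n\<in>L. F n)"
  using sum_lattice_translate[OF h_pos _ norm_step2(1) assms, of j k]
  by (simp add: add.assoc lattice_intros)

text \<open>Every edge occurs twice with opposite signs. This is what removes the diagonal term
  \<open>- 2 * f n\<close> of the symmetric part from the commutator.\<close>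

lemma sum_f_asym:
  "(\<Sum>n\<in>L. f n * (sinh (a n - a (n - step h k)) * f (n - step h k)
     - sinh (a (n + step h k) - a n) * f (n + step h k))) = 0"
proof -
  have "(\<Sum>n\<in>L. f n * sinh (a n - a (n - step h k)) * f (n - step h k)) =
     (\<Sum>n\<in>L. f (n + step h k) * sinh (a (n + step h k) - a n) * f n)"
    by (subst sum_shift[symmetric, of _ k]) (simp_all add: f_zeros)
  then show ?thesis by (simp add: algebra_simps sum_subtractf)
qed

text \<open>The commutator identity behind the Carleman estimate. It is exact for every weight \<open>a\<close>: after
  symmetrizing in \<open>j\<close> and \<open>k\<close> the addition theorems leave only the mixed second difference of \<open>a\<close>.\<close>

lemma sum_sym_asym:
  "(\<Sum>n\<in>L. sym_part h a f n * asym_part h a f n) =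
    (\<Sum>n\<in>L. \<Sum>j\<in>UNIV. \<Sum>k\<in>UNIV.
      sinh (a (n + step h j + step h k) + a n - a (n + step h j) - a (n + step h k)) *
      (cosh (a (n + step h j + step h k) - a n) * (f (n + step h j) * f (n + step h k))
       - cosh (a (n + step h k) - a (n + step h j)) * (f n * f (n + step h j + step h k))))"
proof -
  \<comment> \<open>\<open>X j k\<close> is what remains once every product has been shifted to the
    square spanned by directions j and k: only the products over its two diagonals survive.\<close>
  define X where "X j k n =
     (cosh (a (n + step h j + step h k) - a (n + step h k)) * sinh (a (n + step h j + step h k) - a (n + step h j))
      - cosh (a (n + step h j) - a n) * sinh (a (n + step h k) - a n)) * (f (n + step h j) * f (n + step h k))
     + (cosh (a (n + step h j + step h k) - a (n + step h k)) * sinh (a (n + step h k) - a n)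
      - cosh (a (n + step h j) - a n) * sinh (a (n + step h j + step h k) - a (n + step h j)))
       * (f n * f (n + step h j + step h k))" for j k n
  define Sj where "Sj j n = cosh (a (n + step h j) - a n) * f (n + step h j)
     + cosh (a n - a (n - step h j)) * f (n - step h j) - 2 * f n" for j n
  define Ak where "Ak k n = sinh (a n - a (n - step h k)) * f (n - step h k)
     - sinh (a (n + step h k) - a n) * f (n + step h k)" for k n
  have comm: "n + step h k + step h j = n + step h j + step h k" for n :: "real ^ 'n" and j k
    by (simp add: ac_simps)
  have 1: "(\<Sum>n\<in>L. Sj j n * Ak k n) = (\<Sum>n\<in>L. X j k n)" for j k
  proof -
    have t1: "(\<Sum>n\<in>L. cosh (a (n + step h j) - a n) * f (n + step h j) * (sinh (a n - a (n - step h k)) * f (n - step h k)))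
      = (\<Sum>n\<in>L. cosh (a (n + step h j + step h k) - a (n + step h k)) * f (n + step h j + step h k) * (sinh (a (n + step h k) - a n) * f n))"
      by (subst sum_shift[symmetric, of _ k]) (simp_all add: f_zeros comm[of _ k j])
    have t2: "(\<Sum>n\<in>L. cosh (a n - a (n - step h j)) * f (n - step h j) * (sinh (a n - a (n - step h k)) * f (n - step h k)))
      = (\<Sum>n\<in>L. cosh (a (n + step h j + step h k) - a (n + step h k)) * f (n + step h k) *
          (sinh (a (n + step h j + step h k) - a (n + step h j)) * f (n + step h j)))"
    proof -
      have "n + step h j + step h k - step h j = n + step h k" for n :: "real ^ 'n" by simp
      then show ?thesis
        by (subst sum_shift2[symmetric, of _ j k]) (simp_all add: f_zeros)
    qed
    have t3: "(\<Sum>n\<in>L. cosh (a n - a (n - step h j)) * f (n - step h j) * (sinh (a (n + step h k) - a n) * f (n + step h k)))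
      = (\<Sum>n\<in>L. cosh (a (n + step h j) - a n) * f n *
          (sinh (a (n + step h j + step h k) - a (n + step h j)) * f (n + step h j + step h k)))"
      by (subst sum_shift[symmetric, of _ j]) (simp_all add: f_zeros)
    have t4: "(\<Sum>n\<in>L. f n * Ak k n) = 0" unfolding Ak_def by (rule sum_f_asym)
    have "(\<Sum>n\<in>L. Sj j n * Ak k n) =
      (\<Sum>n\<in>L. cosh (a (n + step h j) - a n) * f (n + step h j) * (sinh (a n - a (n - step h k)) * f (n - step h k)))
      - (\<Sum>n\<in>L. cosh (a (n + step h j) - a n) * f (n + step h j) * (sinh (a (n + step h k) - a n) * f (n + step h k)))
      + (\<Sum>n\<in>L. cosh (a n - a (n - step h j)) * f (n - step h j) * (sinh (a n - a (n - step h k)) * f (n - step h k)))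
      - (\<Sum>n\<in>L. cosh (a n - a (n - step h j)) * f (n - step h j) * (sinh (a (n + step h k) - a n) * f (n + step h k)))
      - 2 * (\<Sum>n\<in>L. f n * Ak k n)"
      unfolding sum_distrib_left sum_subtractf[symmetric] sum.distrib[symmetric] Sj_def Ak_def
      by (rule sum.cong) (auto simp: algebra_simps)
    also have "\<dots> = (\<Sum>n\<in>L. X j k n)"
      unfolding t1 t2 t3 t4 X_def
      unfolding sum_distrib_left sum_subtractf[symmetric] sum.distrib[symmetric] mult_zero_right diff_zero
      by (rule sum.cong) (auto simp: algebra_simps)
    finally show ?thesis .
  qed
  have "(\<Sum>n\<in>L. sym_part h a f n * asym_part h a f n) = (\<Sum>n\<in>L. \<Sum>j\<in>UNIV. \<Sum>k\<in>UNIV. Sj j n * Ak k n)"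
    by (simp add: sym_part_def asym_part_def sum_product Sj_def Ak_def)
  also have "\<dots> = (\<Sum>j\<in>UNIV. \<Sum>n\<in>L. \<Sum>k\<in>UNIV. Sj j n * Ak k n)" by (rule sum.swap)
  also have "\<dots> = (\<Sum>j\<in>UNIV. \<Sum>k\<in>UNIV. \<Sum>n\<in>L. X j k n)"
    by (intro sum.cong refl) (subst sum.swap, simp add: 1)
  also have "\<dots> = (\<Sum>j\<in>UNIV. \<Sum>n\<in>L. \<Sum>k\<in>UNIV. X j k n)" by (intro sum.cong refl sum.swap)
  also have "\<dots> = (\<Sum>n\<in>L. \<Sum>j\<in>UNIV. \<Sum>k\<in>UNIV. X j k n)" by (rule sum.swap)
  also have "\<dots> = (\<Sum>n\<in>L. \<Sum>j\<in>UNIV. \<Sum>k\<in>UNIV.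
      sinh (a (n + step h j + step h k) + a n - a (n + step h j) - a (n + step h k)) *
      (cosh (a (n + step h j + step h k) - a n) * (f (n + step h j) * f (n + step h k))
       - cosh (a (n + step h k) - a (n + step h j)) * (f n * f (n + step h j + step h k))))"
    (is "_ = (\<Sum>n\<in>L. \<Sum>j\<in>UNIV. \<Sum>k\<in>UNIV. ?Y n j k)")
  proof (rule sum.cong[OF refl])
    fix n
    \<comment> \<open>\<open>X j k\<close> alone is not a multiple of the sinh of the mixed second
      difference; under the double sum it may be averaged with \<open>X k j\<close>.\<close>
    have "X j k n + X k j n = 2 * ?Y n j k" for j k
      unfolding X_def comm[of n k j] mult.commute[of "f (n + step h k)" "f (n + step h j)"]
      by (rule hyperbolic_symmetrization)
    then have "2 * (\<Sum>j\<in>UNIV. \<Sum>k\<in>UNIV. ?Y n j k) = (\<Sum>j\<in>UNIV. \<Sum>k\<in>UNIV. X j k n + X k j n)"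
      by (simp add: sum_distrib_left)
    also have "\<dots> = (\<Sum>j\<in>UNIV. \<Sum>k\<in>UNIV. X j k n) + (\<Sum>j\<in>UNIV. \<Sum>k\<in>UNIV. X k j n)"
      by (simp add: sum.distrib)
    also have "(\<Sum>j\<in>UNIV. \<Sum>k\<in>UNIV. X k j n) = (\<Sum>j\<in>UNIV. \<Sum>k\<in>UNIV. X j k n)" by (rule sum.swap)
    finally show "(\<Sum>j\<in>UNIV. \<Sum>k\<in>UNIV. X j k n) = (\<Sum>j\<in>UNIV. \<Sum>k\<in>UNIV. ?Y n j k)" by simp
  qed
  finally show ?thesis .
qed

end

section \<open>Pointwise estimates\<close>

lemma abs_sinh_diff_le:
  fixes y :: real assumes "\<bar>y\<bar> \<le> 1" shows "\<bar>sinh y - y\<bar> \<le> \<bar>y\<bar> ^ 3"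
proof -
  have *: "\<bar>sinh y - y\<bar> \<le> \<bar>y\<bar> ^ 3" if "0 \<le> y" "y \<le> 1" for y :: real
  proof -
    obtain t where t: "\<bar>t\<bar> \<le> \<bar>y\<bar>" "exp y = (\<Sum>m<3. y ^ m / fact m) + exp t / fact 3 * y ^ 3"
      using Maclaurin_exp_le[of y 3] by auto
    obtain r where r: "\<bar>r\<bar> \<le> \<bar>-y\<bar>" "exp (-y) = (\<Sum>m<3. (-y) ^ m / fact m) + exp r / fact 3 * (-y) ^ 3"
      using Maclaurin_exp_le[of "-y" 3] by auto
    have eq: "sinh y - y = (exp t + exp r) / 12 * y ^ 3"
      unfolding sinh_field_def t(2) r(2) by (simp add: eval_nat_numeral field_simps)
    have "exp t \<le> 3" "exp r \<le> 3"
      using t(1) r(1) that exp_le[THEN order_trans[rotated], of "exp t"] exp_le[THEN order_trans[rotated], of "exp r"]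
      by auto
    then have "\<bar>sinh y - y\<bar> = (exp t + exp r) / 12 * \<bar>y\<bar> ^ 3" "(exp t + exp r) / 12 \<le> 1"
      unfolding eq using that by (simp_all add: abs_mult add_nonneg_nonneg)
    then show ?thesis by (metis mult_right_mono mult_1 zero_le_power abs_ge_zero)
  qed
  show ?thesis using *[of y] *[of "-y"] assms by (cases "0 \<le> y") (auto simp: sinh_minus)
qed

lemma abs_sinh_le:
  fixes y :: real assumes "\<bar>y\<bar> \<le> 1" shows "\<bar>sinh y\<bar> \<le> 2 * \<bar>y\<bar>"
proof -
  have "\<bar>y\<bar> ^ 3 \<le> \<bar>y\<bar>" using power_decreasing[of 1 3 "\<bar>y\<bar>"] assms by simp
  then show ?thesis using abs_sinh_diff_le[OF assms] by linarith
qed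

lemma abs_cosh_diff_le:
  fixes y :: real assumes "\<bar>y\<bar> \<le> 1" shows "\<bar>cosh y - 1 - y\<^sup>2 / 2\<bar> \<le> y ^ 4"
proof -
  obtain t where t: "\<bar>t\<bar> \<le> \<bar>y\<bar>" "exp y = (\<Sum>m<4. y ^ m / fact m) + exp t / fact 4 * y ^ 4"
    using Maclaurin_exp_le[of y 4] by auto
  obtain r where r: "\<bar>r\<bar> \<le> \<bar>-y\<bar>" "exp (-y) = (\<Sum>m<4. (-y) ^ m / fact m) + exp r / fact 4 * (-y) ^ 4"
    using Maclaurin_exp_le[of "-y" 4] by auto
  have eq: "cosh y - 1 - y\<^sup>2 / 2 = (exp t + exp r) / 48 * y ^ 4"
    unfolding cosh_field_def t(2) r(2) by (simp add: eval_nat_numeral field_simps)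
  have "exp t \<le> 3" "exp r \<le> 3"
    using t(1) r(1) assms exp_le[THEN order_trans[rotated], of "exp t"] exp_le[THEN order_trans[rotated], of "exp r"]
    by auto
  then have "\<bar>cosh y - 1 - y\<^sup>2 / 2\<bar> = (exp t + exp r) / 48 * y ^ 4" "(exp t + exp r) / 48 \<le> 1"
    unfolding eq by (simp_all add: abs_mult add_nonneg_nonneg)
  then show ?thesis by (metis mult_right_mono mult_1 zero_le_even_power even_numeral)
qed

lemma cosh_le:
  fixes y :: real assumes "\<bar>y\<bar> \<le> 1" shows "cosh y - 1 \<le> y\<^sup>2"
proof -
  have "cosh y - 1 = 2 * (sinh (y/2))\<^sup>2"
    using cosh_diff_prod[of y 0] by (simp add: power2_eq_square)
  also have "\<dots> \<le> 2 * (\<bar>y/2\<bar> + \<bar>y/2\<bar>^3)\<^sup>2"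
    using abs_sinh_diff_le[of "y/2"] assms by (intro mult_left_mono abs_le_square_iff[THEN iffD1]) auto
  \<comment> \<open>For |y/2| \<le> 1/2 the cubic term costs at most a quarter of the linear one,
    and 2 * (5/4)^2 / 4 is still below 1.\<close>
  also have "\<dots> \<le> 2 * ((5/4) * \<bar>y/2\<bar>)\<^sup>2"
  proof -
    have "\<bar>y/2\<bar>^2 \<le> (1/2)^2" using assms by (intro power_mono) auto
    then have "\<bar>y/2\<bar>^2 * \<bar>y/2\<bar> \<le> (1/4) * \<bar>y/2\<bar>" by (intro mult_right_mono) (auto simp: power2_eq_square)
    then have "\<bar>y/2\<bar>^3 \<le> (1/4) * \<bar>y/2\<bar>" by (simp add: eval_nat_numeral)
    then show ?thesis by (intro mult_left_mono power_mono) auto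
  qed
  also have "\<dots> \<le> y\<^sup>2" by (simp add: power2_eq_square abs_if)
  finally show ?thesis .
qed

lemma weighted_amgm:
  fixes x y A B c :: real
  assumes "c\<^sup>2 = A * B" "0 \<le> A" "0 \<le> B" "0 \<le> c"
  shows "c * \<bar>x * y\<bar> \<le> (A * x\<^sup>2 + B * y\<^sup>2) / 2"
proof -
  have c: "c = sqrt A * sqrt B" using assms by (metis real_sqrt_mult real_sqrt_unique)
  have "2 * (sqrt A * \<bar>x\<bar>) * (sqrt B * \<bar>y\<bar>) \<le> (sqrt A * \<bar>x\<bar>)\<^sup>2 + (sqrt B * \<bar>y\<bar>)\<^sup>2"
    using sum_squares_bound by blast
  then show ?thesis unfolding c using assms by (simp add: power_mult_distrib abs_mult ac_simps)
qed

text \<open>Errors are measured against \<open>\<tau>\<^sup>3 h\<^sup>4 f\<^sup>2\<close>, \<open>\<tau> h\<^sup>2 (D f)\<^sup>2\<close> and \<open>\<tau>\<^sup>-\<^sup>1 (D\<^sup>2 f)\<^sup>2\<close>; the last term is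
  available because the symmetric part is elliptic at frequencies above \<open>\<tau>\<close>. In this
  scale every error in the pointwise lemmas below gains a factor \<open>\<epsilon>\<close>.\<close>

locale small_parameters =
  fixes h \<tau> \<epsilon> K :: real
  assumes h_pos: "0 < h" and h_le: "h \<le> \<epsilon>" and \<tau>_pos: "0 < \<tau>" and \<tau>h_le: "\<tau> * h \<le> \<epsilon>"
    and \<tau>_inv_le: "1 \<le> \<tau> * \<epsilon>"
    and K_ge: "1 \<le> K" and K\<epsilon>_le: "4 * K * \<epsilon> \<le> 1"
begin

lemma \<epsilon>_pos: "0 < \<epsilon>" using h_pos h_le by linarith

lemma \<epsilon>_le: "\<epsilon> \<le> 1/4"
proof -
  have "1 * \<epsilon> \<le> K * \<epsilon>" using K_ge \<epsilon>_pos by (intro mult_right_mono) auto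
  then show ?thesis using K\<epsilon>_le by linarith
qed

lemma K_pos: "0 < K" using K_ge by linarith

lemma h_le_quarter: "h \<le> 1/4" using h_le \<epsilon>_le by linarith

text \<open>Each prefactor is the geometric mean of two weights of the error scale; for instance
  \<open>\<tau> * h^2\<close> is the root of \<open>\<tau>^3 * h^4\<close> times
  \<open>1 / \<tau>\<close>. A product of f and its differences is therefore harmless exactly when
  its coefficient beats this mean by a factor \<epsilon>.\<close>

lemma cross_bounds:
  "\<tau> * h\<^sup>2 * \<bar>x * w\<bar> \<le> (\<tau>^3 * h^4 * x\<^sup>2 + w\<^sup>2 / \<tau>) / 2"
  "\<tau> * h\<^sup>2 * \<bar>u * v\<bar> \<le> (\<tau> * h\<^sup>2 * u\<^sup>2 + \<tau> * h\<^sup>2 * v\<^sup>2) / 2"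
  "\<tau>\<^sup>2 * h^3 * \<bar>x * u\<bar> \<le> (\<tau>^3 * h^4 * x\<^sup>2 + \<tau> * h\<^sup>2 * u\<^sup>2) / 2"
  "h * \<bar>v * w\<bar> \<le> (\<tau> * h\<^sup>2 * v\<^sup>2 + w\<^sup>2 / \<tau>) / 2"
proof -
  note [simp] = h_pos \<tau>_pos h_pos[THEN less_imp_le] \<tau>_pos[THEN less_imp_le]
  show "\<tau> * h\<^sup>2 * \<bar>x * w\<bar> \<le> (\<tau>^3 * h^4 * x\<^sup>2 + w\<^sup>2 / \<tau>) / 2"
    using weighted_amgm[of "\<tau> * h\<^sup>2" "\<tau>^3 * h^4" "1/\<tau>" x w] by (simp add: eval_nat_numeral)
  show "\<tau> * h\<^sup>2 * \<bar>u * v\<bar> \<le> (\<tau> * h\<^sup>2 * u\<^sup>2 + \<tau> * h\<^sup>2 * v\<^sup>2) / 2"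
    using weighted_amgm[of "\<tau> * h\<^sup>2" "\<tau> * h\<^sup>2" "\<tau> * h\<^sup>2" u v] by (simp add: eval_nat_numeral)
  show "\<tau>\<^sup>2 * h^3 * \<bar>x * u\<bar> \<le> (\<tau>^3 * h^4 * x\<^sup>2 + \<tau> * h\<^sup>2 * u\<^sup>2) / 2"
    using weighted_amgm[of "\<tau>\<^sup>2 * h^3" "\<tau>^3 * h^4" "\<tau> * h\<^sup>2" x u] by (simp add: eval_nat_numeral)
  show "h * \<bar>v * w\<bar> \<le> (\<tau> * h\<^sup>2 * v\<^sup>2 + w\<^sup>2 / \<tau>) / 2"
    using weighted_amgm[of h "\<tau> * h\<^sup>2" "1/\<tau>" v w] \<tau>_pos less_imp_neq[OF \<tau>_pos] by (simp add: eval_nat_numeral)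
qed

lemma cross_bounds_total:
  fixes x w u v :: real
  defines "N \<equiv> \<tau>^3 * h^4 * x\<^sup>2 + \<tau> * h\<^sup>2 * (u\<^sup>2 + v\<^sup>2) + w\<^sup>2 / \<tau>"
  shows "\<tau> * h\<^sup>2 * \<bar>x * w\<bar> \<le> N / 2" "\<tau> * h\<^sup>2 * \<bar>u * v\<bar> \<le> N / 2"
    "\<tau>\<^sup>2 * h^3 * \<bar>x * u\<bar> \<le> N / 2" "\<tau>\<^sup>2 * h^3 * \<bar>x * v\<bar> \<le> N / 2" "h * \<bar>v * w\<bar> \<le> N / 2"
    "0 \<le> N" "\<tau>^3 * h^4 * x\<^sup>2 \<le> N" "\<tau> * h\<^sup>2 * \<bar>u * v\<bar> + \<tau> * h\<^sup>2 * \<bar>x * w\<bar> \<le> N" "\<tau> * h\<^sup>2 * \<bar>u * v\<bar> \<le> N"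
proof -
  have nn: "0 \<le> \<tau>^3 * h^4 * x\<^sup>2" "0 \<le> \<tau> * h\<^sup>2 * u\<^sup>2" "0 \<le> \<tau> * h\<^sup>2 * v\<^sup>2" "0 \<le> w\<^sup>2 / \<tau>"
    using h_pos \<tau>_pos by simp_all
  have N: "N = \<tau>^3 * h^4 * x\<^sup>2 + (\<tau> * h\<^sup>2 * u\<^sup>2 + \<tau> * h\<^sup>2 * v\<^sup>2) + w\<^sup>2 / \<tau>"
    unfolding N_def by (simp only: distrib_left)
  have half: "z \<le> (a + d) / 2 \<Longrightarrow> z \<le> (a + (b + c) + d) / 2"
     "z \<le> (b + c) / 2 \<Longrightarrow> z \<le> (a + (b + c) + d) / 2"
     "z \<le> (a + b) / 2 \<Longrightarrow> z \<le> (a + (b + c) + d) / 2"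
     "z \<le> (a + c) / 2 \<Longrightarrow> z \<le> (a + (b + c) + d) / 2"
     "z \<le> (c + d) / 2 \<Longrightarrow> z \<le> (a + (b + c) + d) / 2"
     "0 \<le> a + (b + c) + d" "a \<le> a + (b + c) + d"
     "y \<le> (b + c) / 2 \<Longrightarrow> z \<le> (a + d) / 2 \<Longrightarrow> y + z \<le> a + (b + c) + d"
     "y \<le> (b + c) / 2 \<Longrightarrow> y \<le> a + (b + c) + d"
    if "0 \<le> a" "0 \<le> b" "0 \<le> c" "0 \<le> d" for y z a b c d :: real
    using that by (auto simp: field_simps)
  show "\<tau> * h\<^sup>2 * \<bar>x * w\<bar> \<le> N / 2" "\<tau> * h\<^sup>2 * \<bar>u * v\<bar> \<le> N / 2"
    "\<tau>\<^sup>2 * h^3 * \<bar>x * u\<bar> \<le> N / 2" "\<tau>\<^sup>2 * h^3 * \<bar>x * v\<bar> \<le> N / 2" "h * \<bar>v * w\<bar> \<le> N / 2"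
    "0 \<le> N" "\<tau>^3 * h^4 * x\<^sup>2 \<le> N" "\<tau> * h\<^sup>2 * \<bar>u * v\<bar> + \<tau> * h\<^sup>2 * \<bar>x * w\<bar> \<le> N" "\<tau> * h\<^sup>2 * \<bar>u * v\<bar> \<le> N"
    unfolding N
    by (rule half[OF nn] cross_bounds)+
qed

lemma increment_bounds:
  assumes s: "\<bar>s - \<tau> * h * p\<bar> \<le> \<tau> * K * h\<^sup>2" and p: "\<bar>p\<bar> \<le> K"
  shows "\<bar>s\<bar> \<le> 2 * K * (\<tau> * h)" "\<bar>s\<bar> \<le> 1/2"
proof -
  have "\<bar>\<tau> * h * p\<bar> \<le> \<tau> * h * K" using p h_pos \<tau>_pos by (simp add: abs_mult)
  moreover have "\<tau> * K * h\<^sup>2 \<le> \<tau> * h * K"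
  proof -
    have "(\<tau> * K * h) * h \<le> (\<tau> * K * h) * 1" using h_le_quarter h_pos \<tau>_pos K_pos by (intro mult_left_mono) auto
    then show ?thesis by (simp add: power2_eq_square ac_simps)
  qed
  ultimately show 1: "\<bar>s\<bar> \<le> 2 * K * (\<tau> * h)" using s by (simp add: algebra_simps)
  have "2 * K * (\<tau> * h) \<le> 2 * K * \<epsilon>" using \<tau>h_le K_pos by (intro mult_left_mono) auto
  then show "\<bar>s\<bar> \<le> 1/2" using 1 K\<epsilon>_le by linarith
qed

text \<open>\<open>s\<close>, \<open>r\<close> are the increments of the weight in directions j and
  k, \<open>\<theta>\<close> is its mixed second difference; \<open>x\<close>, \<open>u\<close>,
  \<open>v\<close>, \<open>w\<close> are f, its two first differences and its mixed second
  difference. Two facts drive the expansion: \<open>cosh (s + r + \<theta>) - cosh (r - s)\<close>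
  factors into two sinh, giving the product of first derivatives, and
  \<open>(x + u) * (x + v) - x * (x + u + v + w) = u * v - x * w\<close>.\<close>

lemma commutator_pointwise:
  assumes s: "\<bar>s - \<tau> * h * p\<bar> \<le> \<tau> * K * h\<^sup>2" and r: "\<bar>r - \<tau> * h * p'\<bar> \<le> \<tau> * K * h\<^sup>2"
    and \<theta>: "\<bar>\<theta> - \<tau> * h\<^sup>2 * q\<bar> \<le> \<tau> * K * h ^ 3"
    and bd: "\<bar>p\<bar> \<le> K" "\<bar>p'\<bar> \<le> K" "\<bar>q\<bar> \<le> K"
  shows "\<bar>sinh \<theta> * (cosh (s + r + \<theta>) * ((x + u) * (x + v)) - cosh (r - s) * (x * (x + u + v + w)))
      - (\<tau> * h\<^sup>2 * q * (u * v - x * w) + 2 * \<tau>^3 * h^4 * q * p * p' * x\<^sup>2)\<bar>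
    \<le> 368 * K^4 * \<epsilon> * (\<tau>^3 * h^4 * x\<^sup>2 + \<tau> * h\<^sup>2 * (u\<^sup>2 + v\<^sup>2) + w\<^sup>2 / \<tau>)" (is "\<bar>?E\<bar> \<le> 368 * K^4 * \<epsilon> * ?N")
proof -
  note [simp] = h_pos \<tau>_pos \<epsilon>_pos K_pos h_pos[THEN less_imp_le] \<tau>_pos[THEN less_imp_le]
    \<epsilon>_pos[THEN less_imp_le] K_pos[THEN less_imp_le]
  define \<alpha> where "\<alpha> = sinh \<theta>"
  define \<beta> where "\<beta> = cosh (r - s) - 1"
  define S1 where "S1 = sinh (s + \<theta>/2)"
  define S2 where "S2 = sinh (r + \<theta>/2)"
  define Z where "Z = u * v - x * w"
  define R where "R = x * v + x * u + u * v"
  define t where "t = \<tau> * h"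
  have t0: "0 < t" "t \<le> \<epsilon>" using \<tau>h_le by (auto simp: t_def)
  have th2: "\<tau> * h\<^sup>2 = t * h" by (simp add: t_def power2_eq_square)
  have Kt: "K * t \<le> 1/4"
  proof -
    have "K * t \<le> K * \<epsilon>" using t0 by (intro mult_left_mono) auto
    then show ?thesis using K\<epsilon>_le by linarith
  qed
  have th: "t * h \<le> t / 4" using h_le_quarter mult_left_mono[of h "1/4" t] t0 by auto
  have \<theta>1: "\<bar>\<theta>\<bar> \<le> 2 * K * (t * h)"
  proof -
    have "\<bar>\<tau> * h\<^sup>2 * q\<bar> \<le> (t * h) * K" using bd t0 by (simp add: abs_mult th2)
    moreover have "(t * h) * K * h \<le> (t * h) * K * 1" using h_le_quarter t0 by (intro mult_left_mono) auto
    then have "\<tau> * K * h ^ 3 \<le> (t * h) * K" by (simp add: t_def eval_nat_numeral ac_simps)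
    ultimately have "\<bar>\<theta>\<bar> \<le> (t * h) * K + (t * h) * K" using \<theta> by linarith
    then show ?thesis by (simp add: algebra_simps)
  qed
  have \<theta>2: "\<bar>\<theta>\<bar> \<le> K * t / 2"
  proof -
    have "2 * K * (t * h) \<le> 2 * K * (t / 4)" using th by (intro mult_left_mono) auto
    also have "\<dots> = K * t / 2" by simp
    finally show ?thesis using \<theta>1 by linarith
  qed
  then have \<theta>3: "\<bar>\<theta>\<bar> \<le> 1/2" using Kt by linarith
  have \<alpha>1: "\<bar>\<alpha> - t * h * q\<bar> \<le> 2 * K * \<epsilon> * (t * h)"
  proof -
    have "\<bar>\<theta>\<bar> ^ 3 \<le> (2 * K * (t * h)) ^ 3" using \<theta>1 by (intro power_mono) auto
    also have "\<dots> = (t * h) * (K * t) * (K * t) * (8 * K * h * h)" by (simp add: eval_nat_numeral)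
    also have "\<dots> \<le> (t * h) * (1/4) * (1/4) * (8 * K * \<epsilon> * (1/4))"
      using Kt t0 h_le h_le_quarter by (intro mult_mono) auto
    also have "\<dots> \<le> K * \<epsilon> * (t * h)" using t0 by (simp add: field_simps)
    finally have 1: "\<bar>\<theta>\<bar> ^ 3 \<le> K * \<epsilon> * (t * h)" .
    have "\<tau> * K * h ^ 3 = K * h * (t * h)" by (simp add: t_def eval_nat_numeral)
    also have "\<dots> \<le> K * \<epsilon> * (t * h)" using h_le t0 by (intro mult_right_mono mult_left_mono) auto
    finally have "\<tau> * K * h ^ 3 \<le> K * \<epsilon> * (t * h)" .
    then have "\<bar>\<theta> - t * h * q\<bar> \<le> K * \<epsilon> * (t * h)" using \<theta> unfolding th2 by linarith
    then show ?thesis using 1 abs_sinh_diff_le[of \<theta>] \<theta>3 unfolding \<alpha>_def by simp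
  qed
  have \<alpha>2: "\<bar>\<alpha>\<bar> \<le> 4 * K * (t * h)"
    using abs_sinh_le[of \<theta>] \<theta>1 \<theta>3 unfolding \<alpha>_def by simp
  have sb: "\<bar>s\<bar> \<le> 2 * K * t" "\<bar>s\<bar> \<le> 1/2" and rb: "\<bar>r\<bar> \<le> 2 * K * t" "\<bar>r\<bar> \<le> 1/2"
    using increment_bounds[OF s bd(1)] increment_bounds[OF r bd(2)] by (auto simp: t_def)
  have \<beta>: "0 \<le> \<beta>" "\<beta> \<le> 4 * K * \<epsilon>"
  proof -
    show "0 \<le> \<beta>" by (simp add: \<beta>_def cosh_real_ge_1)
    have "\<beta> \<le> (r - s)\<^sup>2" unfolding \<beta>_def using sb rb by (intro cosh_le) auto
    also have "\<dots> = \<bar>r - s\<bar> ^ 2" by simp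
    also have "\<dots> \<le> (4 * K * t) ^ 2" using sb rb by (intro power_mono) auto
    also have "\<dots> = 4 * (4 * (K * t)) * (K * t)" by (simp add: power2_eq_square)
    also have "\<dots> \<le> 4 * (4 * (1/4)) * (K * \<epsilon>)" using Kt t0 by (intro mult_mono) auto
    finally show "\<beta> \<le> 4 * K * \<epsilon>" by (simp add: ac_simps)
  qed
  have S: "\<bar>sinh (s' + \<theta>/2) - t * P\<bar> \<le> 4 * K\<^sup>2 * \<epsilon> * t" "\<bar>sinh (s' + \<theta>/2)\<bar> \<le> 4 * K * t"
    if s': "\<bar>s' - \<tau> * h * P\<bar> \<le> \<tau> * K * h\<^sup>2" and P: "\<bar>P\<bar> \<le> K" for s' P
  proof -
    have 0: "\<bar>s' - t * P\<bar> \<le> K * (t * h)" using s' by (simp add: t_def power2_eq_square ac_simps)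
    have 1: "\<bar>s' + \<theta>/2 - t * P\<bar> \<le> 2 * K * (t * h)" using 0 \<theta>1 by linarith
    have "K * (t * h) \<le> K * (t / 4)" using th by (intro mult_left_mono) auto
    also have "\<dots> = K * t / 4" by simp
    finally have "K * (t * h) \<le> K * t / 4" .
    moreover have "\<bar>t * P\<bar> \<le> K * t" using P t0 by (simp add: abs_mult)
    ultimately have 2: "\<bar>s' + \<theta>/2\<bar> \<le> 2 * K * t" using 0 \<theta>2 by linarith
    have 3: "\<bar>s' + \<theta>/2\<bar> \<le> 1" using 2 Kt by linarith
    have "\<bar>s' + \<theta>/2\<bar> ^ 3 \<le> (2 * K * t) ^ 3" using 2 by (intro power_mono) auto
    also have "\<dots> = 8 * K\<^sup>2 * t * (K * t) * t" by (simp add: eval_nat_numeral)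
    also have "\<dots> \<le> 8 * K\<^sup>2 * \<epsilon> * (1/4) * t" using Kt t0 by (intro mult_mono) auto
    finally have 4: "\<bar>s' + \<theta>/2\<bar> ^ 3 \<le> 2 * K\<^sup>2 * \<epsilon> * t" by (simp add: ac_simps)
    have "2 * K * (t * h) = 2 * K * h * t" by simp
    also have "\<dots> \<le> 2 * K\<^sup>2 * \<epsilon> * t"
      using h_le K_ge t0 self_le_power[of K 2] by (intro mult_mono) auto
    finally show "\<bar>sinh (s' + \<theta>/2) - t * P\<bar> \<le> 4 * K\<^sup>2 * \<epsilon> * t"
      using abs_sinh_diff_le[OF 3] 4 1 by linarith
    have "\<bar>sinh (s' + \<theta>/2)\<bar> \<le> 2 * \<bar>s' + \<theta>/2\<bar>" by (rule abs_sinh_le[OF 3])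
    also have "\<dots> \<le> 2 * (2 * K * t)" using 2 by (intro mult_left_mono) auto
    finally show "\<bar>sinh (s' + \<theta>/2)\<bar> \<le> 4 * K * t" by (simp add: ac_simps)
  qed
  have S1: "\<bar>S1 - t * p\<bar> \<le> 4 * K\<^sup>2 * \<epsilon> * t" "\<bar>S1\<bar> \<le> 4 * K * t" unfolding S1_def using S s bd by auto
  have S2: "\<bar>S2 - t * p'\<bar> \<le> 4 * K\<^sup>2 * \<epsilon> * t" "\<bar>S2\<bar> \<le> 4 * K * t" unfolding S2_def using S r bd by auto
  have S12: "\<bar>S1 * S2\<bar> \<le> 16 * K\<^sup>2 * t\<^sup>2"
  proof -
    have "\<bar>S1\<bar> * \<bar>S2\<bar> \<le> (4 * K * t) * (4 * K * t)" using S1 S2 t0 by (intro mult_mono) auto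
    then show ?thesis by (simp add: abs_mult power2_eq_square ac_simps)
  qed
  have tri: "\<bar>a * b + c * d\<bar> \<le> \<bar>a\<bar> * \<bar>b\<bar> + \<bar>c\<bar> * \<bar>d\<bar>" for a b c d :: real
    by (metis abs_mult abs_triangle_ineq)
  have SS: "\<bar>S1 * S2 - t\<^sup>2 * p * p'\<bar> \<le> 20 * K^3 * \<epsilon> * t\<^sup>2"
  proof -
    have "S1 * S2 - t\<^sup>2 * p * p' = (S1 - t * p) * S2 + t * p * (S2 - t * p')"
      by (simp add: algebra_simps power2_eq_square)
    also have "\<bar>\<dots>\<bar> \<le> \<bar>S1 - t * p\<bar> * \<bar>S2\<bar> + \<bar>t * p\<bar> * \<bar>S2 - t * p'\<bar>"
      by (rule tri)
    also have "\<dots> \<le> (4 * K\<^sup>2 * \<epsilon> * t) * (4 * K * t) + (K * t) * (4 * K\<^sup>2 * \<epsilon> * t)"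
      using S1 S2 t0 bd by (intro add_mono mult_mono) (auto simp: abs_mult)
    also have "\<dots> = 20 * K^3 * \<epsilon> * t\<^sup>2" by (simp add: eval_nat_numeral)
    finally show ?thesis .
  qed
  have A: "\<bar>\<alpha> * (2 * (S1 * S2)) - 2 * (t * h) * q * t\<^sup>2 * p * p'\<bar> \<le> 104 * K^4 * \<epsilon> * (t^3 * h)"
  proof -
    have "\<alpha> * (2 * (S1 * S2)) - 2 * (t * h) * q * t\<^sup>2 * p * p' =
       2 * ((\<alpha> - t * h * q) * (S1 * S2) + t * h * q * (S1 * S2 - t\<^sup>2 * p * p'))"
      by (simp add: algebra_simps)
    also have "\<bar>\<dots>\<bar> \<le> 2 * (\<bar>\<alpha> - t * h * q\<bar> * \<bar>S1 * S2\<bar> + \<bar>t * h * q\<bar> * \<bar>S1 * S2 - t\<^sup>2 * p * p'\<bar>)"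
      unfolding abs_mult[of 2] abs_numeral by (intro mult_left_mono tri) auto
    also have "\<dots> \<le> 2 * ((2 * K * \<epsilon> * (t * h)) * (16 * K\<^sup>2 * t\<^sup>2) + (t * h * K) * (20 * K^3 * \<epsilon> * t\<^sup>2))"
      using \<alpha>1 S12 SS t0 bd by (intro add_mono mult_left_mono mult_mono) (auto simp: abs_mult)
    also have "\<dots> = 64 * K^3 * \<epsilon> * (t^3 * h) + 40 * K^4 * \<epsilon> * (t^3 * h)" by (simp add: eval_nat_numeral algebra_simps)
    also have "\<dots> \<le> 64 * K^4 * \<epsilon> * (t^3 * h) + 40 * K^4 * \<epsilon> * (t^3 * h)"
      using t0 K_ge by (intro add_right_mono mult_right_mono mult_left_mono power_increasing) auto
    finally show ?thesis by (simp add: ac_simps)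
  qed
  have t3: "t^3 * h = \<tau>^3 * h^4" by (simp add: t_def eval_nat_numeral)
  note N0 = cross_bounds_total(6,7)[where x = x and w = w and u = u and v = v]
  note N2 = cross_bounds_total(9,3,4,8)[where x = x and w = w and u = u and v = v]
  have ZN: "t * h * \<bar>Z\<bar> \<le> ?N"
  proof -
    have "t * h * \<bar>Z\<bar> \<le> t * h * (\<bar>u * v\<bar> + \<bar>x * w\<bar>)" unfolding Z_def using t0 by (intro mult_left_mono) auto
    also have "\<dots> \<le> ?N" using N2(4) unfolding th2 by (simp only: distrib_left)
    finally show ?thesis .
  qed
  have RN: "t^3 * h * \<bar>R\<bar> \<le> 2 * \<epsilon> * ?N"
  proof -
    have "t^3 * h * \<bar>R\<bar> \<le> t^3 * h * (\<bar>x * v\<bar> + \<bar>x * u\<bar> + \<bar>u * v\<bar>)"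
      unfolding R_def using t0 by (intro mult_left_mono) auto
    also have "\<dots> = t * (\<tau>\<^sup>2 * h^3 * \<bar>x * v\<bar> + \<tau>\<^sup>2 * h^3 * \<bar>x * u\<bar> + t * (\<tau> * h\<^sup>2 * \<bar>u * v\<bar>))"
      by (simp add: t_def eval_nat_numeral algebra_simps)
    also have "\<dots> \<le> \<epsilon> * (?N / 2 + ?N / 2 + 1 * ?N)"
      using N2(1-3) N0 t0 \<epsilon>_le by (intro mult_mono add_mono) auto
    finally show ?thesis by (simp add: ac_simps)
  qed
  \<comment> \<open>Factors are replaced by their leading parts one at a time. Three summands carry
    a Taylor error; the one with \<open>R\<close> is small because \<open>t^3 * h\<close> beats by
    at least one power of \<open>t\<close> the weight allowed for products containing a
    difference.\<close>
  have E: "?E = (\<alpha> * (2 * (S1 * S2)) - 2 * (t * h) * q * t\<^sup>2 * p * p') * x\<^sup>2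
      + \<alpha> * (2 * (S1 * S2)) * R + (\<alpha> - t * h * q) * ((1 + \<beta>) * Z) + t * h * q * (\<beta> * Z)"
  proof -
    have "cosh (s + r + \<theta>) = cosh (r - s) + 2 * (S1 * S2)"
    proof -
      have "(s + r + \<theta> + (r - s)) / 2 = r + \<theta>/2" "(s + r + \<theta> - (r - s)) / 2 = s + \<theta>/2" by auto
      then have "cosh (s + r + \<theta>) - cosh (r - s) = 2 * sinh (r + \<theta>/2) * sinh (s + \<theta>/2)"
        unfolding cosh_diff_prod by (simp only:)
      then show ?thesis unfolding S1_def S2_def by (simp only: algebra_simps)
    qed
    moreover have "cosh (r - s) = 1 + \<beta>" by (simp add: \<beta>_def)
    moreover have "2 * \<tau>^3 * h^4 = 2 * (t * h) * t\<^sup>2" by (simp add: t_def eval_nat_numeral)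
    ultimately show ?thesis unfolding \<alpha>_def[symmetric] Z_def R_def th2
      by (simp add: algebra_simps power2_eq_square)
  qed
  have B1: "\<bar>(\<alpha> * (2 * (S1 * S2)) - 2 * (t * h) * q * t\<^sup>2 * p * p') * x\<^sup>2\<bar> \<le> 104 * K^4 * \<epsilon> * ?N"
  proof -
    have "\<bar>(\<alpha> * (2 * (S1 * S2)) - 2 * (t * h) * q * t\<^sup>2 * p * p') * x\<^sup>2\<bar> \<le> 104 * K^4 * \<epsilon> * (t^3 * h) * x\<^sup>2"
      unfolding abs_mult[of _ "x\<^sup>2"] using A t0 by (intro mult_mono) auto
    also have "\<dots> \<le> 104 * K^4 * \<epsilon> * ?N" using N0 unfolding t3 mult.assoc by (intro mult_left_mono) auto
    finally show ?thesis .
  qed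
  have K34: "K \<le> K^4" "K\<^sup>2 \<le> K^4" "K^3 \<le> K^4" using K_ge by (auto intro: self_le_power power_increasing)
  have B2: "\<bar>\<alpha> * (2 * (S1 * S2)) * R\<bar> \<le> 256 * K^4 * \<epsilon> * ?N"
  proof -
    have "\<bar>\<alpha> * (2 * (S1 * S2)) * R\<bar> = \<bar>\<alpha>\<bar> * (2 * \<bar>S1 * S2\<bar>) * \<bar>R\<bar>" by (simp add: abs_mult)
    also have "\<dots> \<le> (4 * K * (t * h)) * (2 * (16 * K\<^sup>2 * t\<^sup>2)) * \<bar>R\<bar>"
      using \<alpha>2 S12 t0 by (intro mult_mono) auto
    also have "\<dots> = 128 * K^3 * (t^3 * h * \<bar>R\<bar>)" by (simp add: eval_nat_numeral)
    also have "\<dots> \<le> 128 * K^4 * (2 * \<epsilon> * ?N)" using K34 t0 by (intro mult_mono[OF _ RN] mult_left_mono) auto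
    finally show ?thesis by (simp add: algebra_simps)
  qed
  have B3: "\<bar>(\<alpha> - t * h * q) * ((1 + \<beta>) * Z)\<bar> \<le> 4 * K^4 * \<epsilon> * ?N"
  proof -
    have "\<bar>(\<alpha> - t * h * q) * ((1 + \<beta>) * Z)\<bar> = \<bar>\<alpha> - t * h * q\<bar> * ((1 + \<beta>) * \<bar>Z\<bar>)"
      using \<beta> by (simp add: abs_mult)
    also have "\<dots> \<le> 2 * K * \<epsilon> * (t * h) * (2 * \<bar>Z\<bar>)"
      using \<alpha>1 \<beta> K\<epsilon>_le t0 by (intro mult_mono) auto
    also have "\<dots> = 4 * K * \<epsilon> * (t * h * \<bar>Z\<bar>)" by simp
    also have "\<dots> \<le> 4 * K^4 * \<epsilon> * ?N" using ZN K34 t0 by (intro mult_mono) auto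
    finally show ?thesis .
  qed
  have B4: "\<bar>t * h * q * (\<beta> * Z)\<bar> \<le> 4 * K^4 * \<epsilon> * ?N"
  proof -
    have "\<bar>t * h * q * (\<beta> * Z)\<bar> = (\<bar>q\<bar> * \<beta>) * (t * h * \<bar>Z\<bar>)" using \<beta> t0 by (simp add: abs_mult)
    also have "\<dots> \<le> (K * (4 * K * \<epsilon>)) * ?N" using ZN bd \<beta> t0 by (intro mult_mono) auto
    also have "\<dots> = 4 * K\<^sup>2 * \<epsilon> * ?N" by (simp add: power2_eq_square)
    also have "\<dots> \<le> 4 * K^4 * \<epsilon> * ?N" using K34 N0 by (intro mult_right_mono mult_left_mono) auto
    finally show ?thesis .
  qed
  have "\<bar>?E\<bar> \<le> 104 * K^4 * \<epsilon> * ?N + 256 * K^4 * \<epsilon> * ?N + 4 * K^4 * \<epsilon> * ?N + 4 * K^4 * \<epsilon> * ?N"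
    unfolding E using B1 B2 B3 B4 by linarith
  also have "\<dots> = 368 * K^4 * \<epsilon> * ?N" by (simp only: distrib_right[symmetric]) simp
  finally show ?thesis .
qed

text \<open>Bounds the debris of turning \<open>- x * w\<close> into \<open>u * v\<close> by a
  summation by parts. \<open>q'\<close> is the Hessian entry at the shifted point, so
  \<open>q' - q\<close> supplies a factor \<open>h\<close>, while \<open>v * w\<close> has a
  coefficient that exceeds the admissible one by the factor \<open>\<tau> * h\<close>.\<close>

lemma by_parts_pointwise:
  assumes q: "\<bar>q\<bar> \<le> K" "\<bar>q' - q\<bar> \<le> K * h"
  shows "\<bar>\<tau> * h\<^sup>2 * (q * v * w + (q' - q) * (x + v) * (u + w))\<bar>
    \<le> 3 * K * \<epsilon> * (\<tau>^3 * h^4 * x\<^sup>2 + \<tau> * h\<^sup>2 * (u\<^sup>2 + v\<^sup>2) + w\<^sup>2 / \<tau>)" (is "_ \<le> 3 * K * \<epsilon> * ?N")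
proof -
  note [simp] = h_pos \<tau>_pos \<epsilon>_pos K_pos h_pos[THEN less_imp_le] \<tau>_pos[THEN less_imp_le]
    \<epsilon>_pos[THEN less_imp_le] K_pos[THEN less_imp_le]
  note N = cross_bounds_total[where x = x and w = w and u = u and v = v]
  have N: "\<tau> * h\<^sup>2 * \<bar>x * w\<bar> \<le> ?N / 2" "\<tau> * h\<^sup>2 * \<bar>u * v\<bar> \<le> ?N / 2" "\<tau>\<^sup>2 * h^3 * \<bar>x * u\<bar> \<le> ?N / 2" "h * \<bar>v * w\<bar> \<le> ?N / 2" "0 \<le> ?N"
    by (rule N)+
  have xu: "\<tau> * h^3 * \<bar>x * u\<bar> \<le> \<epsilon> * (?N / 2)"
  proof -
    have "1 * (\<tau> * h^3 * \<bar>x * u\<bar>) \<le> \<tau> * \<epsilon> * (\<tau> * h^3 * \<bar>x * u\<bar>)"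
      using \<tau>_inv_le by (intro mult_right_mono) auto
    also have "\<dots> = \<epsilon> * (\<tau>\<^sup>2 * h^3 * \<bar>x * u\<bar>)" by (simp add: power2_eq_square)
    also have "\<dots> \<le> \<epsilon> * (?N / 2)" using N by (intro mult_left_mono) auto
    finally show ?thesis by (simp add: ac_simps)
  qed
  have xw: "\<tau> * h^3 * \<bar>x * w\<bar> \<le> \<epsilon> * (?N / 2)"
  proof -
    have "\<tau> * h^3 * \<bar>x * w\<bar> = h * (\<tau> * h\<^sup>2 * \<bar>x * w\<bar>)" by (simp add: eval_nat_numeral)
    also have "\<dots> \<le> \<epsilon> * (?N / 2)" using N h_le by (intro mult_mono) auto
    finally show ?thesis .
  qed
  have uv: "\<tau> * h^3 * \<bar>v * u\<bar> \<le> \<epsilon> * (?N / 2)"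
  proof -
    have "\<tau> * h^3 * \<bar>v * u\<bar> = h * (\<tau> * h\<^sup>2 * \<bar>u * v\<bar>)" by (simp add: eval_nat_numeral mult.commute)
    also have "\<dots> \<le> \<epsilon> * (?N / 2)" using N h_le by (intro mult_mono) auto
    finally show ?thesis .
  qed
  have vw: "\<tau> * h^2 * \<bar>v * w\<bar> \<le> \<epsilon> * (?N / 2)"
  proof -
    have "\<tau> * h^2 * \<bar>v * w\<bar> = (\<tau> * h) * (h * \<bar>v * w\<bar>)" by (simp add: eval_nat_numeral)
    also have "\<dots> \<le> \<epsilon> * (?N / 2)" using N \<tau>h_le by (intro mult_mono) auto
    finally show ?thesis .
  qed
  have vw3: "\<tau> * h^3 * \<bar>v * w\<bar> \<le> \<epsilon> * (?N / 2)"
  proof -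
    have "h * (\<tau> * h^2 * \<bar>v * w\<bar>) \<le> 1 * (\<tau> * h^2 * \<bar>v * w\<bar>)" using h_le_quarter by (intro mult_right_mono) auto
    moreover have "\<tau> * h^3 * \<bar>v * w\<bar> = h * (\<tau> * h^2 * \<bar>v * w\<bar>)" by (simp add: eval_nat_numeral)
    ultimately show ?thesis using vw by linarith
  qed
  have "\<bar>\<tau> * h\<^sup>2 * (q * v * w + (q' - q) * (x + v) * (u + w))\<bar> \<le>
     \<tau> * h\<^sup>2 * (\<bar>q\<bar> * \<bar>v * w\<bar> + \<bar>q' - q\<bar> * \<bar>(x + v) * (u + w)\<bar>)"
    unfolding abs_mult[of "\<tau> * h\<^sup>2"]
    by (intro mult_mono) (auto simp: abs_mult[symmetric] mult.assoc)
  also have "\<dots> \<le> \<tau> * h\<^sup>2 * (K * \<bar>v * w\<bar> + (K * h) * (\<bar>x * u\<bar> + \<bar>x * w\<bar> + \<bar>v * u\<bar> + \<bar>v * w\<bar>))"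
    using q by (intro mult_left_mono add_mono mult_mono) (auto simp: algebra_simps)
  also have "\<dots> = K * (\<tau> * h\<^sup>2 * \<bar>v * w\<bar> + \<tau> * h^3 * \<bar>x * u\<bar> + \<tau> * h^3 * \<bar>x * w\<bar>
     + \<tau> * h^3 * \<bar>v * u\<bar> + \<tau> * h^3 * \<bar>v * w\<bar>)"
    by (simp add: eval_nat_numeral algebra_simps)
  also have "\<dots> \<le> K * (\<epsilon> * (?N / 2) + \<epsilon> * (?N / 2) + \<epsilon> * (?N / 2) + \<epsilon> * (?N / 2) + \<epsilon> * (?N / 2))"
    using xu xw uv vw vw3 by (intro mult_left_mono add_mono) auto
  also have "\<dots> = (5/2) * (K * \<epsilon> * ?N)"
  proof -
    have "K * (z + z + z + z + z) = 5 * (K * z)" for z by (simp add: algebra_simps)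
    then show ?thesis by simp
  qed
  also have "\<dots> \<le> 3 * (K * \<epsilon> * ?N)" using N(5) by (intro mult_right_mono mult_nonneg_nonneg) auto
  finally show ?thesis by (simp add: ac_simps)
qed

text \<open>Expansion of a single edge term of the multiplier. The zeroth order part has coefficient
  one because \<open>cosh s - 1\<close> is close to half of \<open>(\<tau> * h * p)^2\<close> while
  \<open>x^2 + (x + u)^2\<close> is close to \<open>2 * x^2\<close>.\<close>

lemma multiplier_pointwise:
  assumes s: "\<bar>s - \<tau> * h * p\<bar> \<le> \<tau> * K * h\<^sup>2"
    and bd: "\<bar>p\<bar> \<le> K" "\<bar>g\<bar> \<le> K" "\<bar>g' - g\<bar> \<le> K * h"
  shows "\<bar>- (\<tau> * h\<^sup>2) * (- cosh s * (g + g') * u\<^sup>2 / 2 + (cosh s - 1) * (g + g') * (x\<^sup>2 + (x + u)\<^sup>2) / 2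
       - (g' - g) * u * (2 * x + u) / 2) - (\<tau> * h\<^sup>2 * g * u\<^sup>2 - \<tau>^3 * h^4 * g * p\<^sup>2 * x\<^sup>2)\<bar>
    \<le> 36 * K^4 * \<epsilon> * (\<tau>^3 * h^4 * x\<^sup>2 + \<tau> * h\<^sup>2 * u\<^sup>2)" (is "\<bar>?E\<bar> \<le> 36 * K^4 * \<epsilon> * ?N")
proof -
  note [simp] = h_pos \<tau>_pos \<epsilon>_pos K_pos h_pos[THEN less_imp_le] \<tau>_pos[THEN less_imp_le]
    \<epsilon>_pos[THEN less_imp_le] K_pos[THEN less_imp_le]
  define t where "t = \<tau> * h"
  have t0: "0 < t" "t \<le> \<epsilon>" using \<tau>h_le by (auto simp: t_def)
  have th2: "\<tau> * h\<^sup>2 = t * h" and t3: "\<tau>^3 * h^4 = t^3 * h" by (simp_all add: t_def eval_nat_numeral)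
  have Kt: "K * t \<le> 1/4"
  proof -
    have "K * t \<le> K * \<epsilon>" using t0 by (intro mult_left_mono) auto
    then show ?thesis using K\<epsilon>_le by linarith
  qed
  have K34: "1 \<le> K^4" "K \<le> K^4" "K\<^sup>2 \<le> K^4" "K^3 \<le> K^4" "K\<^sup>2 \<le> K^3" "K \<le> K\<^sup>2" "1 \<le> K^2" "1 \<le> K^3"
    using K_ge by (auto intro: self_le_power power_increasing one_le_power)
  define \<beta> where "\<beta> = cosh s - 1"
  define \<eta> where "\<eta> = (g' - g) / 2"
  define r where "r = 2 * x * u + u\<^sup>2"
  have sb: "\<bar>s\<bar> \<le> 2 * K * t" "\<bar>s\<bar> \<le> 1/2"
    using increment_bounds[OF s bd(1)] by (auto simp: t_def)
  have s2: "s\<^sup>2 \<le> 4 * K\<^sup>2 * t\<^sup>2"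
    using power_mono[OF sb(1), of 2] by (simp add: power_mult_distrib)
  have \<beta>: "0 \<le> \<beta>" "\<beta> \<le> 4 * K\<^sup>2 * t\<^sup>2"
    using cosh_le[of s] sb s2 by (auto simp: \<beta>_def cosh_real_ge_1)
  have \<beta>': "\<beta> \<le> K * \<epsilon>"
  proof -
    have "4 * K\<^sup>2 * t\<^sup>2 = 4 * (K * t) * (K * t)" by (simp add: power2_eq_square)
    also have "\<dots> \<le> 4 * (1/4) * (K * \<epsilon>)" using Kt t0 by (intro mult_mono) auto
    finally show ?thesis using \<beta> by (simp add: ac_simps)
  qed
  have \<beta>p: "\<bar>\<beta> - t\<^sup>2 * p\<^sup>2 / 2\<bar> \<le> 6 * K^3 * \<epsilon> * t\<^sup>2"
  proof -
    have "s ^ 4 = s\<^sup>2 * s\<^sup>2" by (simp add: eval_nat_numeral)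
    also have "\<dots> \<le> (4 * K\<^sup>2 * t\<^sup>2) * (4 * K\<^sup>2 * t\<^sup>2)" using s2 by (intro mult_mono) auto
    also have "\<dots> = 16 * K^3 * t * (K * t) * t\<^sup>2" by (simp add: eval_nat_numeral)
    also have "\<dots> \<le> 16 * K^3 * \<epsilon> * (1/4) * t\<^sup>2" using Kt t0 by (intro mult_mono) auto
    finally have 1: "s ^ 4 \<le> 4 * K^3 * \<epsilon> * t\<^sup>2" by (simp add: ac_simps)
    have tp: "\<bar>t * p\<bar> \<le> K * t" using bd t0 by (simp add: abs_mult)
    have s': "\<bar>s - t * p\<bar> \<le> K * \<epsilon> * t"
    proof -
      have "\<tau> * K * h\<^sup>2 = K * h * t" by (simp add: t_def power2_eq_square)
      also have "\<dots> \<le> K * \<epsilon> * t" using h_le t0 by (intro mult_right_mono mult_left_mono) auto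
      finally have "\<tau> * K * h\<^sup>2 \<le> K * \<epsilon> * t" .
      then show ?thesis using s unfolding t_def by linarith
    qed
    have "s\<^sup>2 - t\<^sup>2 * p\<^sup>2 = (s - t * p) * (s + t * p)" by (simp add: algebra_simps power2_eq_square)
    also have "\<bar>\<dots>\<bar> \<le> (K * \<epsilon> * t) * (3 * K * t)"
      unfolding abs_mult using s' tp sb by (intro mult_mono) auto
    also have "\<dots> = 3 * K\<^sup>2 * \<epsilon> * t\<^sup>2" by (simp add: power2_eq_square)
    also have "\<dots> \<le> 4 * K^3 * \<epsilon> * t\<^sup>2" using K34 t0 by (intro mult_mono) auto
    finally have 2: "\<bar>s\<^sup>2 - t\<^sup>2 * p\<^sup>2\<bar> \<le> 4 * K^3 * \<epsilon> * t\<^sup>2" .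
    have 3: "\<bar>\<beta> - s\<^sup>2 / 2\<bar> \<le> s ^ 4" unfolding \<beta>_def using abs_cosh_diff_le[of s] sb by auto
    show ?thesis using 1 2 3 by (simp add: abs_le_iff)
  qed
  have \<eta>: "\<bar>\<eta>\<bar> \<le> K * h / 2" using bd by (simp add: \<eta>_def)
  have \<eta>K: "\<bar>\<eta>\<bar> \<le> K" "\<bar>\<eta>\<bar> \<le> K * \<epsilon>"
  proof -
    have "K * h \<le> K * 1" "K * h \<le> K * \<epsilon>" using h_le_quarter h_le by (auto intro!: mult_left_mono)
    then show "\<bar>\<eta>\<bar> \<le> K" "\<bar>\<eta>\<bar> \<le> K * \<epsilon>" using \<eta> K_pos mult_pos_pos[OF K_pos \<epsilon>_pos] by linarith+
  qed
  have N0: "0 \<le> ?N" "\<tau>^3 * h^4 * x\<^sup>2 \<le> ?N" "\<tau> * h\<^sup>2 * u\<^sup>2 \<le> ?N" by auto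
  have rN: "t^3 * h * \<bar>r\<bar> \<le> 2 * \<epsilon> * ?N"
  proof -
    have "t^3 * h * \<bar>r\<bar> \<le> t^3 * h * (2 * \<bar>x * u\<bar> + u\<^sup>2)" unfolding r_def using t0
      by (intro mult_left_mono abs_triangle_ineq[THEN order_trans]) (auto simp: abs_mult)
    also have "\<dots> = t * (2 * (\<tau>\<^sup>2 * h^3 * \<bar>x * u\<bar>) + t * (\<tau> * h\<^sup>2 * u\<^sup>2))"
      by (simp add: t_def eval_nat_numeral algebra_simps)
    also have "\<dots> \<le> \<epsilon> * (2 * (?N/2) + 1 * ?N)"
      using cross_bounds(3)[of x u] t0 \<epsilon>_le N0 by (intro mult_mono add_mono) auto
    also have "\<dots> = 2 * \<epsilon> * ?N" by (simp add: field_simps)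
    finally show ?thesis .
  qed
  \<comment> \<open>\<open>\<eta>\<close> is half the increment of \<open>g\<close> and
    \<open>r\<close> is \<open>(x + u)^2 - x^2\<close>; all terms without a small factor have
    cancelled.\<close>
  have E: "?E = t * h * (\<beta> * (g + \<eta>) + \<eta>) * u\<^sup>2 - t * h * (g * (2 * x\<^sup>2) * (\<beta> - t\<^sup>2 * p\<^sup>2 / 2))
     - t * h * \<beta> * (2 * x\<^sup>2) * \<eta> - t * h * \<beta> * (g + \<eta>) * r + t * h * \<eta> * (2 * (x * u) + u\<^sup>2)"
  proof -
    have "g' = g + 2 * \<eta>" "cosh s = 1 + \<beta>" by (auto simp: \<eta>_def \<beta>_def field_simps)
    then show ?thesis unfolding th2 t3 r_def
      by (simp add: field_simps power2_eq_square eval_nat_numeral)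
  qed
  have B1: "\<bar>t * h * (\<beta> * (g + \<eta>) + \<eta>) * u\<^sup>2\<bar> \<le> 3 * K^4 * \<epsilon> * ?N"
  proof -
    have "\<bar>\<beta> * (g + \<eta>) + \<eta>\<bar> \<le> \<beta> * \<bar>g + \<eta>\<bar> + \<bar>\<eta>\<bar>"
      using \<beta> abs_triangle_ineq[of "\<beta> * (g + \<eta>)" \<eta>] by (simp add: abs_mult)
    also have "\<dots> \<le> (K * \<epsilon>) * (2 * K) + K * \<epsilon>"
      using \<beta> \<beta>' \<eta>K bd by (intro add_mono mult_mono) auto
    also have "\<dots> = 2 * K\<^sup>2 * \<epsilon> + K * \<epsilon>" by (simp add: power2_eq_square)
    also have "\<dots> \<le> 2 * K^4 * \<epsilon> + K^4 * \<epsilon>" using K34 by (intro add_mono mult_right_mono mult_left_mono) auto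
    finally have 1: "\<bar>\<beta> * (g + \<eta>) + \<eta>\<bar> \<le> 3 * K^4 * \<epsilon>" by (simp add: ac_simps)
    have "\<bar>t * h * (\<beta> * (g + \<eta>) + \<eta>) * u\<^sup>2\<bar> = \<bar>\<beta> * (g + \<eta>) + \<eta>\<bar> * (t * h * u\<^sup>2)"
      using t0 by (simp add: abs_mult)
    also have "\<dots> \<le> 3 * K^4 * \<epsilon> * ?N" using N0 1 t0 by (intro mult_mono) (auto simp: th2)
    finally show ?thesis .
  qed
  have B2: "\<bar>t * h * (g * (2 * x\<^sup>2) * (\<beta> - t\<^sup>2 * p\<^sup>2 / 2))\<bar> \<le> 12 * K^4 * \<epsilon> * ?N"
  proof -
    have "\<bar>t * h * (g * (2 * x\<^sup>2) * (\<beta> - t\<^sup>2 * p\<^sup>2 / 2))\<bar> = (2 * \<bar>g\<bar>) * \<bar>\<beta> - t\<^sup>2 * p\<^sup>2 / 2\<bar> * (t * h * x\<^sup>2)"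
      using t0 by (simp add: abs_mult)
    also have "\<dots> \<le> (2 * K) * (6 * K^3 * \<epsilon> * t\<^sup>2) * (t * h * x\<^sup>2)"
      using bd \<beta>p t0 by (intro mult_mono) auto
    also have "\<dots> = 12 * K^4 * \<epsilon> * (\<tau>^3 * h^4 * x\<^sup>2)" unfolding t3 by (simp add: eval_nat_numeral)
    also have "\<dots> \<le> 12 * K^4 * \<epsilon> * ?N" using N0 by (intro mult_left_mono) auto
    finally show ?thesis .
  qed
  have B3: "\<bar>t * h * \<beta> * (2 * x\<^sup>2) * \<eta>\<bar> \<le> 4 * K^4 * \<epsilon> * ?N"
  proof -
    have "\<bar>t * h * \<beta> * (2 * x\<^sup>2) * \<eta>\<bar> = \<beta> * (2 * \<bar>\<eta>\<bar>) * (t * h * x\<^sup>2)"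
      using t0 \<beta> by (simp add: abs_mult)
    also have "\<dots> \<le> (4 * K\<^sup>2 * t\<^sup>2) * (K * \<epsilon>) * (t * h * x\<^sup>2)"
    proof -
      have "2 * \<bar>\<eta>\<bar> \<le> K * h" using \<eta> by simp
      also have "\<dots> \<le> K * \<epsilon>" using h_le by simp
      finally have e: "2 * \<bar>\<eta>\<bar> \<le> K * \<epsilon>" .
      show ?thesis using t0 \<beta> by (intro mult_right_mono[OF mult_mono[OF \<beta>(2) e]]) auto
    qed
    also have "\<dots> = 4 * K^3 * \<epsilon> * (\<tau>^3 * h^4 * x\<^sup>2)" unfolding t3 by (simp add: eval_nat_numeral)
    also have "\<dots> \<le> 4 * K^4 * \<epsilon> * ?N" using N0 K34 by (intro mult_mono) auto
    finally show ?thesis .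
  qed
  have B4: "\<bar>t * h * \<beta> * (g + \<eta>) * r\<bar> \<le> 16 * K^4 * \<epsilon> * ?N"
  proof -
    have "\<bar>t * h * \<beta> * (g + \<eta>) * r\<bar> = \<beta> * \<bar>g + \<eta>\<bar> * (t * h * \<bar>r\<bar>)"
      using t0 \<beta> by (simp add: abs_mult)
    also have "\<dots> \<le> (4 * K\<^sup>2 * t\<^sup>2) * (2 * K) * (t * h * \<bar>r\<bar>)"
      using \<beta> t0 \<eta>K bd by (intro mult_mono) auto
    also have "\<dots> = 8 * K^3 * (t^3 * h * \<bar>r\<bar>)" by (simp add: eval_nat_numeral)
    also have "\<dots> \<le> 8 * K^4 * (2 * \<epsilon> * ?N)" using K34 t0 by (intro mult_mono[OF _ rN] mult_left_mono) auto
    finally show ?thesis by (simp add: algebra_simps)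
  qed
  have B5: "\<bar>t * h * \<eta> * (2 * (x * u) + u\<^sup>2)\<bar> \<le> K^4 * \<epsilon> * ?N"
  proof -
    have "\<bar>t * h * \<eta> * (2 * (x * u) + u\<^sup>2)\<bar> = \<bar>\<eta>\<bar> * (t * h) * \<bar>2 * (x * u) + u\<^sup>2\<bar>"
      using t0 by (simp add: abs_mult)
    also have "\<dots> \<le> (K * h / 2) * (t * h) * (2 * \<bar>x * u\<bar> + u\<^sup>2)"
      using \<eta> t0 by (intro mult_mono abs_triangle_ineq[THEN order_trans]) (auto simp: abs_mult)
    also have "\<dots> = K * (1 * (\<tau> * h^3 * \<bar>x * u\<bar>) + h * (\<tau> * h\<^sup>2 * u\<^sup>2) / 2)"
      by (simp add: t_def eval_nat_numeral algebra_simps)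
    also have "\<dots> \<le> K * (\<tau> * \<epsilon> * (\<tau> * h^3 * \<bar>x * u\<bar>) + \<epsilon> * (\<tau> * h\<^sup>2 * u\<^sup>2) / 2)"
      using \<tau>_inv_le h_le by (intro mult_left_mono add_mono divide_right_mono mult_right_mono) auto
    also have "\<dots> = K * \<epsilon> * (\<tau>\<^sup>2 * h^3 * \<bar>x * u\<bar> + (\<tau> * h\<^sup>2 * u\<^sup>2) / 2)"
      by (simp add: eval_nat_numeral algebra_simps)
    also have "\<dots> \<le> K^4 * \<epsilon> * (?N / 2 + ?N / 2)"
      using cross_bounds(3)[of x u] N0 K34 by (intro mult_mono add_mono) auto
    finally show ?thesis by (simp add: ac_simps)
  qed
  have "\<bar>?E\<bar> \<le> 3 * K^4 * \<epsilon> * ?N + 12 * K^4 * \<epsilon> * ?N + 4 * K^4 * \<epsilon> * ?N + 16 * K^4 * \<epsilon> * ?N + K^4 * \<epsilon> * ?N"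
    unfolding E using B1 B2 B3 B4 B5 by linarith
  also have "\<dots> = 36 * K^4 * \<epsilon> * ?N" by (simp add: algebra_simps)
  finally show ?thesis .
qed

end

section \<open>The Carleman estimate\<close>

text \<open>\<open>p\<close> and \<open>q\<close> play the role of the gradient and the Hessian of \<open>\<phi>\<close>. The Hessian need not be positive:
  \<open>g\<close> is the density of a zeroth order multiplier, which transfers positivity between the two
  conditions \<open>gradient_pos\<close> and \<open>zeroth_pos\<close>. The number 400000 is a crude bound for the sum of all
  absolute constants that occur when the error terms are absorbed.\<close>

locale carleman_weight = supported_function h f + small_parameters h \<tau> \<epsilon> K
  for h :: real and f :: "real ^ 'n::finite \<Rightarrow> real" and \<tau> \<epsilon> K :: real +
  fixes \<phi> :: "real ^ 'n \<Rightarrow> real" and p :: "'n \<Rightarrow> real ^ 'n \<Rightarrow> real"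
    and q :: "'n \<Rightarrow> 'n \<Rightarrow> real ^ 'n \<Rightarrow> real" and g :: "real ^ 'n \<Rightarrow> real" and c :: real
  assumes \<phi>_grad: "norm n < 3 \<Longrightarrow> \<bar>\<phi> (n + step h j) - \<phi> n - h * p j n\<bar> \<le> K * h\<^sup>2"
    and \<phi>_hess: "norm n < 3 \<Longrightarrow>
      \<bar>\<phi> (n + step h j + step h k) + \<phi> n - \<phi> (n + step h j) - \<phi> (n + step h k) - h\<^sup>2 * q j k n\<bar> \<le> K * h ^ 3"
    and p_bound: "norm n < 3 \<Longrightarrow> \<bar>p j n\<bar> \<le> K"
    and q_bound: "norm n < 3 \<Longrightarrow> \<bar>q j k n\<bar> \<le> K"
    and g_bound: "norm n < 3 \<Longrightarrow> \<bar>g n\<bar> \<le> K"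
    and q_lip: "norm n < 3 \<Longrightarrow> \<bar>q j k (n + step h k) - q j k n\<bar> \<le> K * h"
    and g_lip: "norm n < 3 \<Longrightarrow> \<bar>g (n + step h j) - g n\<bar> \<le> K * h"
    and c_pos: "0 < c"
    and gradient_pos: "norm n < 3 \<Longrightarrow>
      c * (\<Sum>j\<in>UNIV. (\<xi> j)\<^sup>2) \<le> 4 * (\<Sum>j\<in>UNIV. \<Sum>k\<in>UNIV. q j k n * \<xi> j * \<xi> k) + g n * (\<Sum>j\<in>UNIV. (\<xi> j)\<^sup>2)"
    and zeroth_pos: "f n \<noteq> 0 \<Longrightarrow> norm n < 3 \<Longrightarrow>
      c \<le> 4 * (\<Sum>j\<in>UNIV. \<Sum>k\<in>UNIV. q j k n * p j n * p k n) - g n * (\<Sum>j\<in>UNIV. (p j n)\<^sup>2)"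
    and \<epsilon>_small: "400000 * real CARD('n) ^ 4 * K ^ 8 * \<epsilon> \<le> 1" "400000 * real CARD('n) ^ 4 * K ^ 8 * \<epsilon> \<le> c"
begin

section \<open>Summed lower bounds for the commutator and the multiplier\<close>

abbreviation "a \<equiv> \<lambda>n. \<tau> * \<phi> n"
abbreviation "D j n \<equiv> f (n + step h j) - f n"
abbreviation "D2 j k n \<equiv> f (n + step h j + step h k) - f (n + step h j) - f (n + step h k) + f n"
abbreviation "mass \<equiv> \<tau>^3 * h^4 * (\<Sum>n\<in>L. (f n)\<^sup>2)"
abbreviation "energy \<equiv> \<tau> * h\<^sup>2 * (\<Sum>n\<in>L. \<Sum>j\<in>UNIV. (D j n)\<^sup>2)"
abbreviation "hess \<equiv> (\<Sum>n\<in>L. \<Sum>j\<in>UNIV. \<Sum>k\<in>UNIV. (D2 j k n)\<^sup>2) / \<tau>"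

lemma L_norm: "n \<in> L \<Longrightarrow> norm n < 3"
  by (simp add: lattice_ball_def)

lemma d_ge: "1 \<le> real CARD('n)"
  using one_le_card_finite[where 'a = 'n] by (simp add: Suc_le_eq)

lemma a_grad: "norm n < 3 \<Longrightarrow> \<bar>(a (n + step h j) - a n) - \<tau> * h * p j n\<bar> \<le> \<tau> * K * h\<^sup>2"
proof -
  assume "norm n < 3"
  then have "\<tau> * \<bar>\<phi> (n + step h j) - \<phi> n - h * p j n\<bar> \<le> \<tau> * (K * h\<^sup>2)"
    using \<phi>_grad \<tau>_pos by (intro mult_left_mono) auto
  moreover have "\<bar>(a (n + step h j) - a n) - \<tau> * h * p j n\<bar> = \<tau> * \<bar>\<phi> (n + step h j) - \<phi> n - h * p j n\<bar>"
  proof -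
    have "(a (n + step h j) - a n) - \<tau> * h * p j n = \<tau> * (\<phi> (n + step h j) - \<phi> n - h * p j n)"
      by (simp add: algebra_simps)
    then show ?thesis using \<tau>_pos by (simp add: abs_mult)
  qed
  ultimately show ?thesis by (simp add: mult.assoc)
qed

lemma a_hess: "norm n < 3 \<Longrightarrow>
  \<bar>(a (n + step h j + step h k) + a n - a (n + step h j) - a (n + step h k)) - \<tau> * h\<^sup>2 * q j k n\<bar> \<le> \<tau> * K * h ^ 3"
proof -
  let ?e = "\<phi> (n + step h j + step h k) + \<phi> n - \<phi> (n + step h j) - \<phi> (n + step h k) - h\<^sup>2 * q j k n"
  assume "norm n < 3"
  then have "\<tau> * \<bar>?e\<bar> \<le> \<tau> * (K * h ^ 3)"
    using \<phi>_hess \<tau>_pos by (intro mult_left_mono) auto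
  moreover have "\<bar>(a (n + step h j + step h k) + a n - a (n + step h j) - a (n + step h k)) - \<tau> * h\<^sup>2 * q j k n\<bar> = \<tau> * \<bar>?e\<bar>"
  proof -
    have "(a (n + step h j + step h k) + a n - a (n + step h j) - a (n + step h k)) - \<tau> * h\<^sup>2 * q j k n = \<tau> * ?e"
      by (simp add: algebra_simps)
    then show ?thesis using \<tau>_pos by (simp add: abs_mult)
  qed
  ultimately show ?thesis by (simp add: mult.assoc)
qed

text \<open>Moving the difference in direction k from \<open>D2\<close> onto \<open>q * f\<close>
  turns the term without a sign into the gradient form. This doubles the Hessian form and, with the
  factor 2 of the cross term in the square, produces the coefficient 4 in
  \<open>gradient_pos\<close>.\<close>

lemma commutator_by_parts:
  "(\<Sum>n\<in>L. - (q j k n * f n * D2 j k n)) =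
   (\<Sum>n\<in>L. q j k n * D j n * D k n + (q j k n * D k n * D2 j k n
      + (q j k (n + step h k) - q j k n) * (f n + D k n) * (D j n + D2 j k n)))"
proof -
  \<comment> \<open>The sum of the k-difference of \<open>q * f * D j\<close> telescopes to zero;
    adding it to the sum performs the summation by parts.\<close>
  have "(\<Sum>n\<in>L. q j k (n + step h k) * f (n + step h k) * (f (n + step h k + step h j) - f (n + step h k)))
    = (\<Sum>n\<in>L. q j k n * f n * D j n)"
    by (rule sum_shift[where F = "\<lambda>n. q j k n * f n * D j n"]) (simp add: f_zeros)
  moreover have "n + step h k + step h j = n + step h j + step h k" for n :: "real ^ 'n"
    by (simp add: ac_simps)
  ultimately have "(\<Sum>n\<in>L. q j k (n + step h k) * f (n + step h k) * (f (n + step h j + step h k) - f (n + step h k))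
     - q j k n * f n * D j n) = 0"
    by (simp add: sum_subtractf)
  then have "(\<Sum>n\<in>L. - (q j k n * f n * D2 j k n)) = (\<Sum>n\<in>L. - (q j k n * f n * D2 j k n)
     + (q j k (n + step h k) * f (n + step h k) * (f (n + step h j + step h k) - f (n + step h k))
     - q j k n * f n * D j n))"
    unfolding sum.distrib by simp
  also have "\<dots> = (\<Sum>n\<in>L. q j k n * D j n * D k n + (q j k n * D k n * D2 j k n
      + (q j k (n + step h k) - q j k n) * (f n + D k n) * (D j n + D2 j k n)))"
    by (rule sum.cong) (auto simp: algebra_simps)
  finally show ?thesis .
qed

abbreviation "N j k n \<equiv> \<tau>^3 * h^4 * (f n)\<^sup>2 + \<tau> * h\<^sup>2 * ((D j n)\<^sup>2 + (D k n)\<^sup>2) + (D2 j k n)\<^sup>2 / \<tau>"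

lemma N_nonneg: "0 \<le> N j k n"
  using h_pos \<tau>_pos by (intro add_nonneg_nonneg) auto

lemma sum_N: "(\<Sum>n\<in>L. \<Sum>j\<in>UNIV. \<Sum>k\<in>UNIV. N j k n) \<le> 2 * (real CARD('n))\<^sup>2 * (mass + energy + hess)"
proof -
  have "(\<Sum>n\<in>L. \<Sum>j\<in>UNIV. \<Sum>k\<in>UNIV. A * x n + B * (y j n + y k n) + z j k n / \<tau>)
    = (real CARD('n))\<^sup>2 * (A * (\<Sum>n\<in>L. x n)) + 2 * real CARD('n) * (B * (\<Sum>n\<in>L. \<Sum>j\<in>UNIV. y j n))
      + (\<Sum>n\<in>L. \<Sum>j\<in>UNIV. \<Sum>k\<in>UNIV. z j k n) / \<tau>"
    for A B :: real and x :: "real ^ 'n \<Rightarrow> real" and y :: "'n \<Rightarrow> real ^ 'n \<Rightarrow> real" and z :: "'n \<Rightarrow> 'n \<Rightarrow> real ^ 'n \<Rightarrow> real"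
  proof -
    have "(\<Sum>j\<in>UNIV. \<Sum>k\<in>UNIV. y j n + y k n) = 2 * real CARD('n) * (\<Sum>j\<in>UNIV. y j n)" for n
      by (simp add: sum.distrib sum_distrib_left mult.assoc)
    then show ?thesis
      by (simp add: sum.distrib power2_eq_square sum_divide_distrib[symmetric] sum_distrib_left[symmetric] mult.assoc mult.left_commute)
  qed
  then have eq: "(\<Sum>n\<in>L. \<Sum>j\<in>UNIV. \<Sum>k\<in>UNIV. N j k n) = (real CARD('n))\<^sup>2 * mass + 2 * real CARD('n) * energy + hess" .
  have m: "0 \<le> mass" "0 \<le> energy" "0 \<le> hess"
    using h_pos \<tau>_pos by (auto intro!: mult_nonneg_nonneg divide_nonneg_nonneg sum_nonneg)
  have d2: "real CARD('n) \<le> (real CARD('n))\<^sup>2" "1 \<le> (real CARD('n))\<^sup>2" using d_ge by (auto simp: power2_eq_square mult_ge1_I)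
  then have d3: "(real CARD('n))\<^sup>2 \<le> 2 * (real CARD('n))\<^sup>2" "2 * real CARD('n) \<le> 2 * (real CARD('n))\<^sup>2" "1 \<le> 2 * (real CARD('n))\<^sup>2"
    by linarith+
  note mult_right_mono[OF d3(1) m(1)] mult_right_mono[OF d3(2) m(2)] mult_right_mono[OF d3(3) m(3)]
  then show ?thesis unfolding eq distrib_left[of "2 * _"] mult_1 by (intro add_mono)
qed

lemma commutator_lower_bound:
  "(\<Sum>n\<in>L. sym_part h a f n * asym_part h a f n) \<ge>
   (\<Sum>n\<in>L. \<Sum>j\<in>UNIV. \<Sum>k\<in>UNIV. 2 * \<tau> * h\<^sup>2 * (q j k n * D j n * D k n) + 2 * \<tau>^3 * h^4 * (q j k n * p j n * p k n) * (f n)\<^sup>2)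
   - 371 * K^4 * \<epsilon> * (\<Sum>n\<in>L. \<Sum>j\<in>UNIV. \<Sum>k\<in>UNIV. N j k n)"
proof -
  let ?R = "\<lambda>j k n. q j k n * D k n * D2 j k n
      + (q j k (n + step h k) - q j k n) * (f n + D k n) * (D j n + D2 j k n)"
  let ?P = "\<lambda>j k n. 2 * \<tau>^3 * h^4 * (q j k n * p j n * p k n) * (f n)\<^sup>2"
  have swap: "(\<Sum>n\<in>L. \<Sum>j\<in>UNIV. \<Sum>k\<in>UNIV. Q n j k) = (\<Sum>j\<in>UNIV. \<Sum>k\<in>UNIV. \<Sum>n\<in>L. Q n j k)"
    for Q :: "real ^ 'n \<Rightarrow> 'n \<Rightarrow> 'n \<Rightarrow> real"
    by (subst sum.swap) (intro sum.cong refl sum.swap)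
  have KK: "K \<le> K^4" using K_ge by (rule self_le_power) simp
  have "(\<Sum>n\<in>L. sym_part h a f n * asym_part h a f n) \<ge>
     (\<Sum>n\<in>L. \<Sum>j\<in>UNIV. \<Sum>k\<in>UNIV. \<tau> * h\<^sup>2 * (q j k n * D j n * D k n - q j k n * f n * D2 j k n) + ?P j k n
        - 368 * K^4 * \<epsilon> * N j k n)" (is "_ \<ge> (\<Sum>n\<in>L. \<Sum>j\<in>UNIV. \<Sum>k\<in>UNIV. ?Q n j k)")
    unfolding sum_sym_asym
  proof (intro sum_mono)
    fix n j k assume "n \<in> L"
    then have n: "norm n < 3" by (rule L_norm)
    let ?s = "a (n + step h j) - a n" and ?r = "a (n + step h k) - a n"
    let ?\<theta> = "a (n + step h j + step h k) + a n - a (n + step h j) - a (n + step h k)"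
    note * = commutator_pointwise[OF a_grad[OF n, of j] a_grad[OF n, of k] a_hess[OF n, of j k]
      p_bound[OF n] p_bound[OF n] q_bound[OF n], of "f n" "D j n" "D k n" "D2 j k n"]
    have "sinh ?\<theta> * (cosh (a (n + step h j + step h k) - a n) * (f (n + step h j) * f (n + step h k))
       - cosh (a (n + step h k) - a (n + step h j)) * (f n * f (n + step h j + step h k)))
      = sinh ?\<theta> * (cosh (?s + ?r + ?\<theta>) * ((f n + D j n) * (f n + D k n))
       - cosh (?r - ?s) * (f n * (f n + D j n + D k n + D2 j k n)))"
      by simp
    then show "?Q n j k \<le> sinh ?\<theta> * (cosh (a (n + step h j + step h k) - a n) * (f (n + step h j) * f (n + step h k))
       - cosh (a (n + step h k) - a (n + step h j)) * (f n * f (n + step h j + step h k)))"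
      using * by (simp add: abs_le_iff algebra_simps)
  qed
  moreover have "(\<Sum>n\<in>L. \<Sum>j\<in>UNIV. \<Sum>k\<in>UNIV. ?Q n j k) =
     (\<Sum>n\<in>L. \<Sum>j\<in>UNIV. \<Sum>k\<in>UNIV. 2 * \<tau> * h\<^sup>2 * (q j k n * D j n * D k n) + ?P j k n
       + (\<tau> * h\<^sup>2 * ?R j k n - 368 * K^4 * \<epsilon> * N j k n))" (is "_ = (\<Sum>n\<in>L. \<Sum>j\<in>UNIV. \<Sum>k\<in>UNIV. ?Q' n j k)")
  proof -
    have "(\<Sum>n\<in>L. ?Q n j k) = (\<Sum>n\<in>L. ?Q' n j k)" for j k
    proof -
      have "(\<Sum>n\<in>L. ?Q n j k) = \<tau> * h\<^sup>2 * (\<Sum>n\<in>L. - (q j k n * f n * D2 j k n))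
        + (\<Sum>n\<in>L. \<tau> * h\<^sup>2 * (q j k n * D j n * D k n) + ?P j k n - 368 * K^4 * \<epsilon> * N j k n)"
        unfolding sum_distrib_left sum.distrib[symmetric] by (rule sum.cong) (auto simp: algebra_simps)
      also have "\<dots> = (\<Sum>n\<in>L. ?Q' n j k)"
        unfolding commutator_by_parts
        unfolding sum_distrib_left sum.distrib[symmetric] by (rule sum.cong) (auto simp: algebra_simps)
      finally show ?thesis .
    qed
    then show ?thesis unfolding swap by simp
  qed
  \<comment> \<open>371 = 368 + 3: the Taylor error of the commutator plus the error of the
    summation by parts.\<close>
  moreover have "(\<Sum>n\<in>L. \<Sum>j\<in>UNIV. \<Sum>k\<in>UNIV. ?Q' n j k) \<ge>
     (\<Sum>n\<in>L. \<Sum>j\<in>UNIV. \<Sum>k\<in>UNIV. 2 * \<tau> * h\<^sup>2 * (q j k n * D j n * D k n) + ?P j k n - 371 * K^4 * \<epsilon> * N j k n)"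
  proof (intro sum_mono)
    fix n j k assume "n \<in> L"
    then have n: "norm n < 3" by (rule L_norm)
    have "\<bar>\<tau> * h\<^sup>2 * ?R j k n\<bar> \<le> 3 * K * \<epsilon> * N j k n"
      by (rule by_parts_pointwise[OF q_bound[OF n] q_lip[OF n]])
    also have "\<dots> \<le> 3 * K^4 * \<epsilon> * N j k n"
      using KK \<epsilon>_pos N_nonneg by (intro mult_right_mono mult_left_mono) auto
    finally have *: "\<bar>\<tau> * h\<^sup>2 * ?R j k n\<bar> \<le> 3 * K^4 * \<epsilon> * N j k n" .
    have "x + y - 371 * K^4 * \<epsilon> * M \<le> x + y + (R - 368 * K^4 * \<epsilon> * M)" if "\<bar>R\<bar> \<le> 3 * K^4 * \<epsilon> * M" for x y R M
    proof -
      have "371 * K^4 * \<epsilon> * M = 3 * K^4 * \<epsilon> * M + 368 * K^4 * \<epsilon> * M" by (simp add: algebra_simps)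
      then show ?thesis using that by linarith
    qed
    from this[OF *] show "2 * \<tau> * h\<^sup>2 * (q j k n * D j n * D k n) + ?P j k n - 371 * K^4 * \<epsilon> * N j k n \<le> ?Q' n j k" .
  qed
  ultimately show ?thesis by (simp only: sum_subtractf sum_distrib_left)
qed

text \<open>Polarization of each edge: \<open>f n * f (n + step h j)\<close> is half of the sum of
  the two squares minus the square of the difference. What \<open>g\<close> fails to contribute
  symmetrically at the two ends is collected in the last term.\<close>

lemma multiplier_identity:
  "(\<Sum>n\<in>L. sym_part h a f n * (g n * f n)) =
   (\<Sum>n\<in>L. \<Sum>j\<in>UNIV. - cosh (a (n + step h j) - a n) * (g n + g (n + step h j)) * (D j n)\<^sup>2 / 2
     + (cosh (a (n + step h j) - a n) - 1) * (g n + g (n + step h j)) * ((f n)\<^sup>2 + (f n + D j n)\<^sup>2) / 2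
     - (g (n + step h j) - g n) * D j n * (2 * f n + D j n) / 2)"
proof -
  let ?c = "\<lambda>j n. cosh (a (n + step h j) - a n)"
  let ?Y = "\<lambda>j n. - ?c j n * (g n + g (n + step h j)) * (D j n)\<^sup>2 / 2
     + (?c j n - 1) * (g n + g (n + step h j)) * ((f n)\<^sup>2 + (f n + D j n)\<^sup>2) / 2
     - (g (n + step h j) - g n) * D j n * (2 * f n + D j n) / 2"
  have 1: "(\<Sum>n\<in>L. (?c j n * f (n + step h j) + cosh (a n - a (n - step h j)) * f (n - step h j) - 2 * f n) * (g n * f n))
    = (\<Sum>n\<in>L. ?Y j n)" for j
  proof -
    have s1: "(\<Sum>n\<in>L. cosh (a n - a (n - step h j)) * f (n - step h j) * g n * f n)
       = (\<Sum>n\<in>L. ?c j n * f n * g (n + step h j) * f (n + step h j))"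
      by (subst sum_shift[symmetric, of _ j]) (simp_all add: f_zeros)
    have s2: "(\<Sum>n\<in>L. g (n + step h j) * (f (n + step h j))\<^sup>2) = (\<Sum>n\<in>L. g n * (f n)\<^sup>2)"
      by (rule sum_shift[where F = "\<lambda>n. g n * (f n)\<^sup>2"]) (simp add: f_zeros)
    have "(\<Sum>n\<in>L. (?c j n * f (n + step h j) + cosh (a n - a (n - step h j)) * f (n - step h j) - 2 * f n) * (g n * f n))
      = (\<Sum>n\<in>L. ?c j n * f (n + step h j) * g n * f n) + (\<Sum>n\<in>L. cosh (a n - a (n - step h j)) * f (n - step h j) * g n * f n)
        - (\<Sum>n\<in>L. g n * (f n)\<^sup>2) - (\<Sum>n\<in>L. g n * (f n)\<^sup>2)"
      unfolding sum_subtractf[symmetric] sum.distrib[symmetric]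
      by (rule sum.cong) (auto simp: algebra_simps power2_eq_square)
    also have "\<dots> = (\<Sum>n\<in>L. ?c j n * f (n + step h j) * g n * f n) + (\<Sum>n\<in>L. ?c j n * f n * g (n + step h j) * f (n + step h j))
        - (\<Sum>n\<in>L. g n * (f n)\<^sup>2) - (\<Sum>n\<in>L. g (n + step h j) * (f (n + step h j))\<^sup>2)"
      by (simp only: s1 s2)
    also have "\<dots> = (\<Sum>n\<in>L. ?Y j n)"
      unfolding sum_subtractf[symmetric] sum.distrib[symmetric]
      by (rule sum.cong) (auto simp: field_simps power2_eq_square)
    finally show ?thesis .
  qed
  have "(\<Sum>n\<in>L. sym_part h a f n * (g n * f n)) = (\<Sum>n\<in>L. \<Sum>j\<in>UNIV.
     (?c j n * f (n + step h j) + cosh (a n - a (n - step h j)) * f (n - step h j) - 2 * f n) * (g n * f n))"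
    by (simp add: sym_part_def sum_distrib_right)
  also have "\<dots> = (\<Sum>j\<in>UNIV. \<Sum>n\<in>L. ?Y j n)"
    by (subst sum.swap) (simp only: 1)
  also have "\<dots> = (\<Sum>n\<in>L. \<Sum>j\<in>UNIV. ?Y j n)" by (rule sum.swap)
  finally show ?thesis .
qed

lemma multiplier_lower_bound:
  "- (\<tau> * h\<^sup>2) * (\<Sum>n\<in>L. sym_part h a f n * (g n * f n)) \<ge>
   (\<Sum>n\<in>L. \<Sum>j\<in>UNIV. \<tau> * h\<^sup>2 * g n * (D j n)\<^sup>2 - \<tau>^3 * h^4 * g n * (p j n)\<^sup>2 * (f n)\<^sup>2)
   - 36 * K^4 * \<epsilon> * (real CARD('n) * (mass + energy))"
proof -
  have "(\<Sum>n\<in>L. \<Sum>j\<in>UNIV. \<tau>^3 * h^4 * (f n)\<^sup>2 + \<tau> * h\<^sup>2 * (D j n)\<^sup>2) = real CARD('n) * mass + energy"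
    by (simp add: sum.distrib sum_distrib_left algebra_simps)
  also have "\<dots> \<le> real CARD('n) * (mass + energy)"
  proof -
    have "0 \<le> energy" using h_pos \<tau>_pos by (auto intro!: mult_nonneg_nonneg sum_nonneg)
    then have "1 * energy \<le> real CARD('n) * energy" using d_ge by (intro mult_right_mono) auto
    then show ?thesis by (simp add: distrib_left)
  qed
  finally have "36 * K^4 * \<epsilon> * (\<Sum>n\<in>L. \<Sum>j\<in>UNIV. \<tau>^3 * h^4 * (f n)\<^sup>2 + \<tau> * h\<^sup>2 * (D j n)\<^sup>2) \<le> 36 * K^4 * \<epsilon> * (real CARD('n) * (mass + energy))"
    using \<epsilon>_pos K_pos by (intro mult_left_mono) auto
  moreover have "- (\<tau> * h\<^sup>2) * (\<Sum>n\<in>L. sym_part h a f n * (g n * f n)) \<ge>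
    (\<Sum>n\<in>L. \<Sum>j\<in>UNIV. (\<tau> * h\<^sup>2 * g n * (D j n)\<^sup>2 - \<tau>^3 * h^4 * g n * (p j n)\<^sup>2 * (f n)\<^sup>2)
       - 36 * K^4 * \<epsilon> * (\<tau>^3 * h^4 * (f n)\<^sup>2 + \<tau> * h\<^sup>2 * (D j n)\<^sup>2))"
    unfolding multiplier_identity sum_distrib_left[of "- (\<tau> * h\<^sup>2)"]
  proof (intro sum_mono)
    fix n j assume "n \<in> L"
    then have n: "norm n < 3" by (rule L_norm)
    note multiplier_pointwise[OF a_grad[OF n, of j] p_bound[OF n] g_bound[OF n] g_lip[OF n], of j "D j n" "f n"]
    then show "(\<tau> * h\<^sup>2 * g n * (D j n)\<^sup>2 - \<tau>^3 * h^4 * g n * (p j n)\<^sup>2 * (f n)\<^sup>2)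
       - 36 * K^4 * \<epsilon> * (\<tau>^3 * h^4 * (f n)\<^sup>2 + \<tau> * h\<^sup>2 * (D j n)\<^sup>2) \<le>
      - (\<tau> * h\<^sup>2) * (- cosh (a (n + step h j) - a n) * (g n + g (n + step h j)) * (D j n)\<^sup>2 / 2
     + (cosh (a (n + step h j) - a n) - 1) * (g n + g (n + step h j)) * ((f n)\<^sup>2 + (f n + D j n)\<^sup>2) / 2
     - (g (n + step h j) - g n) * D j n * (2 * f n + D j n) / 2)"
      unfolding abs_le_iff by linarith
  qed
  ultimately show ?thesis unfolding sum_subtractf sum_distrib_left[symmetric] by linarith
qed

end

section \<open>Second differences and the ellipticity of the symmetric part\<close>

context supported_function
begin

text \<open>Lattice version of the fact that Hessian and Laplacian have the same norm on compactly
  supported functions. For each pair of directions one difference is moved in direction j and one in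
  direction k, so that a product of pure second differences becomes the square of a mixed
  one.\<close>

lemma sum_second_differences:
  "(\<Sum>n\<in>L. \<Sum>j\<in>UNIV. \<Sum>k\<in>UNIV. (f (n + step h j + step h k) - f (n + step h j) - f (n + step h k) + f n)\<^sup>2)
   = (\<Sum>n\<in>L. (discrete_laplacian h f n)\<^sup>2)"
proof -
  let ?W = "\<lambda>j k n. f (n + step h j + step h k) - f (n + step h j) - f (n + step h k) + f n"
  let ?E = "\<lambda>j n. f (n + step h j) + f (n - step h j) - 2 * f n"
  have comm: "n + step h k + step h j = n + step h j + step h k" for n :: "real ^ 'n" and j k
    by (simp add: ac_simps)
  have comm': "n + step h j - step h k = n - step h k + step h j" for n :: "real ^ 'n" and j k
    by (simp add: algebra_simps)
  have 1: "(\<Sum>n\<in>L. ?E j n * ?E k n) = (\<Sum>n\<in>L. (?W j k n)\<^sup>2)" for j k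
  proof -
    have s1: "(\<Sum>n\<in>L. ?E k n * (f n - f (n - step h j))) = (\<Sum>n\<in>L. ?E k (n + step h j) * (f (n + step h j) - f n))"
      by (subst sum_shift[symmetric, of _ j]) (simp_all add: f_zeros)
    have s2: "(\<Sum>n\<in>L. (f (n + step h j) - f n) * (f (n + step h j) - f n - f (n - step h k + step h j) + f (n - step h k)))
      = (\<Sum>n\<in>L. (f (n + step h j + step h k) - f (n + step h k)) * ?W j k n)"
      by (subst sum_shift[symmetric, of _ k]) (simp_all add: f_zeros comm[of _ k j] algebra_simps)
    have "(\<Sum>n\<in>L. ?E j n * ?E k n) = (\<Sum>n\<in>L. ?E k n * (f (n + step h j) - f n)) - (\<Sum>n\<in>L. ?E k n * (f n - f (n - step h j)))"
      unfolding sum_subtractf[symmetric] by (rule sum.cong) (auto simp: algebra_simps)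
    also have "\<dots> = (\<Sum>n\<in>L. (f (n + step h j) - f n) * (f (n + step h j) - f n - f (n - step h k + step h j) + f (n - step h k)))
       - (\<Sum>n\<in>L. (f (n + step h j) - f n) * ?W j k n)"
      unfolding s1 unfolding sum_subtractf[symmetric]
      by (rule sum.cong) (simp_all add: comm', simp add: algebra_simps)
    also have "\<dots> = (\<Sum>n\<in>L. (?W j k n)\<^sup>2)"
      unfolding s2 unfolding sum_subtractf[symmetric] by (rule sum.cong) (auto simp: algebra_simps power2_eq_square)
    finally show ?thesis .
  qed
  have "(\<Sum>n\<in>L. (discrete_laplacian h f n)\<^sup>2) = (\<Sum>n\<in>L. \<Sum>j\<in>UNIV. \<Sum>k\<in>UNIV. ?E j n * ?E k n)"
    by (simp add: discrete_laplacian_eq step_def[symmetric] power2_eq_square sum_product)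
  also have "\<dots> = (\<Sum>j\<in>UNIV. \<Sum>n\<in>L. \<Sum>k\<in>UNIV. ?E j n * ?E k n)" by (rule sum.swap)
  also have "\<dots> = (\<Sum>j\<in>UNIV. \<Sum>k\<in>UNIV. \<Sum>n\<in>L. ?E j n * ?E k n)" by (intro sum.cong refl sum.swap)
  also have "\<dots> = (\<Sum>j\<in>UNIV. \<Sum>k\<in>UNIV. \<Sum>n\<in>L. (?W j k n)\<^sup>2)" by (simp only: 1)
  also have "\<dots> = (\<Sum>j\<in>UNIV. \<Sum>n\<in>L. \<Sum>k\<in>UNIV. (?W j k n)\<^sup>2)" by (intro sum.cong refl sum.swap)
  also have "\<dots> = (\<Sum>n\<in>L. \<Sum>j\<in>UNIV. \<Sum>k\<in>UNIV. (?W j k n)\<^sup>2)" by (rule sum.swap)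
  finally show ?thesis by simp
qed

end

context carleman_weight
begin

text \<open>The diagonals agree, and the edge coefficients differ by \<open>cosh - 1\<close>, which
  is of order \<open>(\<tau> * h)^2\<close>. The Laplacian is thus the symmetric part up to a term
  of the size of \<open>mass\<close>.\<close>

lemma sym_part_minus_laplacian:
  "(\<Sum>n\<in>L. (sym_part h a f n - discrete_laplacian h f n)\<^sup>2) \<le> 64 * (real CARD('n))\<^sup>2 * K^4 * (\<tau>^4 * h^4) * (\<Sum>n\<in>L. (f n)\<^sup>2)"
proof -
  let ?b = "\<lambda>j n. cosh (a (n + step h j) - a n) - 1"
  let ?b' = "\<lambda>j n. cosh (a n - a (n - step h j)) - 1"
  have b: "(?b j n)\<^sup>2 \<le> 16 * K^4 * (\<tau>^4 * h^4)" if "norm n < 3" for j n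
  proof -
    note s = increment_bounds[OF a_grad[OF that, of j] p_bound[OF that]]
    have "?b j n \<le> (a (n + step h j) - a n)\<^sup>2" using s by (intro cosh_le) auto
    also have "\<dots> = \<bar>a (n + step h j) - a n\<bar>\<^sup>2" by simp
    also have "\<dots> \<le> (2 * K * (\<tau> * h))\<^sup>2" using s by (intro power_mono) auto
    finally have "(?b j n)\<^sup>2 \<le> ((2 * K * (\<tau> * h))\<^sup>2)\<^sup>2" by (intro power_mono) (auto simp: cosh_real_ge_1)
    then show ?thesis by (simp add: power_mult_distrib flip: power_mult)
  qed
  have "(\<Sum>n\<in>L. (sym_part h a f n - discrete_laplacian h f n)\<^sup>2)
    = (\<Sum>n\<in>L. (\<Sum>j\<in>UNIV. ?b j n * f (n + step h j) + ?b' j n * f (n - step h j))\<^sup>2)"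
    by (simp add: sym_part_def discrete_laplacian_eq step_def[symmetric] sum_subtractf[symmetric] algebra_simps)
  also have "\<dots> \<le> (\<Sum>n\<in>L. (\<Sum>j\<in>UNIV. (?b j n * f (n + step h j) + ?b' j n * f (n - step h j))\<^sup>2) * real CARD('n))"
    by (intro sum_mono sum_squared_le_sum_of_squares)
  also have "\<dots> \<le> (\<Sum>n\<in>L. (\<Sum>j\<in>UNIV. 2 * ((?b j n)\<^sup>2 * (f (n + step h j))\<^sup>2) + 2 * ((?b' j n)\<^sup>2 * (f (n - step h j))\<^sup>2)) * real CARD('n))"
  proof -
    have "(x * y + z * w)\<^sup>2 \<le> 2 * (x\<^sup>2 * y\<^sup>2) + 2 * (z\<^sup>2 * w\<^sup>2)" for x y z w :: real
      using sum_squares_bound[of "x * y" "z * w"] unfolding power2_sum power_mult_distrib by linarith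
    then show ?thesis by (intro sum_mono mult_right_mono) auto
  qed
  also have "\<dots> = (\<Sum>j\<in>UNIV. 2 * (\<Sum>n\<in>L. (?b j n)\<^sup>2 * (f (n + step h j))\<^sup>2) + 2 * (\<Sum>n\<in>L. (?b' j n)\<^sup>2 * (f (n - step h j))\<^sup>2)) * real CARD('n)"
    unfolding sum_distrib_right[symmetric] by (subst sum.swap) (simp only: sum.distrib sum_distrib_left)
  also have "\<dots> \<le> (\<Sum>j\<in>(UNIV :: 'n set). 2 * (16 * K^4 * (\<tau>^4 * h^4) * (\<Sum>n\<in>L. (f n)\<^sup>2)) + 2 * (16 * K^4 * (\<tau>^4 * h^4) * (\<Sum>n\<in>L. (f n)\<^sup>2))) * real CARD('n)"
  proof (intro mult_right_mono sum_mono add_mono mult_left_mono)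
    fix j
    have "(\<Sum>n\<in>L. (?b j n)\<^sup>2 * (f (n + step h j))\<^sup>2) \<le> (\<Sum>n\<in>L. 16 * K^4 * (\<tau>^4 * h^4) * (f (n + step h j))\<^sup>2)"
      using b L_norm by (intro sum_mono mult_right_mono) auto
    also have "\<dots> = 16 * K^4 * (\<tau>^4 * h^4) * (\<Sum>n\<in>L. (f (n + step h j))\<^sup>2)" by (simp only: sum_distrib_left)
    also have "(\<Sum>n\<in>L. (f (n + step h j))\<^sup>2) = (\<Sum>n\<in>L. (f n)\<^sup>2)"
      by (rule sum_shift[where F = "\<lambda>n. (f n)\<^sup>2"]) (simp add: f_zeros)
    finally show "(\<Sum>n\<in>L. (?b j n)\<^sup>2 * (f (n + step h j))\<^sup>2) \<le> 16 * K^4 * (\<tau>^4 * h^4) * (\<Sum>n\<in>L. (f n)\<^sup>2)" .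
    have "(\<Sum>n\<in>L. (?b' j n)\<^sup>2 * (f (n - step h j))\<^sup>2) = (\<Sum>n\<in>L. (?b j n)\<^sup>2 * (f n)\<^sup>2)"
      by (subst sum_shift[symmetric, of _ j]) (simp_all add: f_zeros)
    also have "\<dots> \<le> (\<Sum>n\<in>L. 16 * K^4 * (\<tau>^4 * h^4) * (f n)\<^sup>2)"
      using b L_norm by (intro sum_mono mult_right_mono) auto
    finally show "(\<Sum>n\<in>L. (?b' j n)\<^sup>2 * (f (n - step h j))\<^sup>2) \<le> 16 * K^4 * (\<tau>^4 * h^4) * (\<Sum>n\<in>L. (f n)\<^sup>2)"
      by (simp only: sum_distrib_left)
  qed auto
  also have "\<dots> = 64 * (real CARD('n))\<^sup>2 * K^4 * (\<tau>^4 * h^4) * (\<Sum>n\<in>L. (f n)\<^sup>2)"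
    by (simp add: power2_eq_square)
  finally show ?thesis .
qed

text \<open>The price of second differences: a small multiple of the symmetric part, and a multiple
  of \<open>mass\<close> that is bounded but not small. Hence \<open>hess\<close> can be tolerated
  only in error terms that already carry \<epsilon>.\<close>

lemma hess_bound:
  "hess \<le> 2 * \<epsilon> * (\<Sum>n\<in>L. (sym_part h a f n)\<^sup>2) + 128 * (real CARD('n))\<^sup>2 * K^4 * mass"
proof -
  let ?S = "\<lambda>n. sym_part h a f n" and ?D = "\<lambda>n. discrete_laplacian h f n"
  have "(?D n)\<^sup>2 \<le> 2 * (?S n)\<^sup>2 + 2 * (?S n - ?D n)\<^sup>2" for n
    using zero_le_power2[of "2 * ?S n - ?D n"] by (simp add: power2_eq_square algebra_simps)
  then have "(\<Sum>n\<in>L. (?D n)\<^sup>2) \<le> (\<Sum>n\<in>L. 2 * (?S n)\<^sup>2 + 2 * (?S n - ?D n)\<^sup>2)"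
    by (intro sum_mono)
  also have "\<dots> = 2 * (\<Sum>n\<in>L. (?S n)\<^sup>2) + 2 * (\<Sum>n\<in>L. (?S n - ?D n)\<^sup>2)"
    by (simp add: sum.distrib sum_distrib_left)
  also have "\<dots> \<le> 2 * (\<Sum>n\<in>L. (?S n)\<^sup>2) + 2 * (64 * (real CARD('n))\<^sup>2 * K^4 * (\<tau>^4 * h^4) * (\<Sum>n\<in>L. (f n)\<^sup>2))"
    by (intro add_left_mono mult_left_mono sym_part_minus_laplacian) auto
  finally have "hess \<le> (2 * (\<Sum>n\<in>L. (?S n)\<^sup>2) + 2 * (64 * (real CARD('n))\<^sup>2 * K^4 * (\<tau>^4 * h^4) * (\<Sum>n\<in>L. (f n)\<^sup>2))) / \<tau>"
    unfolding sum_second_differences using \<tau>_pos by (intro divide_right_mono) auto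
  also have "\<dots> = 2 * (1 / \<tau>) * (\<Sum>n\<in>L. (?S n)\<^sup>2) + 128 * (real CARD('n))\<^sup>2 * K^4 * mass"
    using \<tau>_pos by (simp add: field_simps eval_nat_numeral)
  also have "2 * (1 / \<tau>) * (\<Sum>n\<in>L. (?S n)\<^sup>2) \<le> 2 * \<epsilon> * (\<Sum>n\<in>L. (?S n)\<^sup>2)"
    using \<tau>_pos \<tau>_inv_le by (intro mult_right_mono mult_left_mono sum_nonneg) (auto simp: field_simps)
  finally show ?thesis by simp
qed

theorem carleman_estimate:
  "c / 2 * (mass + energy) \<le> (\<Sum>n\<in>L. (sym_part h a f n + asym_part h a f n)\<^sup>2)"
proof -
  define X where "X = (\<Sum>n\<in>L. (sym_part h a f n)\<^sup>2)"
  define Y where "Y = (\<Sum>n\<in>L. sym_part h a f n * asym_part h a f n)"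
  define Z where "Z = \<tau> * h\<^sup>2 * (\<Sum>n\<in>L. sym_part h a f n * (g n * f n))"
  define F where "F = mass"
  define G where "G = energy"
  define H where "H = hess"
  define dd where "dd = (real CARD('n))\<^sup>2"
  \<comment> \<open>1520 = 4 * 371 + 36: the cross term enters twice, \<open>sum_N\<close> costs
    another factor 2, and 36 comes from the multiplier.\<close>
  define A where "A = 1520 * dd * K^4"
  have dd: "1 \<le> dd" "real CARD('n) \<le> dd" using d_ge by (auto simp: dd_def power2_eq_square mult_ge1_I)
  have K4: "1 \<le> K^4" "K^2 \<le> K^8" "K^4 \<le> K^8" using K_ge by (auto intro: power_increasing)
  have FGH: "0 \<le> F" "0 \<le> G" "0 \<le> H"
    using h_pos \<tau>_pos unfolding F_def G_def H_def by (auto intro!: mult_nonneg_nonneg divide_nonneg_nonneg sum_nonneg)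
  have X0: "0 \<le> X" unfolding X_def by (intro sum_nonneg) auto
  \<comment> \<open>The square of the antisymmetric part is dropped; positivity comes from the cross
    term alone, and \<open>X\<close> is kept to pay for errors.\<close>
  have 1: "X + 2 * Y \<le> (\<Sum>n\<in>L. (sym_part h a f n + asym_part h a f n)\<^sup>2)"
  proof -
    have "X + 2 * Y = (\<Sum>n\<in>L. (sym_part h a f n)\<^sup>2 + 2 * (sym_part h a f n * asym_part h a f n))"
      by (simp add: X_def Y_def sum.distrib sum_distrib_left)
    also have "\<dots> \<le> (\<Sum>n\<in>L. (sym_part h a f n + asym_part h a f n)\<^sup>2)"
      by (intro sum_mono) (auto simp: power2_sum)
    finally show ?thesis .
  qed
  have 2: "2 * Y - Z \<ge> c * (F + G) - A * \<epsilon> * (F + G + H)"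
  proof -
    have "c * (F + G) \<le> 2 * (\<Sum>n\<in>L. \<Sum>j\<in>UNIV. \<Sum>k\<in>UNIV. 2 * \<tau> * h\<^sup>2 * (q j k n * D j n * D k n) + 2 * \<tau>^3 * h^4 * (q j k n * p j n * p k n) * (f n)\<^sup>2)
      + (\<Sum>n\<in>L. \<Sum>j\<in>UNIV. \<tau> * h\<^sup>2 * g n * (D j n)\<^sup>2 - \<tau>^3 * h^4 * g n * (p j n)\<^sup>2 * (f n)\<^sup>2)"
    proof -
      have "c * (F + G) = (\<Sum>n\<in>L. \<tau> * h\<^sup>2 * (c * (\<Sum>j\<in>UNIV. (D j n)\<^sup>2)) + \<tau>^3 * h^4 * (f n)\<^sup>2 * c)"
        unfolding F_def G_def sum.distrib sum_distrib_left[symmetric] sum_distrib_right[symmetric] by (simp add: algebra_simps)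
      also have "\<dots> \<le> (\<Sum>n\<in>L. \<tau> * h\<^sup>2 * (4 * (\<Sum>j\<in>UNIV. \<Sum>k\<in>UNIV. q j k n * D j n * D k n) + g n * (\<Sum>j\<in>UNIV. (D j n)\<^sup>2))
         + \<tau>^3 * h^4 * (f n)\<^sup>2 * (4 * (\<Sum>j\<in>UNIV. \<Sum>k\<in>UNIV. q j k n * p j n * p k n) - g n * (\<Sum>j\<in>UNIV. (p j n)\<^sup>2)))"
      proof (intro sum_mono add_mono)
        fix n assume "n \<in> L"
        then have n: "norm n < 3" by (rule L_norm)
        show "\<tau> * h\<^sup>2 * (c * (\<Sum>j\<in>UNIV. (D j n)\<^sup>2)) \<le> \<tau> * h\<^sup>2 * (4 * (\<Sum>j\<in>UNIV. \<Sum>k\<in>UNIV. q j k n * D j n * D k n) + g n * (\<Sum>j\<in>UNIV. (D j n)\<^sup>2))"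
          using gradient_pos[OF n] \<tau>_pos by (intro mult_left_mono) auto
        show "\<tau>^3 * h^4 * (f n)\<^sup>2 * c \<le> \<tau>^3 * h^4 * (f n)\<^sup>2 * (4 * (\<Sum>j\<in>UNIV. \<Sum>k\<in>UNIV. q j k n * p j n * p k n) - g n * (\<Sum>j\<in>UNIV. (p j n)\<^sup>2))"
          using zeroth_pos[OF _ n] \<tau>_pos h_pos by (cases "f n = 0") (auto intro!: mult_left_mono)
      qed
      also have "\<dots> = 2 * (\<Sum>n\<in>L. \<Sum>j\<in>UNIV. \<Sum>k\<in>UNIV. 2 * \<tau> * h\<^sup>2 * (q j k n * D j n * D k n) + 2 * \<tau>^3 * h^4 * (q j k n * p j n * p k n) * (f n)\<^sup>2)
      + (\<Sum>n\<in>L. \<Sum>j\<in>UNIV. \<tau> * h\<^sup>2 * g n * (D j n)\<^sup>2 - \<tau>^3 * h^4 * g n * (p j n)\<^sup>2 * (f n)\<^sup>2)"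
        unfolding sum_distrib_left[of 2] sum.distrib[symmetric]
        by (rule sum.cong) (simp_all add: sum.distrib sum_subtractf distrib_left right_diff_distrib sum_distrib_left mult.assoc mult.left_commute mult.commute[of "(f _)\<^sup>2"])
      finally show ?thesis .
    qed
    moreover have "2 * Y \<ge> 2 * (\<Sum>n\<in>L. \<Sum>j\<in>UNIV. \<Sum>k\<in>UNIV. 2 * \<tau> * h\<^sup>2 * (q j k n * D j n * D k n) + 2 * \<tau>^3 * h^4 * (q j k n * p j n * p k n) * (f n)\<^sup>2)
      - 1484 * dd * K^4 * \<epsilon> * (F + G + H)"
    proof -
      have "371 * K^4 * \<epsilon> * (\<Sum>n\<in>L. \<Sum>j\<in>UNIV. \<Sum>k\<in>UNIV. N j k n) \<le> 371 * K^4 * \<epsilon> * (2 * dd * (F + G + H))"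
        using sum_N K_pos \<epsilon>_pos unfolding dd_def F_def G_def H_def by (intro mult_left_mono) auto
      then show ?thesis using commutator_lower_bound unfolding Y_def by (simp add: algebra_simps)
    qed
    moreover have "- Z \<ge> (\<Sum>n\<in>L. \<Sum>j\<in>UNIV. \<tau> * h\<^sup>2 * g n * (D j n)\<^sup>2 - \<tau>^3 * h^4 * g n * (p j n)\<^sup>2 * (f n)\<^sup>2)
      - 36 * dd * K^4 * \<epsilon> * (F + G + H)"
    proof -
      have "36 * K^4 * \<epsilon> * (real CARD('n) * (F + G)) \<le> 36 * K^4 * \<epsilon> * (dd * (F + G + H))"
        using K_pos \<epsilon>_pos FGH dd by (intro mult_left_mono mult_mono) auto
      then show ?thesis using multiplier_lower_bound unfolding Z_def F_def[symmetric] G_def[symmetric] by (simp add: algebra_simps)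
    qed
    ultimately show ?thesis unfolding A_def by (simp add: algebra_simps)
  qed
  \<comment> \<open>Young's inequality spends one half of \<open>X\<close> on the multiplier; its
    remainder has weight \<open>\<tau>^2 * h^4\<close>, at most \<epsilon> times that of
    \<open>mass\<close>.\<close>
  have 3: "Z \<ge> - (X / 2) - K\<^sup>2 * \<epsilon> * F"
  proof -
    have "(\<Sum>n\<in>L. - (sym_part h a f n)\<^sup>2 / 2 - (\<tau> * h\<^sup>2)\<^sup>2 * K\<^sup>2 * (f n)\<^sup>2) \<le> (\<Sum>n\<in>L. \<tau> * h\<^sup>2 * (sym_part h a f n * (g n * f n)))"
    proof (intro sum_mono)
      fix n assume "n \<in> L"
      then have "\<bar>g n\<bar> \<le> K" by (intro g_bound L_norm)
      then have "(g n)\<^sup>2 \<le> K\<^sup>2" by (metis power2_abs power_mono abs_ge_zero)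
      then have "(\<tau> * h\<^sup>2)\<^sup>2 * (g n)\<^sup>2 * (f n)\<^sup>2 \<le> (\<tau> * h\<^sup>2)\<^sup>2 * K\<^sup>2 * (f n)\<^sup>2"
        by (intro mult_right_mono mult_left_mono) auto
      moreover have "0 \<le> (sym_part h a f n + \<tau> * h\<^sup>2 * (g n * f n))\<^sup>2 + (\<tau> * h\<^sup>2 * (g n * f n))\<^sup>2" by simp
      moreover have "(\<tau> * h\<^sup>2 * (g n * f n))\<^sup>2 = (\<tau> * h\<^sup>2)\<^sup>2 * (g n)\<^sup>2 * (f n)\<^sup>2" by (simp only: power_mult_distrib mult.assoc)
      ultimately show "- (sym_part h a f n)\<^sup>2 / 2 - (\<tau> * h\<^sup>2)\<^sup>2 * K\<^sup>2 * (f n)\<^sup>2 \<le> \<tau> * h\<^sup>2 * (sym_part h a f n * (g n * f n))"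
        by (simp add: power2_sum algebra_simps)
    qed
    then have "- (X / 2) - K\<^sup>2 * ((\<tau> * h\<^sup>2)\<^sup>2 * (\<Sum>n\<in>L. (f n)\<^sup>2)) \<le> Z"
      by (simp add: X_def Z_def sum_subtractf sum_distrib_left sum_divide_distrib sum_negf mult.assoc mult.left_commute)
    moreover have "(\<tau> * h\<^sup>2)\<^sup>2 * (\<Sum>n\<in>L. (f n)\<^sup>2) \<le> \<epsilon> * F"
    proof -
      have "1 * ((\<tau> * h\<^sup>2)\<^sup>2 * (\<Sum>n\<in>L. (f n)\<^sup>2)) \<le> (\<tau> * \<epsilon>) * ((\<tau> * h\<^sup>2)\<^sup>2 * (\<Sum>n\<in>L. (f n)\<^sup>2))"
        using \<tau>_inv_le by (intro mult_right_mono mult_nonneg_nonneg sum_nonneg) auto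
      then show ?thesis unfolding F_def by (simp add: eval_nat_numeral mult.assoc mult.left_commute)
    qed
    then have "K\<^sup>2 * ((\<tau> * h\<^sup>2)\<^sup>2 * (\<Sum>n\<in>L. (f n)\<^sup>2)) \<le> K\<^sup>2 * (\<epsilon> * F)" by (intro mult_left_mono) auto
    ultimately show ?thesis by simp
  qed
  have 4: "H \<le> 2 * \<epsilon> * X + 128 * dd * K^4 * F"
    using hess_bound unfolding H_def X_def F_def dd_def .
  have A0: "0 \<le> A" using dd K_pos by (simp add: A_def)
  \<comment> \<open>1520 * 129 + 1 is below 200000; the assumption asks for twice that since the
    errors may use up only half of \<open>c\<close>.\<close>
  have big: "A \<le> 400000 * dd\<^sup>2 * K^8 / 4" "A * (1 + 128 * dd * K^4) + K\<^sup>2 \<le> 400000 * dd\<^sup>2 * K^8 / 2"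
  proof -
    have d2: "dd \<le> dd\<^sup>2" "1 \<le> dd\<^sup>2" using dd by (auto simp: power2_eq_square mult_ge1_I)
    have a: "dd * K^4 \<le> dd\<^sup>2 * K^8" using d2 K4 dd K_pos by (intro mult_mono) auto
    then show "A \<le> 400000 * dd\<^sup>2 * K^8 / 4"
    proof -
      have "0 \<le> dd\<^sup>2 * K^8" by simp
      then have "1520 * (dd * K^4) \<le> 100000 * (dd\<^sup>2 * K^8)" using a by linarith
      then show ?thesis by (simp add: A_def)
    qed
    have "1 * K\<^sup>2 \<le> dd\<^sup>2 * K^8" using d2 K4 K_pos by (intro mult_mono) auto
    moreover have "A * (1 + 128 * dd * K^4) = 1520 * (dd * K^4) + 194560 * (dd\<^sup>2 * K^8)"
      unfolding A_def by (simp add: algebra_simps eval_nat_numeral)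
    moreover have "400000 * dd\<^sup>2 * K^8 / 2 = 200000 * (dd\<^sup>2 * K^8)" "0 \<le> dd\<^sup>2 * K^8" by simp_all
    ultimately show "A * (1 + 128 * dd * K^4) + K\<^sup>2 \<le> 400000 * dd\<^sup>2 * K^8 / 2" using a by linarith
  qed
  have dd4: "real CARD('n) ^ 4 = dd\<^sup>2" by (simp add: dd_def flip: power_mult)
  note \<epsilon>s = \<epsilon>_small[unfolded dd4]
  have e1: "A * \<epsilon> \<le> 1/4"
  proof -
    have "A * \<epsilon> \<le> 400000 * dd\<^sup>2 * K^8 / 4 * \<epsilon>" using big(1) \<epsilon>_pos by (intro mult_right_mono) auto
    then show ?thesis using \<epsilon>s(1) by simp
  qed
  have e2: "(A * (1 + 128 * dd * K^4) + K\<^sup>2) * \<epsilon> \<le> c / 2"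
  proof -
    have "(A * (1 + 128 * dd * K^4) + K\<^sup>2) * \<epsilon> \<le> 400000 * dd\<^sup>2 * K^8 / 2 * \<epsilon>" using big(2) \<epsilon>_pos by (intro mult_right_mono) auto
    then show ?thesis using \<epsilon>s(2) by simp
  qed
  \<comment> \<open>The second half of \<open>X\<close> pays for the second differences, after which
    nothing of \<open>X\<close> is left.\<close>
  have AH: "A * \<epsilon> * H \<le> X / 2 + A * \<epsilon> * (128 * dd * K^4) * F"
  proof -
    have "A * \<epsilon> * H \<le> A * \<epsilon> * (2 * \<epsilon> * X + 128 * dd * K^4 * F)" using 4 A0 \<epsilon>_pos by (intro mult_left_mono) auto
    also have "\<dots> = A * \<epsilon> * (2 * \<epsilon> * X) + A * \<epsilon> * (128 * dd * K^4) * F" by (simp add: distrib_left mult.assoc)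
    also have "A * \<epsilon> * (2 * \<epsilon> * X) \<le> 1/4 * (2 * 1 * X)"
      using e1 \<epsilon>_le \<epsilon>_pos X0 A0 by (intro mult_mono) auto
    finally show ?thesis by simp
  qed
  have "c / 2 * (F + G) \<le> c * (F + G) - ((A * (1 + 128 * dd * K^4) + K\<^sup>2) * \<epsilon>) * (F + G)"
  proof -
    have "((A * (1 + 128 * dd * K^4) + K\<^sup>2) * \<epsilon>) * (F + G) \<le> c / 2 * (F + G)"
      using e2 FGH by (intro mult_right_mono) auto
    then show ?thesis by (simp add: field_simps)
  qed
  also have "\<dots> \<le> c * (F + G) - A * \<epsilon> * (F + G) - A * \<epsilon> * (128 * dd * K^4) * F - K\<^sup>2 * \<epsilon> * F"
  proof -
    have "0 \<le> A * \<epsilon> * (128 * dd * K^4) * G" "0 \<le> K\<^sup>2 * \<epsilon> * G" using A0 \<epsilon>_pos dd FGH K_pos by auto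
    then show ?thesis by (simp add: algebra_simps)
  qed
  also have "\<dots> \<le> X + 2 * Y"
    using 2 3 AH by (simp add: distrib_left)
  finally show ?thesis using 1 unfolding F_def G_def by linarith
qed

end

section \<open>The Gaussian weight\<close>

lemma norm_add_step:
  fixes n :: "real ^ 'n::finite"
  shows "(norm (n + step h j))\<^sup>2 = (norm n)\<^sup>2 + (2 * h * n $ j + h\<^sup>2)"
proof -
  have "inner n (step h j) = h * n $ j" "inner (step h j) (step h j) = h\<^sup>2" for n :: "real ^ 'n"
    by (simp_all add: step_def inner_axis inner_axis_axis power2_eq_square)
  then show ?thesis
    by (simp add: power2_norm_eq_inner inner_add_left inner_add_right inner_commute[of "step h j" n] distrib_left)
qed

lemma norm_diff_step: "(norm (n - step h j))\<^sup>2 = (norm n)\<^sup>2 + (- 2 * h * n $ j + h\<^sup>2)"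
  using norm_add_step[of n "- h" j] by (simp add: step_def)

lemma step_nth: "step h j $ i = (if i = j then h else 0)"
  by (simp add: step_def axis_def)

lemma norm_add_step_step:
  "(norm (n + step h j + step h k))\<^sup>2 =
   (norm n)\<^sup>2 + (2 * h * n $ j + h\<^sup>2) + (2 * h * n $ k + h\<^sup>2) + (if j = k then 2 * h\<^sup>2 else 0)"
  unfolding norm_add_step by (simp add: step_nth algebra_simps power2_eq_square)

lemma abs_exp_minus_one_le:
  fixes y :: real assumes "\<bar>y\<bar> \<le> 1" shows "\<bar>exp y - 1 - y\<bar> \<le> y\<^sup>2" "\<bar>exp y - 1\<bar> \<le> 2 * \<bar>y\<bar>"
proof -
  show "\<bar>exp y - 1 - y\<bar> \<le> y\<^sup>2"
  proof (cases "0 \<le> y")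
    case True
    then have "exp y \<le> 1 + y + y\<^sup>2" using exp_bound[of y] assms by auto
    then show ?thesis using exp_ge_add_one_self[of y] by linarith
  next
    case False
    then have x: "0 \<le> - y" by simp
    \<comment> \<open>For negative y the upper bound on \<open>exp y\<close> is obtained as the
      inverse of a quadratic lower bound on \<open>exp (- y)\<close>.\<close>
    have "1 \<le> (1 + y + y\<^sup>2) * (1 + (- y) + (- y)\<^sup>2 / 2)"
    proof -
      have "(1 + y + y\<^sup>2) * (1 + (- y) + (- y)\<^sup>2 / 2) = 1 + y\<^sup>2 / 2 * (1 + (- y)) + y\<^sup>2 * y\<^sup>2 / 2"
        by (simp add: field_simps power2_eq_square)
      then show ?thesis using x by simp
    qed
    also have "\<dots> \<le> (1 + y + y\<^sup>2) * exp (- y)"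
      using exp_lower_Taylor_quadratic[OF x] assms by (intro mult_left_mono) auto
    finally have "exp y \<le> 1 + y + y\<^sup>2" by (simp add: exp_minus field_simps)
    then show ?thesis using exp_ge_add_one_self[of y] by linarith
  qed
  then show "\<bar>exp y - 1\<bar> \<le> 2 * \<bar>y\<bar>"
  proof -
    have "y\<^sup>2 = \<bar>y\<bar> * \<bar>y\<bar>" by (simp add: power2_eq_square)
    also have "\<dots> \<le> \<bar>y\<bar> * 1" using assms by (intro mult_left_mono) auto
    finally show ?thesis using \<open>\<bar>exp y - 1 - y\<bar> \<le> y\<^sup>2\<close> by linarith
  qed
qed

section \<open>Discrete derivatives of the Gaussian\<close>

definition gauss :: "real ^ 'n::finite \<Rightarrow> real" where
  "gauss x = exp (- 20 * (norm x)\<^sup>2)"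

definition gauss_grad :: "'n \<Rightarrow> real ^ 'n::finite \<Rightarrow> real" where
  "gauss_grad j x = - 40 * x $ j * gauss x"

definition gauss_hess :: "'n \<Rightarrow> 'n \<Rightarrow> real ^ 'n::finite \<Rightarrow> real" where
  "gauss_hess j k x = (1600 * x $ j * x $ k - (if j = k then 40 else 0)) * gauss x"

lemma gauss_pos: "0 < gauss x" and gauss_le_one: "gauss x \<le> 1"
  by (simp_all add: gauss_def)

context
  fixes h :: real and n :: "real ^ 'n::finite"
  assumes h: "0 < h" "h \<le> 1/1000" and n: "norm n < 3"
begin

lemma nth_le: "\<bar>n $ j\<bar> \<le> 3"
  using component_le_norm_cart[of n j] n by linarith

abbreviation "E j \<equiv> exp (- 20 * (2 * h * n $ j + h\<^sup>2))"

lemma gauss_step: "gauss (n + step h j) = gauss n * E j"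
  unfolding gauss_def norm_add_step by (simp add: algebra_simps flip: exp_add)

lemma E_bounds: "\<bar>E j - 1 + 40 * h * n $ j\<bar> \<le> 20000 * h\<^sup>2" "\<bar>E j - 1\<bar> \<le> 200 * h" "E j \<le> 2"
proof -
  let ?y = "- 20 * (2 * h * n $ j + h\<^sup>2)"
  have hh: "h\<^sup>2 \<le> h / 1000" using mult_left_mono[OF h(2), of h] h by (simp add: power2_eq_square)
  have "\<bar>h * n $ j\<bar> \<le> h * 3" using nth_le[of j] h by (simp add: abs_mult)
  moreover have "\<bar>- 20 * (2 * w + h\<^sup>2)\<bar> \<le> 140 * h" if "\<bar>w\<bar> \<le> h * 3" for w
  proof -
    have "\<bar>- 20 * (2 * w + z)\<bar> \<le> 140 * h" if "0 \<le> z" "z \<le> h / 1000" "\<bar>w\<bar> \<le> h * 3" for z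
      using that h by (simp add: abs_le_iff)
    from this[OF zero_le_power2 hh that] show ?thesis .
  qed
  ultimately have y: "\<bar>?y\<bar> \<le> 140 * h" by (simp add: mult.assoc)
  then have y1: "\<bar>?y\<bar> \<le> 1" using h by linarith
  have "?y\<^sup>2 = \<bar>?y\<bar>\<^sup>2" by simp
  also have "\<dots> \<le> (140 * h)\<^sup>2" using y by (intro power_mono) auto
  finally have y2: "?y\<^sup>2 \<le> 19600 * h\<^sup>2" by (simp add: power_mult_distrib)
  show e: "\<bar>E j - 1 + 40 * h * n $ j\<bar> \<le> 20000 * h\<^sup>2"
    using abs_exp_minus_one_le(1)[OF y1] y2 by (simp add: abs_le_iff algebra_simps)
  show "\<bar>E j - 1\<bar> \<le> 200 * h"
  proof -
    have "\<bar>40 * h * n $ j\<bar> \<le> 120 * h" using nth_le[of j] h by (simp add: abs_mult)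
    then show ?thesis using e hh by linarith
  qed
  then show "E j \<le> 2" using h by linarith
qed

lemma gauss_grad_approx: "\<bar>gauss (n + step h j) - gauss n - h * gauss_grad j n\<bar> \<le> 20000 * h\<^sup>2"
proof -
  have "gauss (n + step h j) - gauss n - h * gauss_grad j n = gauss n * (E j - 1 + 40 * h * n $ j)"
    unfolding gauss_step gauss_grad_def by (simp add: algebra_simps)
  also have "\<bar>\<dots>\<bar> \<le> 1 * (20000 * h\<^sup>2)"
    unfolding abs_mult using E_bounds(1) gauss_pos[of n] gauss_le_one[of n] by (intro mult_mono) auto
  finally show ?thesis by simp
qed

lemma gauss_diff: "\<bar>gauss (n + step h j) - gauss n\<bar> \<le> 200 * h"
proof -
  have "gauss (n + step h j) - gauss n = gauss n * (E j - 1)"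
    unfolding gauss_step by (simp add: algebra_simps)
  also have "\<bar>\<dots>\<bar> \<le> 1 * (200 * h)"
    unfolding abs_mult using E_bounds(2) gauss_pos[of n] gauss_le_one[of n] by (intro mult_mono) auto
  finally show ?thesis by simp
qed

lemma gauss_hess_approx:
  "\<bar>gauss (n + step h j + step h k) + gauss n - gauss (n + step h j) - gauss (n + step h k) - h\<^sup>2 * gauss_hess j k n\<bar>
    \<le> 10000000 * h ^ 3"
proof -
  define z where "z = (if j = k then - 40 * h\<^sup>2 else 0)"
  have hh: "h ^ 4 \<le> h ^ 3" "h\<^sup>2 \<le> 1/1000"
    using h power_decreasing[of 3 4 h] mult_mono[of h "1/1000" h 1] by (auto simp: power2_eq_square)
  have z: "\<bar>z\<bar> \<le> 40 * h\<^sup>2" "\<bar>z\<bar> \<le> 1" using hh by (auto simp: z_def)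
  have z2: "z\<^sup>2 \<le> 1600 * h ^ 3"
  proof -
    have "z\<^sup>2 \<le> 1600 * h ^ 4" by (simp add: z_def power_mult_distrib flip: power_mult)
    then show ?thesis using hh by linarith
  qed
  have split: "gauss (n + step h j + step h k) = gauss n * (E j * E k * exp z)"
    unfolding gauss_def norm_add_step_step z_def by (simp add: algebra_simps flip: exp_add)
  \<comment> \<open>Divided by \<open>gauss n\<close>, the second difference is
    \<open>(E j - 1) * (E k - 1) + E j * E k * (exp z - 1)\<close>, where \<open>z\<close> records
    that |x|^2 has a mixed second difference only for j = k. Subtracting the leading parts
    \<open>1600 * h^2 * n $ j * n $ k\<close> and \<open>z\<close> leaves terms of order
    \<open>h^3\<close>.\<close>
  have e: "gauss (n + step h j + step h k) + gauss n - gauss (n + step h j) - gauss (n + step h k) - h\<^sup>2 * gauss_hess j k n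
    = gauss n * (((E j - 1 + 40 * h * n $ j) * (E k - 1) - 40 * h * n $ j * (E k - 1 + 40 * h * n $ k))
       + (((E j - 1) * E k + (E k - 1)) * (exp z - 1) + (exp z - 1 - z)))"
    unfolding split gauss_step gauss_hess_def by (simp add: z_def algebra_simps power2_eq_square)
  have b1: "\<bar>(E j - 1 + 40 * h * n $ j) * (E k - 1)\<bar> \<le> (20000 * h\<^sup>2) * (200 * h)"
    unfolding abs_mult using E_bounds h by (intro mult_mono) auto
  have "\<bar>40 * h * n $ j\<bar> \<le> 120 * h" using nth_le[of j] h by (simp add: abs_mult)
  then have b2: "\<bar>40 * h * n $ j * (E k - 1 + 40 * h * n $ k)\<bar> \<le> (120 * h) * (20000 * h\<^sup>2)"
    unfolding abs_mult[of "40 * h * n $ j"] using E_bounds h by (intro mult_mono) auto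
  have "\<bar>(E j - 1) * E k\<bar> \<le> (200 * h) * 2"
    unfolding abs_mult using E_bounds h by (intro mult_mono) auto
  then have "\<bar>(E j - 1) * E k + (E k - 1)\<bar> \<le> 600 * h" using E_bounds(2)[of k] by linarith
  moreover have "\<bar>exp z - 1\<bar> \<le> 80 * h\<^sup>2" using abs_exp_minus_one_le(2)[OF z(2)] z by linarith
  ultimately have b3: "\<bar>((E j - 1) * E k + (E k - 1)) * (exp z - 1)\<bar> \<le> (600 * h) * (80 * h\<^sup>2)"
    unfolding abs_mult using h by (intro mult_mono) auto
  have b4: "\<bar>exp z - 1 - z\<bar> \<le> 1600 * h ^ 3" using abs_exp_minus_one_le(1)[OF z(2)] z2 by linarith
  have h3: "h ^ 3 = h * h\<^sup>2" by (simp add: eval_nat_numeral)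
  have "\<bar>((E j - 1 + 40 * h * n $ j) * (E k - 1) - 40 * h * n $ j * (E k - 1 + 40 * h * n $ k))
       + (((E j - 1) * E k + (E k - 1)) * (exp z - 1) + (exp z - 1 - z))\<bar> \<le>
     (20000 * h\<^sup>2) * (200 * h) + (120 * h) * (20000 * h\<^sup>2) + ((600 * h) * (80 * h\<^sup>2) + 1600 * h ^ 3)"
    using b1 b2 b3 b4 by linarith
  also have "\<dots> \<le> 10000000 * h ^ 3" using h unfolding h3 by simp
  finally have "\<bar>gauss n\<bar> * \<bar>((E j - 1 + 40 * h * n $ j) * (E k - 1) - 40 * h * n $ j * (E k - 1 + 40 * h * n $ k))
       + (((E j - 1) * E k + (E k - 1)) * (exp z - 1) + (exp z - 1 - z))\<bar> \<le> 1 * (10000000 * h ^ 3)"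
    using gauss_pos[of n] gauss_le_one[of n] by (intro mult_mono) auto
  then show ?thesis unfolding e abs_mult[of "gauss n"] by simp
qed

lemma gauss_grad_bound: "\<bar>gauss_grad j n\<bar> \<le> 10000000"
proof -
  have "\<bar>gauss_grad j n\<bar> = (40 * \<bar>n $ j\<bar>) * gauss n" using gauss_pos[of n] by (simp add: gauss_grad_def abs_mult)
  also have "\<dots> \<le> (40 * 3) * 1" using nth_le[of j] gauss_pos[of n] gauss_le_one[of n] by (intro mult_mono) auto
  finally show ?thesis by simp
qed

lemma gauss_hess_bound: "\<bar>gauss_hess j k n\<bar> \<le> 10000000"
proof -
  have "\<bar>n $ j * n $ k\<bar> \<le> 3 * 3" unfolding abs_mult using nth_le[of j] nth_le[of k] by (intro mult_mono) auto
  then have "\<bar>1600 * n $ j * n $ k - (if j = k then 40 else 0)\<bar> \<le> 14440" by (auto simp: abs_le_iff)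
  then have "\<bar>gauss_hess j k n\<bar> \<le> 14440 * 1"
    unfolding gauss_hess_def abs_mult using gauss_pos[of n] gauss_le_one[of n] by (intro mult_mono) auto
  then show ?thesis by simp
qed

lemma gauss_hess_lip: "\<bar>gauss_hess j k (n + step h l) - gauss_hess j k n\<bar> \<le> 10000000 * h"
proof -
  define m where "m = n + step h l"
  have md: "\<bar>m $ i - n $ i\<bar> \<le> h" for i using h by (simp add: m_def step_nth)
  have mb: "\<bar>m $ i\<bar> \<le> 4" for i using md[of i] nth_le[of i] h by linarith
  have "gauss_hess j k m - gauss_hess j k n = (1600 * (m $ j * m $ k) - (if j = k then 40 else 0)) * (gauss m - gauss n)
     + 1600 * ((m $ j - n $ j) * m $ k + n $ j * (m $ k - n $ k)) * gauss n"
    by (simp add: gauss_hess_def algebra_simps)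
  also have "\<bar>\<dots>\<bar> \<le> \<bar>1600 * (m $ j * m $ k) - (if j = k then 40 else 0)\<bar> * \<bar>gauss m - gauss n\<bar>
     + 1600 * \<bar>(m $ j - n $ j) * m $ k + n $ j * (m $ k - n $ k)\<bar> * gauss n"
  proof -
    have "\<bar>a * b + 1600 * c * g\<bar> \<le> \<bar>a\<bar> * \<bar>b\<bar> + 1600 * \<bar>c\<bar> * g" if "0 \<le> g" for a b c g :: real
      using abs_triangle_ineq[of "a * b" "1600 * c * g"] that by (simp add: abs_mult)
    from this[OF less_imp_le[OF gauss_pos]] show ?thesis .
  qed
  also have "\<dots> \<le> 26000 * (200 * h) + 1600 * (7 * h) * 1"
  proof (intro add_mono mult_mono)
    have "\<bar>m $ j * m $ k\<bar> \<le> 4 * 4" unfolding abs_mult using mb[of j] mb[of k] by (intro mult_mono) auto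
    then show "\<bar>1600 * (m $ j * m $ k) - (if j = k then 40 else 0)\<bar> \<le> 26000" by (auto simp: abs_le_iff)
    show "\<bar>gauss m - gauss n\<bar> \<le> 200 * h" unfolding m_def by (rule gauss_diff)
    have "\<bar>(m $ j - n $ j) * m $ k\<bar> \<le> h * 4" "\<bar>n $ j * (m $ k - n $ k)\<bar> \<le> 3 * h"
      unfolding abs_mult using md mb nth_le h by (auto intro!: mult_mono)
    then show "\<bar>(m $ j - n $ j) * m $ k + n $ j * (m $ k - n $ k)\<bar> \<le> 7 * h" by linarith
  qed (use h gauss_pos[of n] gauss_le_one[of n] in auto)
  also have "\<dots> \<le> 10000000 * h" using h by simp
  finally show ?thesis unfolding m_def .
qed

end

section \<open>Positivity of the two quadratic forms of the Gaussian\<close>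

lemma gauss_hess_form:
  "(\<Sum>j\<in>UNIV. \<Sum>k\<in>UNIV. gauss_hess j k x * \<xi> j * \<xi> k)
    = gauss x * (1600 * (\<Sum>j\<in>UNIV. x $ j * \<xi> j)\<^sup>2 - 40 * (\<Sum>j\<in>UNIV. (\<xi> j)\<^sup>2))"
proof -
  have "gauss_hess j k x * \<xi> j * \<xi> k = gauss x * (1600 * ((x $ j * \<xi> j) * (x $ k * \<xi> k))) -
     (if k = j then gauss x * (40 * (\<xi> j)\<^sup>2) else 0)" for j k
    by (simp add: gauss_hess_def algebra_simps power2_eq_square)
  then have "(\<Sum>j\<in>UNIV. \<Sum>k\<in>UNIV. gauss_hess j k x * \<xi> j * \<xi> k) =
     (\<Sum>j\<in>UNIV. (\<Sum>k\<in>UNIV. gauss x * (1600 * ((x $ j * \<xi> j) * (x $ k * \<xi> k)))) - gauss x * (40 * (\<xi> j)\<^sup>2))"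
    by (simp add: sum_subtractf)
  also have "\<dots> = gauss x * (1600 * (\<Sum>j\<in>UNIV. \<Sum>k\<in>UNIV. (x $ j * \<xi> j) * (x $ k * \<xi> k)) - 40 * (\<Sum>j\<in>UNIV. (\<xi> j)\<^sup>2))"
    by (simp add: sum_subtractf sum_distrib_left right_diff_distrib)
  finally show ?thesis by (simp add: power2_eq_square sum_product)
qed

text \<open>The worst directions are orthogonal to \<open>x\<close>, where the Hessian form is
  \<open>- 40 * gauss x\<close>; the multiplier wins because 240 > 4 * 40. The constant
  \<open>exp (- 540)\<close> is dictated by \<open>gauss_zeroth_pos\<close>.\<close>

lemma gauss_gradient_pos:
  assumes "norm x < 3"
  shows "exp (- 540) * (\<Sum>j\<in>UNIV. (\<xi> j)\<^sup>2) \<le>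
    4 * (\<Sum>j\<in>UNIV. \<Sum>k\<in>UNIV. gauss_hess j k x * \<xi> j * \<xi> k) + 240 * gauss x * (\<Sum>j\<in>UNIV. (\<xi> j)\<^sup>2)"
proof -
  have "(norm x)\<^sup>2 \<le> 3\<^sup>2" using assms by (intro power_mono) auto
  then have "exp (- 540) \<le> gauss x" by (simp add: gauss_def)
  then have "exp (- 540) * (\<Sum>j\<in>UNIV. (\<xi> j)\<^sup>2) \<le> gauss x * (\<Sum>j\<in>UNIV. (\<xi> j)\<^sup>2)"
    by (intro mult_right_mono sum_nonneg) auto
  also have "\<dots> \<le> gauss x * (4 * (1600 * (\<Sum>j\<in>UNIV. x $ j * \<xi> j)\<^sup>2 - 40 * (\<Sum>j\<in>UNIV. (\<xi> j)\<^sup>2)) + 240 * (\<Sum>j\<in>UNIV. (\<xi> j)\<^sup>2))"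
    using gauss_pos[of x] sum_nonneg[of UNIV "\<lambda>j. (\<xi> j)\<^sup>2"] zero_le_power2[of "\<Sum>j\<in>UNIV. x $ j * \<xi> j"]
    by (intro mult_left_mono) auto
  finally show ?thesis unfolding gauss_hess_form by (simp add: algebra_simps)
qed

text \<open>The gradient is parallel to \<open>x\<close>, the one direction in which the Hessian can
  be positive, and the expression collapses to
  \<open>gauss x ^ 3 * (640000 * r * (16 * r - 1))\<close> with r = |x|^2. This changes sign at |x|
  = 1/4, and 9/100 is the squared inner radius of the support. On radius 3 the Gaussian is at least
  exp (-180), whence its cube.\<close>

lemma gauss_zeroth_pos:
  assumes "norm x < 3" "9/100 \<le> (norm x)\<^sup>2"
  shows "exp (- 540) \<le> 4 * (\<Sum>j\<in>UNIV. \<Sum>k\<in>UNIV. gauss_hess j k x * gauss_grad j x * gauss_grad k x)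
    - 240 * gauss x * (\<Sum>j\<in>UNIV. (gauss_grad j x)\<^sup>2)"
proof -
  let ?r = "(norm x)\<^sup>2"
  have r: "(\<Sum>j\<in>UNIV. x $ j * x $ j) = ?r"
    unfolding power2_norm_eq_inner inner_vec_def by simp
  have s1: "(\<Sum>j\<in>UNIV. x $ j * gauss_grad j x) = - 40 * gauss x * ?r"
    unfolding r[symmetric] sum_distrib_left gauss_grad_def by (rule sum.cong) auto
  have s2: "(\<Sum>j\<in>UNIV. (gauss_grad j x)\<^sup>2) = 1600 * (gauss x)\<^sup>2 * ?r"
    unfolding r[symmetric] sum_distrib_left gauss_grad_def by (rule sum.cong) (auto simp: power2_eq_square)
  have "(norm x)\<^sup>2 \<le> 3\<^sup>2" using assms by (intro power_mono) auto
  then have "exp (- 180) \<le> gauss x" by (simp add: gauss_def)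
  then have "exp (- 180) ^ 3 \<le> gauss x ^ 3" by (intro power_mono) auto
  then have "exp (- 540) \<le> gauss x ^ 3" by (simp flip: exp_of_nat_mult)
  also have "gauss x ^ 3 * 1 \<le> gauss x ^ 3 * (640000 * ?r * (16 * ?r - 1))"
  proof (rule mult_left_mono)
    have "1 \<le> 640000 * (9/100) * (16 * (9/100) - 1 :: real)" by simp
    also have "\<dots> \<le> 640000 * ?r * (16 * ?r - 1)" using assms by (intro mult_mono) auto
    finally show "1 \<le> 640000 * ?r * (16 * ?r - 1)" .
  qed (use gauss_pos[of x] in auto)
  also have "\<dots> = 4 * (\<Sum>j\<in>UNIV. \<Sum>k\<in>UNIV. gauss_hess j k x * gauss_grad j x * gauss_grad k x)
    - 240 * gauss x * (\<Sum>j\<in>UNIV. (gauss_grad j x)\<^sup>2)"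
    unfolding gauss_hess_form s1 s2 by (simp add: algebra_simps eval_nat_numeral)
  finally show ?thesis by simp
qed

section \<open>Cutoff functions and the Caccioppoli inequality\<close>

definition ramp :: "real \<Rightarrow> real" where "ramp s = (max 0 s)\<^sup>2"

text \<open>The derivative \<open>2 * max 0 s\<close> is Lipschitz with constant 2, so the quadratic
  remainder bound also holds across the kink at 0.\<close>

lemma ramp_taylor: "\<bar>ramp (s + a) - ramp s - a * (2 * max 0 s)\<bar> \<le> a\<^sup>2"
proof -
  consider "0 \<le> s" "0 \<le> s + a" | "0 \<le> s" "s + a < 0" | "s < 0" "0 \<le> s + a" | "s < 0" "s + a < 0" by linarith
  then show ?thesis
  proof cases
    case 1
    then show ?thesis by (simp add: ramp_def max_def power2_eq_square algebra_simps)
  next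
    case 2
    then have "0 \<le> s * (- (s + 2 * a))" by (intro mult_nonneg_nonneg) auto
    moreover have "0 \<le> (s + a)\<^sup>2" by simp
    ultimately show ?thesis using 2 by (simp add: ramp_def max_def power2_eq_square algebra_simps)
  next
    case 3
    then have "(s + a)\<^sup>2 \<le> a\<^sup>2" by (intro power_mono) auto
    then show ?thesis using 3 by (simp add: ramp_def max_def)
  next
    case 4
    then show ?thesis by (simp add: ramp_def max_def)
  qed
qed

text \<open>A piecewise quadratic step of class \<open>C\<^sup>1\<^sup>,\<^sup>1\<close>; this regularity is what makes its second differences \<open>O(h\<^sup>2)\<close>.\<close>

definition smooth_step :: "real \<Rightarrow> real" where
  "smooth_step s = 2 * ramp s - 4 * ramp (s - 1/2) + 2 * ramp (s - 1)"

text \<open>The derivative of \<open>smooth_step\<close>, a tent of height 2 over the unit interval;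
  it is left unsimplified so that its summands match \<open>ramp_taylor\<close>.\<close>

definition smooth_step' :: "real \<Rightarrow> real" where
  "smooth_step' s = 2 * (2 * max 0 s) - 4 * (2 * max 0 (s - 1/2)) + 2 * (2 * max 0 (s - 1))"

lemma smooth_step_taylor: "\<bar>smooth_step (s + a) - smooth_step s - a * smooth_step' s\<bar> \<le> 8 * a\<^sup>2"
proof -
  let ?e = "\<lambda>s. ramp (s + a) - ramp s - a * (2 * max 0 s)"
  have "s + a - 1/2 = s - 1/2 + a" "s + a - 1 = s - 1 + a" by simp_all
  then have "smooth_step (s + a) - smooth_step s - a * smooth_step' s = 2 * ?e s - 4 * ?e (s - 1/2) + 2 * ?e (s - 1)"
    unfolding smooth_step_def smooth_step'_def by (simp only: algebra_simps)
  moreover have "\<bar>2 * x - 4 * y + 2 * z\<bar> \<le> 8 * t" if "\<bar>x\<bar> \<le> t" "\<bar>y\<bar> \<le> t" "\<bar>z\<bar> \<le> t" for x y z t :: real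
    using that by linarith
  from this[OF ramp_taylor ramp_taylor ramp_taylor]
  have "\<bar>2 * ?e s - 4 * ?e (s - 1/2) + 2 * ?e (s - 1)\<bar> \<le> 8 * a\<^sup>2" .
  ultimately show ?thesis by simp
qed

lemma smooth_step'_bound: "\<bar>smooth_step' s\<bar> \<le> 2"
  by (auto simp: smooth_step'_def max_def)

lemma smooth_step_zero: "s \<le> 0 \<Longrightarrow> smooth_step s = 0"
  by (simp add: smooth_step_def ramp_def max_def)

lemma smooth_step_one: "1 \<le> s \<Longrightarrow> smooth_step s = 1"
  by (simp add: smooth_step_def ramp_def max_def power2_eq_square algebra_simps)

lemma smooth_step_bounds: "0 \<le> smooth_step s" "smooth_step s \<le> 1"
proof -
  consider "s \<le> 0" | "0 < s" "s \<le> 1/2" | "1/2 < s" "s < 1" | "1 \<le> s" by linarith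
  then have "0 \<le> smooth_step s \<and> smooth_step s \<le> 1"
  proof cases
    case 2
    then have "smooth_step s = 2 * s\<^sup>2" by (simp add: smooth_step_def ramp_def max_def)
    moreover have "s\<^sup>2 \<le> (1/2)\<^sup>2" using 2 by (intro power_mono) auto
    ultimately show ?thesis by (simp add: power2_eq_square)
  next
    case 3
    then have "smooth_step s = 1 - 2 * (1 - s)\<^sup>2"
      by (simp add: smooth_step_def ramp_def max_def power2_eq_square algebra_simps)
    moreover have "(1 - s)\<^sup>2 \<le> (1/2)\<^sup>2" using 3 by (intro power_mono) auto
    ultimately show ?thesis by (simp add: power2_eq_square)
  qed (auto simp: smooth_step_zero smooth_step_one)
  then show "0 \<le> smooth_step s" "smooth_step s \<le> 1" by auto
qed

text \<open>\<open>\<alpha>\<close> and \<open>\<beta>\<close> are squared radii: in terms of |x|^2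
  a lattice step changes the argument by the polynomial \<open>2 * h * x $ j + h^2\<close>, with no
  square roots to expand.\<close>

definition cutoff :: "real \<Rightarrow> real \<Rightarrow> real ^ 'n::finite \<Rightarrow> real" where
  "cutoff \<alpha> \<beta> x = smooth_step ((\<beta> - (norm x)\<^sup>2) / (\<beta> - \<alpha>))"

lemma cutoff_bounds: "0 \<le> cutoff \<alpha> \<beta> x" "cutoff \<alpha> \<beta> x \<le> 1"
  by (simp_all add: cutoff_def smooth_step_bounds)

lemma cutoff_one: "\<alpha> < \<beta> \<Longrightarrow> (norm x)\<^sup>2 \<le> \<alpha> \<Longrightarrow> cutoff \<alpha> \<beta> x = 1"
  by (simp add: cutoff_def smooth_step_one)

lemma cutoff_zero: "\<alpha> < \<beta> \<Longrightarrow> \<beta> \<le> (norm x)\<^sup>2 \<Longrightarrow> cutoff \<alpha> \<beta> x = 0"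
  by (simp add: cutoff_def smooth_step_zero divide_nonpos_pos)

lemma cutoff_differences:
  fixes x :: "real ^ 'n::finite"
  assumes h: "0 < h" "h \<le> 1" and x: "norm x < 3" and w: "\<alpha> < \<beta>" "\<beta> - \<alpha> \<le> 1"
  shows "\<bar>cutoff \<alpha> \<beta> (x + step h j) - cutoff \<alpha> \<beta> x\<bar> \<le> 1000 / (\<beta> - \<alpha>)\<^sup>2 * h"
    and "\<bar>cutoff \<alpha> \<beta> (x - step h j) - cutoff \<alpha> \<beta> x\<bar> \<le> 1000 / (\<beta> - \<alpha>)\<^sup>2 * h"
    and "\<bar>cutoff \<alpha> \<beta> (x + step h j) + cutoff \<alpha> \<beta> (x - step h j) - 2 * cutoff \<alpha> \<beta> x\<bar> \<le> 1000 / (\<beta> - \<alpha>)\<^sup>2 * h\<^sup>2"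
proof -
  define s where "s = (\<beta> - (norm x)\<^sup>2) / (\<beta> - \<alpha>)"
  define W where "W = 1 / (\<beta> - \<alpha>)"
  define b where "b = - (2 * h * x $ j + h\<^sup>2) * W"
  define b' where "b' = - (- 2 * h * x $ j + h\<^sup>2) * W"
  have W: "1 \<le> W" "0 < W" using w by (auto simp: W_def)
  have eq: "cutoff \<alpha> \<beta> (x + step h j) = smooth_step (s + b)"
    "cutoff \<alpha> \<beta> (x - step h j) = smooth_step (s + b')" "cutoff \<alpha> \<beta> x = smooth_step s"
    unfolding cutoff_def norm_add_step norm_diff_step s_def b_def b'_def W_def
    by (simp_all add: diff_divide_distrib add_divide_distrib algebra_simps)
  have hx: "\<bar>2 * h * x $ j\<bar> \<le> 6 * h"
    using component_le_norm_cart[of x j] x h by (simp add: abs_mult)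
  have hh: "h\<^sup>2 \<le> h" "0 \<le> h\<^sup>2" using h mult_left_mono[of h 1 h] by (auto simp: power2_eq_square)
  have bb: "\<bar>b\<bar> \<le> 7 * h * W" "\<bar>b'\<bar> \<le> 7 * h * W"
  proof -
    have "\<bar>- (w + z) * W\<bar> \<le> 7 * h * W" if "\<bar>w\<bar> \<le> 6 * h" "z \<le> h" "0 \<le> z" for w z
      unfolding abs_mult using that W by (intro mult_mono) auto
    from this[OF hx hh] this[of "- 2 * h * x $ j", OF _ hh] hx
    show "\<bar>b\<bar> \<le> 7 * h * W" "\<bar>b'\<bar> \<le> 7 * h * W" by (auto simp: b_def b'_def)
  qed
  have b2: "b\<^sup>2 \<le> 49 * h\<^sup>2 * W\<^sup>2" "b'\<^sup>2 \<le> 49 * h\<^sup>2 * W\<^sup>2"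
    using power_mono[OF bb(1), of 2] power_mono[OF bb(2), of 2] by (simp_all add: power_mult_distrib)
  have WW: "W \<le> W\<^sup>2" using W by (simp add: power2_eq_square)
  have hW: "h * W \<le> h * W\<^sup>2" "h\<^sup>2 * W \<le> h\<^sup>2 * W\<^sup>2" "h\<^sup>2 * W\<^sup>2 \<le> h * W\<^sup>2"
    using WW h hh by (auto intro!: mult_left_mono mult_right_mono)
  have goal: "1000 / (\<beta> - \<alpha>)\<^sup>2 = 1000 * W\<^sup>2" by (simp add: W_def power_divide)
  have lin: "\<bar>c * smooth_step' s\<bar> \<le> 2 * \<bar>c\<bar>" for c
    using mult_left_mono[OF smooth_step'_bound[of s], of "\<bar>c\<bar>"] by (simp add: abs_mult)
  have first: "\<bar>smooth_step (s + c) - smooth_step s\<bar> \<le> 1000 * W\<^sup>2 * h"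
    if "\<bar>c\<bar> \<le> 7 * h * W" "c\<^sup>2 \<le> 49 * h\<^sup>2 * W\<^sup>2" for c
  proof -
    have "\<bar>smooth_step (s + c) - smooth_step s\<bar> \<le> 2 * \<bar>c\<bar> + 8 * c\<^sup>2"
      using smooth_step_taylor[of s c] lin[of c] by linarith
    also have "\<dots> \<le> 14 * (h * W) + 392 * (h\<^sup>2 * W\<^sup>2)" using that by simp
    also have "\<dots> \<le> 14 * (h * W\<^sup>2) + 392 * (h * W\<^sup>2)" using hW by linarith
    also have "\<dots> \<le> 1000 * W\<^sup>2 * h" using h by simp
    finally show ?thesis .
  qed
  show "\<bar>cutoff \<alpha> \<beta> (x + step h j) - cutoff \<alpha> \<beta> x\<bar> \<le> 1000 / (\<beta> - \<alpha>)\<^sup>2 * h"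
    "\<bar>cutoff \<alpha> \<beta> (x - step h j) - cutoff \<alpha> \<beta> x\<bar> \<le> 1000 / (\<beta> - \<alpha>)\<^sup>2 * h"
    unfolding eq goal using first bb b2 by auto
  \<comment> \<open>The forward and backward increments cancel to first order, so the linear Taylor
    terms contribute only \<open>h^2\<close> to the second difference.\<close>
  have "b + b' = - (2 * h\<^sup>2 * W)" by (simp add: b_def b'_def algebra_simps)
  then have "\<bar>(b + b') * smooth_step' s\<bar> \<le> 4 * (h\<^sup>2 * W)" using lin[of "b + b'"] W by (simp add: abs_mult)
  then have "\<bar>smooth_step (s + b) + smooth_step (s + b') - 2 * smooth_step s\<bar> \<le> 4 * (h\<^sup>2 * W) + 8 * b\<^sup>2 + 8 * b'\<^sup>2"
    using smooth_step_taylor[of s b] smooth_step_taylor[of s b'] unfolding distrib_right by linarith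
  also have "\<dots> \<le> 4 * (h\<^sup>2 * W\<^sup>2) + 8 * (49 * h\<^sup>2 * W\<^sup>2) + 8 * (49 * h\<^sup>2 * W\<^sup>2)"
    using b2 hW by linarith
  also have "\<dots> \<le> 1000 * W\<^sup>2 * h\<^sup>2" by simp
  finally show "\<bar>cutoff \<alpha> \<beta> (x + step h j) + cutoff \<alpha> \<beta> (x - step h j) - 2 * cutoff \<alpha> \<beta> x\<bar> \<le> 1000 / (\<beta> - \<alpha>)\<^sup>2 * h\<^sup>2"
    unfolding eq goal .
qed

section \<open>Solutions of the equation and their local energy\<close>

lemma schroedinger_laplacian:
  assumes "h \<noteq> 0" "magnetic_schroedinger h B V u n = 0"
  shows "discrete_laplacian h u n = - (h * (\<Sum>j\<in>UNIV. B n $ j * (u (n + step h j) - u n))) - h\<^sup>2 * (V n * u n)"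
proof -
  have "h\<^sup>2 * magnetic_schroedinger h B V u n =
    discrete_laplacian h u n + h * (\<Sum>j\<in>UNIV. B n $ j * (u (n + step h j) - u n)) + h\<^sup>2 * (V n * u n)"
    using assms(1) by (simp add: magnetic_schroedinger_def fwd_diff_step field_simps power2_eq_square)
  then show ?thesis using assms(2) by simp
qed

text \<open>Both one-sided differences are included because both occur in the Leibniz rule for the
  discrete Laplacian of u^2.\<close>

abbreviation grad_sq :: "real \<Rightarrow> (real ^ 'n::finite \<Rightarrow> real) \<Rightarrow> real ^ 'n \<Rightarrow> real" where
  "grad_sq h u n \<equiv> \<Sum>j\<in>UNIV. (u (n + step h j) - u n)\<^sup>2 + (u n - u (n - step h j))\<^sup>2"

lemma laplacian_square:
  "(\<Sum>j\<in>UNIV. (u (n + step h j))\<^sup>2 + (u (n - step h j))\<^sup>2 - 2 * (u n)\<^sup>2) = 2 * u n * discrete_laplacian h u n + grad_sq h u n"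
  unfolding discrete_laplacian_eq step_def[symmetric] sum_distrib_left sum.distrib[symmetric]
  by (rule sum.cong) (auto simp: power2_eq_square algebra_simps)

text \<open>Summation by parts of \<open>cutoff \<alpha> \<beta>\<close> against the Laplacian of \<open>u\<^sup>2\<close>.\<close>

lemma caccioppoli:
  fixes u :: "real ^ 'n::finite \<Rightarrow> real"
  assumes h: "0 < h" "h \<le> 1/10" and \<alpha>\<beta>: "\<alpha> < \<beta>" "\<beta> - \<alpha> \<le> 1" "\<beta> \<le> 5" and M: "0 \<le> M"
    and R: "0 < R" "R \<le> 3" "\<beta> \<le> (R - h)\<^sup>2" "h < R"
    and BV: "\<And>n. n \<in> lattice_ball h 3 \<Longrightarrow> norm (B n) \<le> M \<and> \<bar>V n\<bar> \<le> M"
    and eq: "\<And>n. n \<in> lattice_ball h 3 \<Longrightarrow> magnetic_schroedinger h B V u n = 0"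
  shows "(\<Sum>n\<in>lattice_ball h 3. cutoff \<alpha> \<beta> n * grad_sq h u n) \<le>
    (2 * real CARD('n) * (1000 / (\<beta> - \<alpha>)\<^sup>2 + 2 * M\<^sup>2) + 4 * M) * h\<^sup>2 * (\<Sum>n\<in>lattice_ball h R. (u n)\<^sup>2)"
proof -
  let ?L = "lattice_ball h 3 :: (real ^ 'n) set" and ?LR = "lattice_ball h R :: (real ^ 'n) set"
  let ?\<zeta> = "cutoff \<alpha> \<beta> :: real ^ 'n \<Rightarrow> real"
  let ?C = "1000 / (\<beta> - \<alpha>)\<^sup>2"
  let ?d = "real CARD('n)"
  let ?A = "\<lambda>n. \<Sum>j\<in>UNIV. (u (n + step h j))\<^sup>2 + (u (n - step h j))\<^sup>2 - 2 * (u n)\<^sup>2"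
  let ?Z = "\<lambda>n. \<Sum>j\<in>UNIV. ?\<zeta> (n + step h j) + ?\<zeta> (n - step h j) - 2 * ?\<zeta> n"
  have norm_sq: "\<beta> \<le> (norm n)\<^sup>2" if "R - h \<le> norm n" for n :: "real ^ 'n"
    using R(4) by (intro order_trans[OF R(3) power_mono[OF that]]) auto
  \<comment> \<open>The margin \<open>h\<close> in \<open>\<beta> \<le> (R - h)^2\<close> ensures
    that neighbours of points outside radius \<open>R\<close> also miss the support of the
    cutoff.\<close>
  have far: "?\<zeta> n = 0" "?\<zeta> (n + step h j) = 0" "?\<zeta> (n - step h j) = 0" if "R \<le> norm n" for n j
  proof -
    have "R - h \<le> norm (n + step h j)" "R - h \<le> norm (n - step h j)" "R - h \<le> norm n"
      using that h norm_triangle_ineq2[of n "- step h j"] norm_triangle_ineq2[of n "step h j"] by auto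
    then show "?\<zeta> n = 0" "?\<zeta> (n + step h j) = 0" "?\<zeta> (n - step h j) = 0"
      using norm_sq cutoff_zero[OF \<alpha>\<beta>(1)] by auto
  qed
  \<comment> \<open>The decay beyond 5/2 that the translation of sums asks for; it holds since
    \<beta> \<le> 5 < (12/5)^2.\<close>
  have far52: "?\<zeta> n = 0" "?\<zeta> (n + step h j) = 0" "?\<zeta> (n - step h j) = 0" if "5/2 \<le> norm n" for n j
  proof -
    have "12/5 \<le> norm (n + step h j)" "12/5 \<le> norm (n - step h j)" "12/5 \<le> norm n"
      using that h norm_triangle_ineq2[of n "- step h j"] norm_triangle_ineq2[of n "step h j"] by auto
    then have "(12/5)\<^sup>2 \<le> (norm (n + step h j))\<^sup>2" "(12/5)\<^sup>2 \<le> (norm (n - step h j))\<^sup>2" "(12/5)\<^sup>2 \<le> (norm n)\<^sup>2"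
      by (auto intro!: power_mono)
    then show "?\<zeta> n = 0" "?\<zeta> (n + step h j) = 0" "?\<zeta> (n - step h j) = 0"
      using \<alpha>\<beta>(3) by (auto intro!: cutoff_zero[OF \<alpha>\<beta>(1)] simp: power2_eq_square)
  qed
  have shift: "(\<Sum>n\<in>?L. ?\<zeta> n * ?A n)
    = (\<Sum>n\<in>?L. ?Z n * (u n)\<^sup>2)"
  proof -
    have s1: "(\<Sum>n\<in>?L. ?\<zeta> n * (u (n + step h j))\<^sup>2) = (\<Sum>n\<in>?L. ?\<zeta> (n - step h j) * (u n)\<^sup>2)" for j
      using sum_lattice_translate[where F = "\<lambda>n. ?\<zeta> (n - step h j) * (u n)\<^sup>2" and v = "step h j" and h = h] h far52
      by (simp add: lattice_intros)
    have s2: "(\<Sum>n\<in>?L. ?\<zeta> n * (u (n - step h j))\<^sup>2) = (\<Sum>n\<in>?L. ?\<zeta> (n + step h j) * (u n)\<^sup>2)" for j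
      using sum_lattice_translate[where F = "\<lambda>n. ?\<zeta> (n + step h j) * (u n)\<^sup>2" and v = "- step h j" and h = h] h far52
      by (simp add: lattice_intros)
    have "(\<Sum>n\<in>?L. ?\<zeta> n * ?A n)
      = (\<Sum>j\<in>UNIV. (\<Sum>n\<in>?L. ?\<zeta> n * (u (n + step h j))\<^sup>2) + (\<Sum>n\<in>?L. ?\<zeta> n * (u (n - step h j))\<^sup>2) - (\<Sum>n\<in>?L. 2 * ?\<zeta> n * (u n)\<^sup>2))"
      unfolding sum_distrib_left
      by (subst sum.swap) (simp add: sum.distrib sum_subtractf algebra_simps)
    also have "\<dots> = (\<Sum>n\<in>?L. ?Z n * (u n)\<^sup>2)"
      unfolding s1 s2 sum_distrib_right sum.swap[where A = ?L and B = "UNIV :: 'n set"]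
      by (simp add: sum.distrib sum_subtractf algebra_simps)
    finally show ?thesis .
  qed
  have pt: "?\<zeta> n * grad_sq h u n \<le> 2 * (?\<zeta> n * ?A n)
     + 4 * (?d * M\<^sup>2 + M) * h\<^sup>2 * (?\<zeta> n * (u n)\<^sup>2)" if n: "n \<in> ?L" for n
  proof -
    have Bj: "\<bar>B n $ j\<bar> \<le> M" for j using BV[OF n] component_le_norm_cart[of "B n" j] by linarith
    have "- (2 * u n * discrete_laplacian h u n) = (\<Sum>j\<in>UNIV. 2 * (h * B n $ j * u n) * (u (n + step h j) - u n)) + 2 * h\<^sup>2 * V n * (u n)\<^sup>2"
      unfolding schroedinger_laplacian[OF less_imp_neq[OF h(1), symmetric] eq[OF n]]
      by (simp add: sum_distrib_left power2_eq_square algebra_simps)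
    also have "\<dots> \<le> (\<Sum>j\<in>UNIV. 2 * (M\<^sup>2 * h\<^sup>2 * (u n)\<^sup>2) + (u (n + step h j) - u n)\<^sup>2 / 2) + 2 * h\<^sup>2 * M * (u n)\<^sup>2"
    proof (intro add_mono sum_mono mult_right_mono mult_left_mono)
      fix j
      have "(B n $ j)\<^sup>2 \<le> M\<^sup>2" using Bj[of j] M by (metis abs_le_square_iff abs_of_nonneg)
      then have "(B n $ j)\<^sup>2 * (h\<^sup>2 * (u n)\<^sup>2) \<le> M\<^sup>2 * (h\<^sup>2 * (u n)\<^sup>2)" by (intro mult_right_mono) auto
      then have "(h * B n $ j * u n)\<^sup>2 \<le> M\<^sup>2 * h\<^sup>2 * (u n)\<^sup>2" by (simp add: power_mult_distrib ac_simps)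
      \<comment> \<open>The weights are chosen so that the first order term consumes half of the
        gradient, which is then absorbed on the left.\<close>
      moreover have "2 * x * y \<le> 2 * x\<^sup>2 + y\<^sup>2 / 2" for x y :: real
        using zero_le_power2[of "2 * x - y"] by (simp add: power2_eq_square algebra_simps)
      from this[of "h * B n $ j * u n" "u (n + step h j) - u n"]
      show "2 * (h * B n $ j * u n) * (u (n + step h j) - u n) \<le> 2 * (M\<^sup>2 * h\<^sup>2 * (u n)\<^sup>2) + (u (n + step h j) - u n)\<^sup>2 / 2"
        using calculation by linarith
    qed (use BV[OF n] in auto)
    also have "(\<Sum>j\<in>UNIV. 2 * (M\<^sup>2 * h\<^sup>2 * (u n)\<^sup>2) + (u (n + step h j) - u n)\<^sup>2 / 2)
      \<le> 2 * ?d * (M\<^sup>2 * h\<^sup>2 * (u n)\<^sup>2) + grad_sq h u n / 2"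
      unfolding sum.distrib by (simp add: sum_divide_distrib[symmetric] sum_nonneg)
    finally have "- (2 * u n * discrete_laplacian h u n) \<le> 2 * (?d * M\<^sup>2 + M) * h\<^sup>2 * (u n)\<^sup>2 + grad_sq h u n / 2"
      by (simp add: algebra_simps)
    then have "grad_sq h u n \<le> 2 * ?A n + 4 * (?d * M\<^sup>2 + M) * h\<^sup>2 * (u n)\<^sup>2"
      unfolding laplacian_square by (simp add: algebra_simps)
    then have "?\<zeta> n * grad_sq h u n \<le> ?\<zeta> n * (2 * ?A n + 4 * (?d * M\<^sup>2 + M) * h\<^sup>2 * (u n)\<^sup>2)"
      by (intro mult_left_mono cutoff_bounds)
    then show ?thesis by (simp only: distrib_left mult.assoc mult.left_commute)
  qed
  have "(\<Sum>n\<in>?L. ?\<zeta> n * grad_sq h u n) \<le>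
     2 * (\<Sum>n\<in>?L. ?Z n * (u n)\<^sup>2)
     + 4 * (?d * M\<^sup>2 + M) * h\<^sup>2 * (\<Sum>n\<in>?L. ?\<zeta> n * (u n)\<^sup>2)"
    unfolding shift[symmetric] sum_distrib_left[of 2] sum_distrib_left[of "4 * (?d * M\<^sup>2 + M) * h\<^sup>2"] sum.distrib[symmetric]
    by (intro sum_mono pt)
  also have "\<dots> = (\<Sum>n\<in>?L. (2 * ?Z n
     + 4 * (?d * M\<^sup>2 + M) * h\<^sup>2 * ?\<zeta> n) * (u n)\<^sup>2)"
    by (simp only: sum.distrib sum_distrib_left[where A = ?L] distrib_right mult.assoc)
  also have "\<dots> = (\<Sum>n\<in>?LR. (2 * ?Z n
     + 4 * (?d * M\<^sup>2 + M) * h\<^sup>2 * ?\<zeta> n) * (u n)\<^sup>2)"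
  proof (rule sum.mono_neutral_right)
    show "?LR \<subseteq> ?L" using R(2) by (auto simp: lattice_ball_def)
    have "R \<le> norm n" if "n \<in> ?L - ?LR" for n using that by (auto simp: lattice_ball_def)
    then show "\<forall>n\<in>?L - ?LR. (2 * ?Z n
     + 4 * (?d * M\<^sup>2 + M) * h\<^sup>2 * ?\<zeta> n) * (u n)\<^sup>2 = 0"
      using far by simp
  qed (rule finite_lattice_ball[OF h(1)])
  also have "\<dots> \<le> (\<Sum>n\<in>?LR. (2 * (?d * (?C * h\<^sup>2)) + 4 * (?d * M\<^sup>2 + M) * h\<^sup>2 * 1) * (u n)\<^sup>2)"
  proof (intro sum_mono mult_right_mono add_mono mult_left_mono cutoff_bounds)
    fix n assume "n \<in> ?LR"
    then have n: "norm n < 3" using R(2) by (auto simp: lattice_ball_def)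
    have "(\<Sum>j\<in>(UNIV :: 'n set). ?\<zeta> (n + step h j) + ?\<zeta> (n - step h j) - 2 * ?\<zeta> n) \<le> (\<Sum>j\<in>(UNIV :: 'n set). ?C * h\<^sup>2)"
      using cutoff_differences(3)[OF h(1) _ n \<alpha>\<beta>(1,2)] h by (intro sum_mono) (simp add: abs_le_iff)
    then show "?Z n \<le> ?d * (?C * h\<^sup>2)" by simp
  qed (use M in auto)
  also have "\<dots> = (2 * ?d * (?C + 2 * M\<^sup>2) + 4 * M) * h\<^sup>2 * (\<Sum>n\<in>?LR. (u n)\<^sup>2)"
    unfolding sum_distrib_left[symmetric] by (simp add: algebra_simps)
  finally show ?thesis .
qed

section \<open>Localization of solutions\<close>

lemma bounded_coefficients_sum_square:
  fixes b y :: "'n::finite \<Rightarrow> real"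
  assumes "\<And>j. \<bar>b j\<bar> \<le> M"
  shows "(\<Sum>j\<in>UNIV. b j * y j)\<^sup>2 \<le> real CARD('n) * M\<^sup>2 * (\<Sum>j\<in>UNIV. (y j)\<^sup>2)"
proof -
  have "(\<Sum>j\<in>UNIV. b j * y j)\<^sup>2 \<le> (\<Sum>j\<in>UNIV. (b j * y j)\<^sup>2) * real CARD('n)"
    by (rule sum_squared_le_sum_of_squares)
  also have "\<dots> \<le> (\<Sum>j\<in>UNIV. M\<^sup>2 * (y j)\<^sup>2) * real CARD('n)"
  proof (intro mult_right_mono sum_mono)
    fix j
    have "(b j)\<^sup>2 \<le> M\<^sup>2" using power_mono[OF assms abs_ge_zero, of j 2] by simp
    then show "(b j * y j)\<^sup>2 \<le> M\<^sup>2 * (y j)\<^sup>2" unfolding power_mult_distrib by (intro mult_right_mono) auto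
  qed auto
  finally show ?thesis by (simp add: sum_distrib_left ac_simps)
qed

text \<open>A common bound for the derivatives of the Gaussian weight on the ball of radius 3.\<close>

definition weight_const :: real where "weight_const = 10000000"

text \<open>In radii, the function rises from 0.3 to 0.4 and falls from 1.5 to 1.6. The inner
  transition has to lie between 1/4, where the zeroth order form changes sign, and 1/2; the plateau
  has to contain the shell from 1/2 to 1. Subtraction works because the outer cutoff is 1 wherever
  the inner one is nonzero.\<close>

definition shell_cutoff :: "real ^ 'n::finite \<Rightarrow> real" where
  "shell_cutoff x = cutoff (9/4) (64/25) x - cutoff (9/100) (4/25) x"

lemma shell_cutoff_zero: "(norm x)\<^sup>2 \<le> 9/100 \<or> 64/25 \<le> (norm x)\<^sup>2 \<Longrightarrow> shell_cutoff x = 0"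
  by (auto simp: shell_cutoff_def cutoff_one cutoff_zero)

lemma shell_cutoff_one: "4/25 \<le> (norm x)\<^sup>2 \<Longrightarrow> (norm x)\<^sup>2 \<le> 9/4 \<Longrightarrow> shell_cutoff x = 1"
  by (auto simp: shell_cutoff_def cutoff_one cutoff_zero)

lemma shell_cutoff_differences:
  fixes x :: "real ^ 'n::finite"
  assumes h: "0 < h" "h \<le> 1" and x: "norm x < 3"
  shows "\<bar>shell_cutoff (x + step h j) - shell_cutoff x\<bar> \<le> 500000 * h"
    and "\<bar>shell_cutoff (x - step h j) - shell_cutoff x\<bar> \<le> 500000 * h"
    and "\<bar>shell_cutoff (x + step h j) + shell_cutoff (x - step h j) - 2 * shell_cutoff x\<bar> \<le> 500000 * h\<^sup>2"
proof -
  \<comment> \<open>The inner width 7/100 is decisive: 1000 / 0.07^2 is about 204082.\<close>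
  have 1: "1000 / (64/25 - 9/4)\<^sup>2 \<le> (250000::real)" "1000 / (4/25 - 9/100)\<^sup>2 \<le> (250000::real)"
    by (simp_all add: power2_eq_square)
  have 2: "\<bar>(a - a') - (b - b')\<bar> \<le> 500000 * t"
    if "\<bar>a - b\<bar> \<le> 1000 / (64/25 - 9/4)\<^sup>2 * t" "\<bar>a' - b'\<bar> \<le> 1000 / (4/25 - 9/100)\<^sup>2 * t" "0 \<le> t" for a a' b b' t :: real
    using that mult_right_mono[OF 1(1) that(3)] mult_right_mono[OF 1(2) that(3)] by linarith
  note A = cutoff_differences[OF h x, of "9/4" "64/25" j] and B = cutoff_differences[OF h x, of "9/100" "4/25" j]
  show "\<bar>shell_cutoff (x + step h j) - shell_cutoff x\<bar> \<le> 500000 * h"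
    unfolding shell_cutoff_def using h by (intro 2 A(1) B(1)) auto
  show "\<bar>shell_cutoff (x - step h j) - shell_cutoff x\<bar> \<le> 500000 * h"
    unfolding shell_cutoff_def using h by (intro 2 A(2) B(2)) auto
  have "\<bar>(cutoff (9/4) (64/25) (x + step h j) + cutoff (9/4) (64/25) (x - step h j) - cutoff (9/100) (4/25) (x + step h j) - cutoff (9/100) (4/25) (x - step h j))
     - (2 * cutoff (9/4) (64/25) x - 2 * cutoff (9/100) (4/25) x)\<bar> \<le> 500000 * h\<^sup>2"
    using 2[OF A(3) B(3)] by (simp add: algebra_simps)
  then show "\<bar>shell_cutoff (x + step h j) + shell_cutoff (x - step h j) - 2 * shell_cutoff x\<bar> \<le> 500000 * h\<^sup>2"
    unfolding shell_cutoff_def by (simp add: algebra_simps)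
qed

text \<open>One step changes |x|^2 by at most 1/100, and the thresholds keep more than that distance
  from 4/25, 9/4 and 64/25, so a point and its neighbours lie on the same plateau.\<close>

lemma shell_cutoff_locally_constant:
  fixes x :: "real ^ 'n::finite"
  assumes h: "0 < h" "h \<le> 1/1000" and x: "norm x < 3"
    and shell: "1/5 < (norm x)\<^sup>2 \<and> (norm x)\<^sup>2 < 49/25 \<or> 3 < (norm x)\<^sup>2"
  shows "shell_cutoff (x + step h j) = shell_cutoff x" "shell_cutoff (x - step h j) = shell_cutoff x"
proof -
  have "\<bar>h * x $ j\<bar> \<le> 1/1000 * 3"
    unfolding abs_mult using component_le_norm_cart[of x j] x h by (intro mult_mono) auto
  moreover have "h\<^sup>2 \<le> 1/1000" "0 \<le> h\<^sup>2" using h mult_mono[of h "1/1000" h 1] by (auto simp: power2_eq_square)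
  moreover have "\<bar>2 * w + z\<bar> \<le> 1/100 \<and> \<bar>- 2 * w + z\<bar> \<le> 1/100" if "\<bar>w\<bar> \<le> 1/1000 * 3" "z \<le> 1/1000" "0 \<le> z" for w z :: real
    using that by (intro conjI abs_leI) linarith+
  ultimately have "\<bar>2 * (h * x $ j) + h\<^sup>2\<bar> \<le> 1/100 \<and> \<bar>- 2 * (h * x $ j) + h\<^sup>2\<bar> \<le> 1/100" by blast
  then have "\<bar>(norm (x + step h j))\<^sup>2 - (norm x)\<^sup>2\<bar> \<le> 1/100" "\<bar>(norm (x - step h j))\<^sup>2 - (norm x)\<^sup>2\<bar> \<le> 1/100"
    unfolding norm_add_step norm_diff_step by (simp_all add: mult.assoc)
  then have "shell_cutoff (x + step h j) = shell_cutoff x \<and> shell_cutoff (x - step h j) = shell_cutoff x"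
    using shell
  proof (elim disjE)
    assume *: "3 < (norm x)\<^sup>2" "\<bar>(norm (x + step h j))\<^sup>2 - (norm x)\<^sup>2\<bar> \<le> 1/100" "\<bar>(norm (x - step h j))\<^sup>2 - (norm x)\<^sup>2\<bar> \<le> 1/100"
    then have "64/25 \<le> (norm x)\<^sup>2" "64/25 \<le> (norm (x + step h j))\<^sup>2" "64/25 \<le> (norm (x - step h j))\<^sup>2" by linarith+
    then show ?thesis by (simp add: shell_cutoff_zero)
  next
    assume *: "1/5 < (norm x)\<^sup>2 \<and> (norm x)\<^sup>2 < 49/25" "\<bar>(norm (x + step h j))\<^sup>2 - (norm x)\<^sup>2\<bar> \<le> 1/100" "\<bar>(norm (x - step h j))\<^sup>2 - (norm x)\<^sup>2\<bar> \<le> 1/100"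
    then have "4/25 \<le> (norm x)\<^sup>2" "4/25 \<le> (norm (x + step h j))\<^sup>2" "4/25 \<le> (norm (x - step h j))\<^sup>2"
       "(norm x)\<^sup>2 \<le> 9/4" "(norm (x + step h j))\<^sup>2 \<le> 9/4" "(norm (x - step h j))\<^sup>2 \<le> 9/4" by linarith+
    then show ?thesis by (simp add: shell_cutoff_one)
  qed
  then show "shell_cutoff (x + step h j) = shell_cutoff x" "shell_cutoff (x - step h j) = shell_cutoff x" by auto
qed

text \<open>This is \<open>h^2\<close> times the commutator of the operator with multiplication by
  \<open>shell_cutoff\<close>, applied to \<open>u\<close>. The potential commutes and leaves no
  trace.\<close>

definition commutator_rest :: "real \<Rightarrow> (real ^ 'n::finite \<Rightarrow> real ^ 'n) \<Rightarrow> (real ^ 'n \<Rightarrow> real) \<Rightarrow> real ^ 'n \<Rightarrow> real" where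
  "commutator_rest h B u n = (\<Sum>j\<in>UNIV. (shell_cutoff (n + step h j) - shell_cutoff n) * u (n + step h j) * (1 + h * B n $ j)
     + (shell_cutoff (n - step h j) - shell_cutoff n) * u (n - step h j))"

lemma laplacian_of_localized:
  assumes "discrete_laplacian h u n = - (h * (\<Sum>j\<in>UNIV. B n $ j * (u (n + step h j) - u n))) - h\<^sup>2 * (V n * u n)"
  defines "v \<equiv> \<lambda>n. shell_cutoff n * u n"
  shows "discrete_laplacian h v n =
    - (h * (\<Sum>j\<in>UNIV. B n $ j * (v (n + step h j) - v n))) - h\<^sup>2 * (V n * v n) + commutator_rest h B u n"
proof -
  have "discrete_laplacian h v n = shell_cutoff n * discrete_laplacian h u n +
    (\<Sum>j\<in>UNIV. (shell_cutoff (n + step h j) - shell_cutoff n) * u (n + step h j) + (shell_cutoff (n - step h j) - shell_cutoff n) * u (n - step h j))"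
    unfolding discrete_laplacian_eq step_def[symmetric] sum_distrib_left sum.distrib[symmetric] v_def
    by (rule sum.cong) (auto simp: algebra_simps)
  also have "shell_cutoff n * discrete_laplacian h u n = - (h * (\<Sum>j\<in>UNIV. B n $ j * (shell_cutoff n * (u (n + step h j) - u n)))) - h\<^sup>2 * (V n * v n)"
    unfolding assms(1) v_def by (simp add: algebra_simps sum_distrib_left)
  also have "(\<Sum>j\<in>UNIV. B n $ j * (shell_cutoff n * (u (n + step h j) - u n))) =
     (\<Sum>j\<in>UNIV. B n $ j * (v (n + step h j) - v n)) - (\<Sum>j\<in>UNIV. B n $ j * ((shell_cutoff (n + step h j) - shell_cutoff n) * u (n + step h j)))"
    unfolding sum_subtractf[symmetric] v_def by (rule sum.cong) (auto simp: algebra_simps)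
  finally show ?thesis
    unfolding commutator_rest_def by (simp add: algebra_simps sum.distrib sum_subtractf sum_distrib_left)
qed

lemma commutator_rest_bound:
  fixes n :: "real ^ 'n::finite"
  assumes h: "0 < h" "h \<le> 1" and n: "norm n < 3" and B: "norm (B n) \<le> M"
  shows "(commutator_rest h B u n)\<^sup>2 \<le> 3 * real CARD('n) * (500000 * (1 + M))\<^sup>2 * h\<^sup>2 * (real CARD('n) * h\<^sup>2 * (u n)\<^sup>2 + grad_sq h u n)"
proof -
  let ?c = "500000 * (1 + M)" and ?\<chi> = shell_cutoff and ?d = "real CARD('n)"
  have M: "0 \<le> M" using B norm_ge_zero[of "B n"] by linarith
  define t where "t j = (?\<chi> (n + step h j) - ?\<chi> n) * u (n + step h j) * (1 + h * B n $ j) + (?\<chi> (n - step h j) - ?\<chi> n) * u (n - step h j)" for j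
  have t: "(t j)\<^sup>2 \<le> 3 * (?c\<^sup>2 * h\<^sup>2) * (h\<^sup>2 * (u n)\<^sup>2 + ((u (n + step h j) - u n)\<^sup>2 + (u n - u (n - step h j))\<^sup>2))" for j
  proof -
    let ?D = "u (n + step h j) - u n" and ?E = "u n - u (n - step h j)"
    let ?a = "?\<chi> (n + step h j) - ?\<chi> n" and ?b = "?\<chi> (n - step h j) - ?\<chi> n"
    let ?s = "?\<chi> (n + step h j) + ?\<chi> (n - step h j) - 2 * ?\<chi> n"
    note \<chi> = shell_cutoff_differences[OF h n, of j]
    have Bj: "\<bar>B n $ j\<bar> \<le> M" using B component_le_norm_cart[of "B n" j] by linarith
    \<comment> \<open>The regrouping pairs first differences of the cutoff with differences of
      \<open>u\<close>, so that \<open>u n\<close> itself is multiplied only by a second difference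
      or by an extra factor \<open>h * B n $ j\<close>, both of order \<open>h^2\<close>.\<close>
    have e: "t j = (?s + ?a * (h * B n $ j)) * u n + (?a * (1 + h * B n $ j)) * ?D - ?b * ?E"
      by (simp add: t_def algebra_simps)
    have hB: "\<bar>h * B n $ j\<bar> \<le> h * M" unfolding abs_mult using Bj h by (intro mult_mono) auto
    have "\<bar>?a * (h * B n $ j)\<bar> \<le> (500000 * h) * (h * M)" unfolding abs_mult[of ?a] using \<chi> hB h by (intro mult_mono) auto
    then have 1: "\<bar>?s + ?a * (h * B n $ j)\<bar> \<le> ?c * h * h" using \<chi>(3) by (simp add: abs_le_iff algebra_simps power2_eq_square)
    have "h * M \<le> 1 * M" using h M by (intro mult_right_mono) auto
    then have "\<bar>1 + h * B n $ j\<bar> \<le> 1 + M" using hB by linarith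
    then have "\<bar>?a * (1 + h * B n $ j)\<bar> \<le> (500000 * h) * (1 + M)" unfolding abs_mult using \<chi> h by (intro mult_mono) auto
    then have 2: "\<bar>?a * (1 + h * B n $ j)\<bar> \<le> ?c * h" by (simp add: mult.commute mult.left_commute)
    have "500000 * h * 1 \<le> 500000 * h * (1 + M)" using h M by (intro mult_left_mono) auto
    then have 3: "\<bar>?b\<bar> \<le> ?c * h" using \<chi>(2) by (simp add: mult.commute mult.left_commute)
    have sq: "(x * y)\<^sup>2 \<le> k\<^sup>2 * y\<^sup>2" if "\<bar>x\<bar> \<le> k" for x y k :: real
      unfolding power_mult_distrib using power_mono[OF that abs_ge_zero, of 2] by (intro mult_right_mono) auto
    have "(x + y - z)\<^sup>2 \<le> 3 * (x\<^sup>2 + y\<^sup>2 + z\<^sup>2)" for x y z :: real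
      using zero_le_power2[of "x - y"] zero_le_power2[of "x + z"] zero_le_power2[of "y + z"]
      by (simp add: power2_eq_square algebra_simps)
    then have "(t j)\<^sup>2 \<le> 3 * (((?s + ?a * (h * B n $ j)) * u n)\<^sup>2 + ((?a * (1 + h * B n $ j)) * ?D)\<^sup>2 + (?b * ?E)\<^sup>2)"
      unfolding e .
    also have "\<dots> \<le> 3 * ((?c * h * h)\<^sup>2 * (u n)\<^sup>2 + (?c * h)\<^sup>2 * ?D\<^sup>2 + (?c * h)\<^sup>2 * ?E\<^sup>2)"
      using 1 2 3 by (intro mult_left_mono add_mono sq) auto
    also have "\<dots> = 3 * (?c\<^sup>2 * h\<^sup>2) * (h\<^sup>2 * (u n)\<^sup>2 + (?D\<^sup>2 + ?E\<^sup>2))"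
      by (simp only: power_mult_distrib distrib_left mult.assoc add.assoc)
    finally show ?thesis .
  qed
  have "(commutator_rest h B u n)\<^sup>2 = (\<Sum>j\<in>UNIV. t j)\<^sup>2" by (simp add: commutator_rest_def t_def)
  also have "\<dots> \<le> (\<Sum>j\<in>UNIV. (t j)\<^sup>2) * ?d" by (rule sum_squared_le_sum_of_squares)
  also have "\<dots> \<le> (\<Sum>j\<in>UNIV. 3 * (?c\<^sup>2 * h\<^sup>2) * (h\<^sup>2 * (u n)\<^sup>2 + ((u (n + step h j) - u n)\<^sup>2 + (u n - u (n - step h j))\<^sup>2))) * ?d"
    by (intro mult_right_mono sum_mono t) auto
  also have "\<dots> = 3 * ?d * ?c\<^sup>2 * h\<^sup>2 * (?d * h\<^sup>2 * (u n)\<^sup>2 + grad_sq h u n)"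
    unfolding sum_distrib_left[symmetric] by (simp add: sum.distrib mult.assoc mult.commute mult.left_commute)
  finally show ?thesis .
qed

text \<open>The magnetic term contains differences of v, whereas the Carleman estimate controls
  those of f. With \<sigma> the increment of the weight, the weighted difference of v is
  \<open>exp (- \<sigma>) * D j n + (exp (- \<sigma>) - 1) * f n\<close>, and the second coefficient
  is of order \<open>\<tau> * h\<close>.\<close>

lemma (in carleman_weight) conjugated_first_order:
  assumes "n \<in> L" and f: "f = (\<lambda>n. exp (a n) * v n)"
  shows "(exp (a n) * (v (n + step h j) - v n))\<^sup>2 \<le> 8 * (D j n)\<^sup>2 + 32 * K\<^sup>2 * \<tau>\<^sup>2 * h\<^sup>2 * (f n)\<^sup>2"
proof -
  define \<sigma> where "\<sigma> = a (n + step h j) - a n"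
  note s = increment_bounds[OF a_grad[OF L_norm[OF assms(1)], of j] p_bound[OF L_norm[OF assms(1)]], folded \<sigma>_def]
  have "exp (a n) * (v (n + step h j) - v n) = exp (- \<sigma>) * D j n + (exp (- \<sigma>) - 1) * f n"
  proof -
    have "exp (- \<sigma>) * exp (a (n + step h j)) = exp (a n)" by (simp add: \<sigma>_def flip: exp_add)
    then show ?thesis unfolding f by (simp add: algebra_simps)
  qed
  moreover have "\<bar>exp (- \<sigma>) - 1\<bar> \<le> 4 * K * (\<tau> * h)" "exp (- \<sigma>) \<le> 2"
    using abs_exp_minus_one_le(2)[of "- \<sigma>"] s by auto
  then have "(exp (- \<sigma>))\<^sup>2 \<le> 2\<^sup>2" "(exp (- \<sigma>) - 1)\<^sup>2 \<le> (4 * K * (\<tau> * h))\<^sup>2"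
    using power_mono[of "exp (- \<sigma>)" 2 2] power_mono[of "\<bar>exp (- \<sigma>) - 1\<bar>" _ 2] by auto
  then have "(exp (- \<sigma>) * D j n)\<^sup>2 \<le> 2\<^sup>2 * (D j n)\<^sup>2" "((exp (- \<sigma>) - 1) * f n)\<^sup>2 \<le> (4 * K * (\<tau> * h))\<^sup>2 * (f n)\<^sup>2"
    unfolding power_mult_distrib[of "exp (- \<sigma>)"] power_mult_distrib[of "exp (- \<sigma>) - 1"]
    by (intro mult_right_mono; simp)+
  moreover have "(x + y)\<^sup>2 \<le> 2 * x\<^sup>2 + 2 * y\<^sup>2" for x y :: real
    using zero_le_power2[of "x - y"] by (simp add: power2_eq_square algebra_simps)
  from this[of "exp (- \<sigma>) * D j n" "(exp (- \<sigma>) - 1) * f n"]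
  have "(exp (- \<sigma>) * D j n + (exp (- \<sigma>) - 1) * f n)\<^sup>2 \<le> 2 * (exp (- \<sigma>) * D j n)\<^sup>2 + 2 * ((exp (- \<sigma>) - 1) * f n)\<^sup>2" .
  ultimately show ?thesis by (simp add: power_mult_distrib)
qed

text \<open>The terms of B and V lack one power of \<tau> compared with \<open>mass\<close> and
  \<open>energy\<close>, so \<tau> \<ge> 1 / \<epsilon> absorbs them in half of the Carleman lower
  bound. Only the commutator with the cutoff is left on the right.\<close>

lemma localized_estimate:
  fixes u :: "real ^ 'n::finite \<Rightarrow> real" and B :: "real ^ 'n \<Rightarrow> real ^ 'n" and V :: "real ^ 'n \<Rightarrow> real"
  assumes h: "0 < h" "h \<le> \<epsilon>" and \<tau>: "0 < \<tau>" "\<tau> * h \<le> \<epsilon>" "1 \<le> \<tau> * \<epsilon>"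
    and \<epsilon>: "400000 * real CARD('n) ^ 4 * weight_const ^ 8 * \<epsilon> \<le> exp (- 540)"
      "123 * (real CARD('n))\<^sup>2 * M\<^sup>2 * weight_const\<^sup>2 * \<epsilon> \<le> exp (- 540) / 4"
    and BV: "\<And>n. n \<in> lattice_ball h 3 \<Longrightarrow> norm (B n) \<le> M \<and> \<bar>V n\<bar> \<le> M"
    and eq: "\<And>n. n \<in> lattice_ball h 3 \<Longrightarrow> magnetic_schroedinger h B V u n = 0"
  shows "exp (- 540) / 4 * (\<tau>^3 * h^4 * (\<Sum>n\<in>lattice_ball h 3. (exp (\<tau> * gauss n) * (shell_cutoff n * u n))\<^sup>2))
    \<le> 3 * (\<Sum>n\<in>lattice_ball h 3. (exp (\<tau> * gauss n) * commutator_rest h B u n)\<^sup>2)"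
proof -
  let ?d = "real CARD('n)" and ?K = weight_const
  have d1: "1 \<le> ?d" using one_le_card_finite[where 'a = 'n] by (simp add: Suc_le_eq)
  have K1: "1 \<le> ?K" by (simp add: weight_const_def)
  have \<epsilon>0: "0 < \<epsilon>" using h by linarith
  have e540: "exp (- 540) \<le> (1::real)" by simp
  have \<epsilon>K: "4 * ?K * \<epsilon> \<le> 1"
  proof -
    have "4 * 1 * ?K ^ 1 \<le> 400000 * ?d ^ 4 * ?K ^ 8"
      using d1 K1 by (intro mult_mono power_increasing) (auto intro: order_trans[of 4 400000 "400000 * ?d ^ 4"])
    then have "4 * ?K * \<epsilon> \<le> 400000 * ?d ^ 4 * ?K ^ 8 * \<epsilon>" using \<epsilon>0 by (intro mult_right_mono) auto
    then show ?thesis using \<epsilon>(1) e540 by linarith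
  qed
  have hs: "h \<le> 1/1000"
    using \<epsilon>K h by (simp add: weight_const_def)
  define v where "v n = shell_cutoff n * u n" for n :: "real ^ 'n"
  define f where "f n = exp (\<tau> * gauss n) * v n" for n :: "real ^ 'n"
  interpret carleman_weight h f \<tau> \<epsilon> weight_const gauss gauss_grad gauss_hess "\<lambda>x. 240 * gauss x" "exp (- 540)"
  proof unfold_locales
    show "0 < h" "h \<le> \<epsilon>" "0 < \<tau>" "\<tau> * h \<le> \<epsilon>" "1 \<le> \<tau> * \<epsilon>" "1 \<le> ?K" "4 * ?K * \<epsilon> \<le> 1" by fact+
    show "h \<le> 1/10" using hs by simp
    show "400000 * ?d ^ 4 * ?K ^ 8 * \<epsilon> \<le> exp (- 540)" by fact
    then show "400000 * ?d ^ 4 * ?K ^ 8 * \<epsilon> \<le> 1" using e540 by linarith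
    show "f n = 0" if "2 \<le> norm n" for n
      using power_mono[OF that, of 2] by (simp add: f_def v_def shell_cutoff_zero)
    fix n :: "real ^ 'n" assume n: "norm n < 3"
    have K: "?K = 10000000" by (simp add: weight_const_def)
    note G = \<open>0 < h\<close> hs n
    show "\<bar>gauss (n + step h j) - gauss n - h * gauss_grad j n\<bar> \<le> ?K * h\<^sup>2" for j
      using gauss_grad_approx[OF G, of j] zero_le_power2[of h] unfolding K by linarith
    show "\<bar>gauss (n + step h j + step h k) + gauss n - gauss (n + step h j) - gauss (n + step h k) - h\<^sup>2 * gauss_hess j k n\<bar>
       \<le> ?K * h ^ 3" for j k
      using gauss_hess_approx[OF G, of j k] unfolding K .
    show "\<bar>gauss_grad j n\<bar> \<le> ?K" "\<bar>gauss_hess j k n\<bar> \<le> ?K" for j k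
      unfolding K using gauss_grad_bound[OF G] gauss_hess_bound[OF G] by auto
    show "\<bar>240 * gauss n\<bar> \<le> ?K" using gauss_pos[of n] gauss_le_one[of n] unfolding K by simp
    show "\<bar>gauss_hess j k (n + step h k) - gauss_hess j k n\<bar> \<le> ?K * h" for j k
      unfolding K by (rule gauss_hess_lip[OF G])
    show "\<bar>240 * gauss (n + step h j) - 240 * gauss n\<bar> \<le> ?K * h" for j
    proof -
      have "\<bar>240 * gauss (n + step h j) - 240 * gauss n\<bar> \<le> 48000 * h" using gauss_diff[OF G, of j] by linarith
      then show ?thesis using h(1) unfolding K by linarith
    qed
    show "exp (- 540) * (\<Sum>j\<in>UNIV. (\<xi> j)\<^sup>2) \<le> 4 * (\<Sum>j\<in>UNIV. \<Sum>k\<in>UNIV. gauss_hess j k n * \<xi> j * \<xi> k) + 240 * gauss n * (\<Sum>j\<in>UNIV. (\<xi> j)\<^sup>2)"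
      for \<xi> by (rule gauss_gradient_pos[OF n])
    show "exp (- 540) \<le> 4 * (\<Sum>j\<in>UNIV. \<Sum>k\<in>UNIV. gauss_hess j k n * gauss_grad j n * gauss_grad k n) - 240 * gauss n * (\<Sum>j\<in>UNIV. (gauss_grad j n)\<^sup>2)"
      if "f n \<noteq> 0"
    proof (rule gauss_zeroth_pos[OF n])
      show "9/100 \<le> (norm n)\<^sup>2"
      proof (rule ccontr)
        assume "\<not> 9/100 \<le> (norm n)\<^sup>2"
        then have "shell_cutoff n = 0" by (intro shell_cutoff_zero) auto
        then show False using that by (simp add: f_def v_def)
      qed
    qed
  qed simp_all
  let ?R = "\<lambda>n. exp (a n) * commutator_rest h B u n"
  have \<tau>1: "1 \<le> \<tau>"
  proof -
    have "\<tau> * \<epsilon> \<le> \<tau> * 1" using \<epsilon>_le \<tau>(1) by (intro mult_left_mono) auto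
    then show ?thesis using \<tau>(3) by linarith
  qed
  have pt: "(exp (a n) * discrete_laplacian h v n)\<^sup>2 \<le>
     24 * ?d * M\<^sup>2 * (h\<^sup>2 * (\<Sum>j\<in>UNIV. (D j n)\<^sup>2)) + (96 * ?d\<^sup>2 * M\<^sup>2 * ?K\<^sup>2 * (\<tau>\<^sup>2 * h^4) + 3 * M\<^sup>2 * h^4) * (f n)\<^sup>2 + 3 * (?R n)\<^sup>2"
    if n: "n \<in> L" for n
  proof -
    have Bj: "\<bar>B n $ j\<bar> \<le> M" for j using BV[OF n] component_le_norm_cart[of "B n" j] by linarith
    have M: "0 \<le> M" using Bj abs_ge_zero order_trans by blast
    define X where "X = (\<Sum>j\<in>UNIV. B n $ j * (exp (a n) * (v (n + step h j) - v n)))"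
    have "(\<Sum>j\<in>UNIV. (exp (a n) * (v (n + step h j) - v n))\<^sup>2) \<le> (\<Sum>j\<in>UNIV. 8 * (D j n)\<^sup>2 + 32 * ?K\<^sup>2 * \<tau>\<^sup>2 * h\<^sup>2 * (f n)\<^sup>2)"
      by (intro sum_mono conjugated_first_order[OF n]) (auto simp: f_def)
    then have "X\<^sup>2 \<le> ?d * M\<^sup>2 * (\<Sum>j\<in>UNIV. 8 * (D j n)\<^sup>2 + 32 * ?K\<^sup>2 * \<tau>\<^sup>2 * h\<^sup>2 * (f n)\<^sup>2)"
      unfolding X_def by (intro order_trans[OF bounded_coefficients_sum_square[OF Bj] mult_left_mono]) auto
    also have "\<dots> = ?d * M\<^sup>2 * (8 * (\<Sum>j\<in>UNIV. (D j n)\<^sup>2) + 32 * ?d * ?K\<^sup>2 * \<tau>\<^sup>2 * h\<^sup>2 * (f n)\<^sup>2)"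
      by (simp add: sum.distrib sum_distrib_left)
    finally have "h\<^sup>2 * X\<^sup>2 \<le> h\<^sup>2 * (?d * M\<^sup>2 * (8 * (\<Sum>j\<in>UNIV. (D j n)\<^sup>2) + 32 * ?d * ?K\<^sup>2 * \<tau>\<^sup>2 * h\<^sup>2 * (f n)\<^sup>2))"
      by (intro mult_left_mono) auto
    then have x: "(h * X)\<^sup>2 \<le> 8 * ?d * M\<^sup>2 * (h\<^sup>2 * (\<Sum>j\<in>UNIV. (D j n)\<^sup>2)) + 32 * ?d\<^sup>2 * M\<^sup>2 * ?K\<^sup>2 * (\<tau>\<^sup>2 * h^4) * (f n)\<^sup>2"
      by (simp add: power_mult_distrib algebra_simps power2_eq_square eval_nat_numeral)
    have "(V n)\<^sup>2 \<le> M\<^sup>2" using BV[OF n] power_mono[of "\<bar>V n\<bar>" M 2] by simp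
    then have "h^4 * (V n)\<^sup>2 * (f n)\<^sup>2 \<le> h^4 * M\<^sup>2 * (f n)\<^sup>2" by (intro mult_right_mono mult_left_mono) auto
    then have y: "(h\<^sup>2 * (V n * f n))\<^sup>2 \<le> M\<^sup>2 * h^4 * (f n)\<^sup>2" by (simp add: power_mult_distrib mult.commute mult.left_commute flip: power_mult)
    have "exp (a n) * discrete_laplacian h v n = - (h * X) - h\<^sup>2 * (V n * f n) + ?R n"
    proof -
      have v_eq: "v = (\<lambda>n. shell_cutoff n * u n)" by (simp add: fun_eq_iff v_def)
      have lap: "discrete_laplacian h v n = - (h * (\<Sum>j\<in>UNIV. B n $ j * (v (n + step h j) - v n))) - h\<^sup>2 * (V n * v n) + commutator_rest h B u n"
        unfolding v_eq
        by (rule laplacian_of_localized[where B = B and V = V and u = u and n = n and h = h])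
          (rule schroedinger_laplacian[OF less_imp_neq[OF h(1), symmetric] eq[OF n]])
      have X: "X = exp (a n) * (\<Sum>j\<in>UNIV. B n $ j * (v (n + step h j) - v n))"
        unfolding X_def sum_distrib_left by (rule sum.cong) auto
      show ?thesis unfolding lap X f_def by (simp add: algebra_simps)
    qed
    moreover have "(- x - y + z)\<^sup>2 \<le> 3 * x\<^sup>2 + 3 * y\<^sup>2 + 3 * z\<^sup>2" for x y z :: real
      using zero_le_power2[of "x - y"] zero_le_power2[of "x + z"] zero_le_power2[of "y + z"]
      by (simp add: power2_eq_square algebra_simps)
    ultimately have "(exp (a n) * discrete_laplacian h v n)\<^sup>2 \<le> 3 * (h * X)\<^sup>2 + 3 * (h\<^sup>2 * (V n * f n))\<^sup>2 + 3 * (?R n)\<^sup>2"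
      by simp
    also have "\<dots> \<le> 3 * (8 * ?d * M\<^sup>2 * (h\<^sup>2 * (\<Sum>j\<in>UNIV. (D j n)\<^sup>2)) + 32 * ?d\<^sup>2 * M\<^sup>2 * ?K\<^sup>2 * (\<tau>\<^sup>2 * h^4) * (f n)\<^sup>2)
      + 3 * (M\<^sup>2 * h^4 * (f n)\<^sup>2) + 3 * (?R n)\<^sup>2"
      using x y by (intro add_right_mono add_mono mult_left_mono) auto
    also have "\<dots> = 24 * ?d * M\<^sup>2 * (h\<^sup>2 * (\<Sum>j\<in>UNIV. (D j n)\<^sup>2)) + (96 * ?d\<^sup>2 * M\<^sup>2 * ?K\<^sup>2 * (\<tau>\<^sup>2 * h^4) + 3 * M\<^sup>2 * h^4) * (f n)\<^sup>2 + 3 * (?R n)\<^sup>2"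
      by (simp add: algebra_simps)
    finally show ?thesis .
  qed
  define F where "F = mass"
  define G where "G = energy"
  define P where "P = (\<Sum>n\<in>L. (f n)\<^sup>2)"
  define Q where "Q = (\<Sum>n\<in>L. \<Sum>j\<in>UNIV. (D j n)\<^sup>2)"
  have PQ: "0 \<le> P" "0 \<le> Q" by (auto simp: P_def Q_def intro!: sum_nonneg)
  have FG: "0 \<le> F" "0 \<le> G" using PQ h \<tau> unfolding F_def G_def P_def[symmetric] Q_def[symmetric] by auto
  have FP: "F = \<tau>^3 * h^4 * P" and GQ: "G = \<tau> * h\<^sup>2 * Q" by (simp_all add: F_def G_def P_def Q_def)
  \<comment> \<open>123 = 24 + 96 + 3, the sum of the numerical coefficients of the gradient term,
    the conjugation error and the potential.\<close>
  define E where "E = 123 * ?d\<^sup>2 * M\<^sup>2 * ?K\<^sup>2"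
  have "exp (- 540) / 2 * (F + G) \<le> (\<Sum>n\<in>L. (sym_part h a f n + asym_part h a f n)\<^sup>2)"
    unfolding F_def G_def by (rule carleman_estimate)
  also have "\<dots> = (\<Sum>n\<in>L. (exp (a n) * discrete_laplacian h v n)\<^sup>2)"
  proof -
    have "f = (\<lambda>n. exp (a n) * v n)" by (simp add: fun_eq_iff f_def)
    then show ?thesis by (simp only: conjugated_laplacian[where a = a])
  qed
  also have "\<dots> \<le> (\<Sum>n\<in>L. 24 * ?d * M\<^sup>2 * (h\<^sup>2 * (\<Sum>j\<in>UNIV. (D j n)\<^sup>2)) + (96 * ?d\<^sup>2 * M\<^sup>2 * ?K\<^sup>2 * (\<tau>\<^sup>2 * h^4) + 3 * M\<^sup>2 * h^4) * (f n)\<^sup>2 + 3 * (?R n)\<^sup>2)"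
    by (intro sum_mono pt)
  also have "\<dots> = 24 * ?d * M\<^sup>2 * (h\<^sup>2 * Q) + (96 * ?d\<^sup>2 * M\<^sup>2 * ?K\<^sup>2 * (\<tau>\<^sup>2 * h^4) + 3 * M\<^sup>2 * h^4) * P + 3 * (\<Sum>n\<in>L. (?R n)\<^sup>2)"
    unfolding P_def Q_def by (simp only: sum.distrib sum_distrib_left[where A = L])
  also have "24 * ?d * M\<^sup>2 * (h\<^sup>2 * Q) + (96 * ?d\<^sup>2 * M\<^sup>2 * ?K\<^sup>2 * (\<tau>\<^sup>2 * h^4) + 3 * M\<^sup>2 * h^4) * P \<le> E * (\<epsilon> * (F + G))"
  proof -
    have q: "h\<^sup>2 * Q \<le> \<epsilon> * G"
      using mult_right_mono[OF \<tau>(3), of "h\<^sup>2 * Q"] PQ unfolding GQ by (simp add: mult.commute mult.left_commute)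
    have nn: "0 \<le> \<tau>\<^sup>2 * h^4 * P" using PQ(1) by (intro mult_nonneg_nonneg) auto
    have p1: "\<tau>\<^sup>2 * h^4 * P \<le> \<epsilon> * F"
      using mult_right_mono[OF \<tau>(3) nn] unfolding FP by (simp add: mult.commute mult.left_commute eval_nat_numeral)
    have p2: "h^4 * P \<le> \<epsilon> * F"
    proof -
      have "1 * (h^4 * P) \<le> \<tau>\<^sup>2 * (h^4 * P)" using \<tau>1 PQ by (intro mult_right_mono) auto
      then show ?thesis using p1 by (simp add: mult.assoc)
    qed
    have dd: "?d \<le> ?d\<^sup>2" "1 \<le> ?d\<^sup>2" "1 \<le> ?K\<^sup>2" using d1 K1 by (auto simp: power2_eq_square mult_ge1_I)
    have "?d * M\<^sup>2 * 1 \<le> ?d\<^sup>2 * M\<^sup>2 * ?K\<^sup>2"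
      by (rule mult_mono[OF mult_right_mono[OF dd(1)] dd(3)]) auto
    moreover have "1 * M\<^sup>2 * 1 \<le> ?d\<^sup>2 * M\<^sup>2 * ?K\<^sup>2"
      by (rule mult_mono[OF mult_right_mono[OF dd(2)] dd(3)]) auto
    moreover have "0 \<le> ?d\<^sup>2 * M\<^sup>2 * ?K\<^sup>2" by simp
    ultimately have "24 * (?d * M\<^sup>2 * 1) \<le> 123 * (?d\<^sup>2 * M\<^sup>2 * ?K\<^sup>2)" "3 * (1 * M\<^sup>2 * 1) \<le> 3 * (?d\<^sup>2 * M\<^sup>2 * ?K\<^sup>2)"
      by linarith+
    then have k: "24 * ?d * M\<^sup>2 \<le> E" "3 * M\<^sup>2 \<le> 3 * ?d\<^sup>2 * M\<^sup>2 * ?K\<^sup>2" unfolding E_def by (simp_all only: mult.assoc mult_1 mult_1_right)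
    have s1: "24 * ?d * M\<^sup>2 * (h\<^sup>2 * Q) \<le> E * (\<epsilon> * G)"
      by (rule mult_mono[OF k(1) q]) (use PQ in \<open>auto simp: E_def\<close>)
    have s2: "96 * ?d\<^sup>2 * M\<^sup>2 * ?K\<^sup>2 * (\<tau>\<^sup>2 * h^4 * P) \<le> 96 * ?d\<^sup>2 * M\<^sup>2 * ?K\<^sup>2 * (\<epsilon> * F)"
      using p1 by (intro mult_left_mono) auto
    have s3: "3 * M\<^sup>2 * (h^4 * P) \<le> 3 * ?d\<^sup>2 * M\<^sup>2 * ?K\<^sup>2 * (\<epsilon> * F)"
      by (rule mult_mono[OF k(2) p2]) (use PQ in auto)
    have s4: "96 * ?d\<^sup>2 * M\<^sup>2 * ?K\<^sup>2 * (\<epsilon> * F) + 3 * ?d\<^sup>2 * M\<^sup>2 * ?K\<^sup>2 * (\<epsilon> * F) \<le> E * (\<epsilon> * F)"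
      unfolding distrib_right[symmetric] E_def using FG \<epsilon>0 by (intro mult_right_mono) auto
    have "24 * ?d * M\<^sup>2 * (h\<^sup>2 * Q) + (96 * ?d\<^sup>2 * M\<^sup>2 * ?K\<^sup>2 * (\<tau>\<^sup>2 * h^4 * P) + 3 * M\<^sup>2 * (h^4 * P)) \<le> E * (\<epsilon> * G) + E * (\<epsilon> * F)"
      by (rule add_mono[OF s1 order_trans[OF add_mono[OF s2 s3] s4]])
    then show ?thesis by (simp only: distrib_left distrib_right mult.assoc add.commute add.left_commute)
  qed
  also have "E * (\<epsilon> * (F + G)) \<le> exp (- 540) / 4 * (F + G)"
    using \<epsilon>(2) FG unfolding E_def[symmetric] mult.assoc[symmetric, of E] by (intro mult_right_mono) auto
  finally have "exp (- 540) / 2 * (F + G) \<le> exp (- 540) / 4 * (F + G) + 3 * (\<Sum>n\<in>L. (?R n)\<^sup>2)" by simp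
  moreover have "exp (- 540) / 4 * F \<le> exp (- 540) / 4 * (F + G)" using FG by (intro mult_left_mono) auto
  moreover have "exp (- 540) / 2 * (F + G) = exp (- 540) / 4 * (F + G) + exp (- 540) / 4 * (F + G)" by (simp add: field_simps)
  ultimately have "exp (- 540) / 4 * F \<le> 3 * (\<Sum>n\<in>L. (?R n)\<^sup>2)" by linarith
  then show ?thesis unfolding F_def f_def v_def .
qed

text \<open>Collects the constants of lemma \<open>caccioppoli\<close> for cutoffs of width at least 1/50.\<close>

definition energy_const :: "real \<Rightarrow> real \<Rightarrow> real" where
  "energy_const d M = d + 2 * d * (2500000 + 2 * M\<^sup>2) + 4 * M"

text \<open>Returns the density produced by \<open>commutator_rest_bound\<close> to \<open>u\<close>
  alone, at the price of enlarging the region; both parts carry \<open>h^2\<close>, which matters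
  for the final homogeneity in \<open>h\<close>.\<close>

lemma cutoff_energy:
  fixes u :: "real ^ 'n::finite \<Rightarrow> real"
  assumes h: "0 < h" "h \<le> 1/10" and \<alpha>\<beta>: "\<alpha> < \<beta>" "\<beta> - \<alpha> \<le> 1" "1/50 \<le> \<beta> - \<alpha>" "\<beta> \<le> 5" and M: "0 \<le> M"
    and R: "0 < R" "R \<le> 3" "\<beta> \<le> (R - h)\<^sup>2" "h < R"
    and BV: "\<And>n. n \<in> lattice_ball h 3 \<Longrightarrow> norm (B n) \<le> M \<and> \<bar>V n\<bar> \<le> M"
    and eq: "\<And>n. n \<in> lattice_ball h 3 \<Longrightarrow> magnetic_schroedinger h B V u n = 0"
  shows "(\<Sum>n\<in>lattice_ball h 3. cutoff \<alpha> \<beta> n * (real CARD('n) * h\<^sup>2 * (u n)\<^sup>2 + grad_sq h u n)) \<le>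
    energy_const (real CARD('n)) M * h\<^sup>2 * (\<Sum>n\<in>lattice_ball h R. (u n)\<^sup>2)"
proof -
  let ?L = "lattice_ball h 3 :: (real ^ 'n) set" and ?LR = "lattice_ball h R :: (real ^ 'n) set" and ?d = "real CARD('n)"
  \<comment> \<open>2500000 = 1000 * 50^2, from the minimal width 1/50.\<close>
  have c: "1000 / (\<beta> - \<alpha>)\<^sup>2 \<le> 2500000"
  proof -
    have "(1/50)\<^sup>2 \<le> (\<beta> - \<alpha>)\<^sup>2" using \<alpha>\<beta> by (intro power_mono) auto
    then have "1000 / (\<beta> - \<alpha>)\<^sup>2 \<le> 1000 / (1/50)\<^sup>2" by (intro divide_left_mono) (auto simp: power2_eq_square)
    then show ?thesis by (simp add: power2_eq_square)
  qed
  have "(\<Sum>n\<in>?L. cutoff \<alpha> \<beta> n * (u n)\<^sup>2) = (\<Sum>n\<in>?LR. cutoff \<alpha> \<beta> n * (u n)\<^sup>2)"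
  proof (rule sum.mono_neutral_right)
    show "?LR \<subseteq> ?L" using R(2) by (auto simp: lattice_ball_def)
    show "\<forall>n\<in>?L - ?LR. cutoff \<alpha> \<beta> n * (u n)\<^sup>2 = 0"
    proof
      fix n assume "n \<in> ?L - ?LR"
      then have "R - h \<le> norm n" using h by (auto simp: lattice_ball_def)
      then have "(R - h)\<^sup>2 \<le> (norm n)\<^sup>2" using R by (intro power_mono) auto
      then show "cutoff \<alpha> \<beta> n * (u n)\<^sup>2 = 0" using R(3) by (simp add: cutoff_zero[OF \<alpha>\<beta>(1)])
    qed
  qed (rule finite_lattice_ball[OF h(1)])
  also have "\<dots> \<le> (\<Sum>n\<in>?LR. 1 * (u n)\<^sup>2)" by (intro sum_mono mult_right_mono cutoff_bounds) auto
  finally have m: "(\<Sum>n\<in>?L. cutoff \<alpha> \<beta> n * (u n)\<^sup>2) \<le> (\<Sum>n\<in>?LR. (u n)\<^sup>2)" by simp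
  have "(\<Sum>n\<in>?L. cutoff \<alpha> \<beta> n * grad_sq h u n) \<le> (2 * ?d * (1000 / (\<beta> - \<alpha>)\<^sup>2 + 2 * M\<^sup>2) + 4 * M) * h\<^sup>2 * (\<Sum>n\<in>?LR. (u n)\<^sup>2)"
    by (rule caccioppoli) (use assms in auto)
  also have "\<dots> \<le> (2 * ?d * (2500000 + 2 * M\<^sup>2) + 4 * M) * h\<^sup>2 * (\<Sum>n\<in>?LR. (u n)\<^sup>2)"
    using c by (intro mult_right_mono add_right_mono mult_left_mono sum_nonneg) auto
  finally have g: "(\<Sum>n\<in>?L. cutoff \<alpha> \<beta> n * grad_sq h u n) \<le> (2 * ?d * (2500000 + 2 * M\<^sup>2) + 4 * M) * h\<^sup>2 * (\<Sum>n\<in>?LR. (u n)\<^sup>2)" .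
  have "(\<Sum>n\<in>?L. cutoff \<alpha> \<beta> n * (?d * h\<^sup>2 * (u n)\<^sup>2 + grad_sq h u n)) =
     ?d * h\<^sup>2 * (\<Sum>n\<in>?L. cutoff \<alpha> \<beta> n * (u n)\<^sup>2) + (\<Sum>n\<in>?L. cutoff \<alpha> \<beta> n * grad_sq h u n)"
    unfolding sum_distrib_left[where A = ?L] sum.distrib[symmetric] by (rule sum.cong) (simp_all only: distrib_left mult.assoc mult.left_commute)
  also have "\<dots> \<le> ?d * h\<^sup>2 * (\<Sum>n\<in>?LR. (u n)\<^sup>2) + (2 * ?d * (2500000 + 2 * M\<^sup>2) + 4 * M) * h\<^sup>2 * (\<Sum>n\<in>?LR. (u n)\<^sup>2)"
    using m g by (intro add_mono mult_left_mono) auto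
  also have "\<dots> = energy_const ?d M * h\<^sup>2 * (\<Sum>n\<in>?LR. (u n)\<^sup>2)" by (simp add: energy_const_def algebra_simps)
  finally show ?thesis .
qed

text \<open>The commutator lives near the two transition zones. Near the inner one the weight is
  bounded by 1; near the outer one, which lies beyond radius 7/5, by
  \<open>exp (- 20 * (49/25))\<close>. The new cutoffs equal 1 on these zones and prepare the
  Caccioppoli inequality.\<close>

lemma commutator_localized:
  fixes u :: "real ^ 'n::finite \<Rightarrow> real" and B :: "real ^ 'n \<Rightarrow> real ^ 'n"
  assumes h: "0 < h" "h \<le> 1/1000" and \<tau>: "0 < \<tau>" and n: "norm n < 3" and B: "norm (B n) \<le> M"
  shows "(exp (\<tau> * gauss n) * commutator_rest h B u n)\<^sup>2 \<le> 3 * real CARD('n) * (500000 * (1 + M))\<^sup>2 * h\<^sup>2 *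
      (exp (2 * \<tau>) * (cutoff (1/5) (11/50) n * (real CARD('n) * h\<^sup>2 * (u n)\<^sup>2 + grad_sq h u n))
       + exp (2 * \<tau> * exp (- 20 * (49/25))) * (cutoff 3 (7/2) n * (real CARD('n) * h\<^sup>2 * (u n)\<^sup>2 + grad_sq h u n)))"
proof -
  let ?W = "real CARD('n) * h\<^sup>2 * (u n)\<^sup>2 + grad_sq h u n" and ?C = "3 * real CARD('n) * (500000 * (1 + M))\<^sup>2 * h\<^sup>2"
  let ?rhs = "exp (2 * \<tau>) * (cutoff (1/5) (11/50) n * ?W) + exp (2 * \<tau> * exp (- 20 * (49/25))) * (cutoff 3 (7/2) n * ?W)"
  have W: "0 \<le> ?W" by (intro add_nonneg_nonneg sum_nonneg) auto
  have rest: "(exp (\<tau> * gauss n) * commutator_rest h B u n)\<^sup>2 \<le> exp (2 * \<tau> * gauss n) * (?C * ?W)"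
  proof -
    have "(exp (\<tau> * gauss n))\<^sup>2 = exp (2 * \<tau> * gauss n)" by (simp add: power2_eq_square flip: exp_add)
    then have e: "(exp (\<tau> * gauss n) * commutator_rest h B u n)\<^sup>2 = exp (2 * \<tau> * gauss n) * (commutator_rest h B u n)\<^sup>2"
      by (simp only: power_mult_distrib)
    have "(commutator_rest h B u n)\<^sup>2 \<le> ?C * ?W"
      by (rule commutator_rest_bound) (use h n B in auto)
    then show ?thesis unfolding e by (rule mult_left_mono) simp
  qed
  have nn: "0 \<le> cutoff (1/5) (11/50) n * ?W" "0 \<le> cutoff 3 (7/2) n * ?W"
    using W by (auto intro!: mult_nonneg_nonneg cutoff_bounds)
  consider "(norm n)\<^sup>2 \<le> 1/5" | "49/25 \<le> (norm n)\<^sup>2" "(norm n)\<^sup>2 \<le> 3" | "1/5 < (norm n)\<^sup>2 \<and> (norm n)\<^sup>2 < 49/25 \<or> 3 < (norm n)\<^sup>2"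
    by linarith
  then show ?thesis
  proof cases
    case 1
    then have "cutoff (1/5) (11/50) n = 1" by (intro cutoff_one) auto
    moreover have "exp (2 * \<tau> * gauss n) * ?W \<le> exp (2 * \<tau>) * ?W" using gauss_le_one[of n] \<tau> W by (intro mult_right_mono) auto
    ultimately have "exp (2 * \<tau> * gauss n) * ?W \<le> ?rhs" using nn(2) by (simp add: add_increasing2)
    then have "?C * (exp (2 * \<tau> * gauss n) * ?W) \<le> ?C * ?rhs" by (intro mult_left_mono) auto
    then show ?thesis using rest by (simp only: mult.left_commute)
  next
    case 2
    then have "cutoff 3 (7/2) n = 1" by (intro cutoff_one) auto
    moreover have "gauss n \<le> exp (- 20 * (49/25))" using 2 by (simp add: gauss_def)
    then have "exp (2 * \<tau> * gauss n) * ?W \<le> exp (2 * \<tau> * exp (- 20 * (49/25))) * ?W" using \<tau> W by (intro mult_right_mono) auto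
    ultimately have "exp (2 * \<tau> * gauss n) * ?W \<le> ?rhs" using nn(1) by (simp add: add_increasing)
    then have "?C * (exp (2 * \<tau> * gauss n) * ?W) \<le> ?C * ?rhs" by (intro mult_left_mono) auto
    then show ?thesis using rest by (simp only: mult.left_commute)
  next
    case 3
    then have "commutator_rest h B u n = 0"
      unfolding commutator_rest_def by (simp add: shell_cutoff_locally_constant[OF h n 3])
    moreover have "0 \<le> ?rhs" by (intro add_nonneg_nonneg mult_nonneg_nonneg[OF exp_ge_zero] nn)
    then have "0 \<le> ?C * ?rhs" by (rule mult_nonneg_nonneg[rotated]) simp
    ultimately show ?thesis by simp
  qed
qed

section \<open>The three balls inequality\<close>

text \<open>36 = 4 * 3 * 3: the inverse of \<open>exp (- 540) / 4\<close>, the factor of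
  \<open>localized_estimate\<close> and that of \<open>commutator_rest_bound\<close>.\<close>

definition three_ball_const :: "real \<Rightarrow> real \<Rightarrow> real" where
  "three_ball_const d M = 36 * d * (500000 * (1 + M))\<^sup>2 * energy_const d M * exp 540"

text \<open>On the shell the cutoff is 1 and the weight at least exp (-20). The powers of
  \<open>h\<close> balance: \<open>h^4\<close> from \<open>mass\<close> on the left,
  \<open>h^2\<close> from the commutator and \<open>h^2\<close> from the Caccioppoli inequality on
  the right; \<open>\<tau>^3\<close> on the left is bounded below by 1.\<close>

lemma shell_estimate:
  fixes u :: "real ^ 'n::finite \<Rightarrow> real" and B :: "real ^ 'n \<Rightarrow> real ^ 'n" and V :: "real ^ 'n \<Rightarrow> real"
  assumes h: "0 < h" "h \<le> \<epsilon>" "h \<le> 1/1000" and \<tau>: "1 \<le> \<tau>" "\<tau> * h \<le> \<epsilon>" "1 \<le> \<tau> * \<epsilon>"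
    and \<epsilon>: "400000 * real CARD('n) ^ 4 * weight_const ^ 8 * \<epsilon> \<le> exp (- 540)"
      "123 * (real CARD('n))\<^sup>2 * M\<^sup>2 * weight_const\<^sup>2 * \<epsilon> \<le> exp (- 540) / 4" and M: "0 \<le> M"
    and BV: "\<And>n. n \<in> lattice_ball h 3 \<Longrightarrow> norm (B n) \<le> M \<and> \<bar>V n\<bar> \<le> M"
    and eq: "\<And>n. n \<in> lattice_ball h 3 \<Longrightarrow> magnetic_schroedinger h B V u n = 0"
  shows "exp (2 * \<tau> * exp (- 20)) * (\<Sum>n\<in>lattice_ball h 1 - lattice_ball h (1/2). (u n)\<^sup>2) \<le>
    three_ball_const (real CARD('n)) M * (exp (2 * \<tau>) * (\<Sum>n\<in>lattice_ball h (1/2). (u n)\<^sup>2)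
      + exp (2 * \<tau> * exp (- 20 * (49/25))) * (\<Sum>n\<in>lattice_ball h 2. (u n)\<^sup>2))"
proof -
  let ?L = "lattice_ball h 3 :: (real ^ 'n) set" and ?S = "lattice_ball h 1 - lattice_ball h (1/2) :: (real ^ 'n) set"
  let ?d = "real CARD('n)" and ?\<rho> = "exp (2 * \<tau> * exp (- 20 * (49/25)))"
  let ?W = "\<lambda>n. ?d * h\<^sup>2 * (u n)\<^sup>2 + grad_sq h u n"
  let ?C = "3 * ?d * (500000 * (1 + M))\<^sup>2 * h\<^sup>2"
  define X where "X = exp (2 * \<tau> * exp (- 20)) * (\<Sum>n\<in>?S. (u n)\<^sup>2)"
  define Y where "Y = exp (2 * \<tau>) * (\<Sum>n\<in>lattice_ball h (1/2). (u n)\<^sup>2) + ?\<rho> * (\<Sum>n\<in>lattice_ball h 2. (u n)\<^sup>2)"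
  have "X \<le> (\<Sum>n\<in>?L. (exp (\<tau> * gauss n) * (shell_cutoff n * u n))\<^sup>2)"
  proof -
    have "X = (\<Sum>n\<in>?S. exp (2 * \<tau> * exp (- 20)) * (u n)\<^sup>2)" unfolding X_def by (rule sum_distrib_left)
    also have "\<dots> \<le> (\<Sum>n\<in>?S. (exp (\<tau> * gauss n) * (shell_cutoff n * u n))\<^sup>2)"
    proof (rule sum_mono)
      fix n assume "n \<in> ?S"
      then have n: "1/2 \<le> norm n" "norm n < 1" by (auto simp: lattice_ball_def)
      have "(1/2)\<^sup>2 \<le> (norm n)\<^sup>2" using n by (intro power_mono) auto
      moreover have "(norm n)\<^sup>2 \<le> 1\<^sup>2" using n by (intro power_mono) auto
      ultimately have n2: "1/4 \<le> (norm n)\<^sup>2" "(norm n)\<^sup>2 \<le> 1" by (simp_all add: power2_eq_square)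
      then have "shell_cutoff n = 1" by (intro shell_cutoff_one) auto
      moreover have "exp (- 20) \<le> gauss n" using n2 by (simp add: gauss_def)
      then have "exp (2 * \<tau> * exp (- 20)) \<le> exp (2 * \<tau> * gauss n)" using \<tau> by simp
      moreover have "(exp (\<tau> * gauss n))\<^sup>2 = exp (2 * \<tau> * gauss n)" by (simp add: power2_eq_square flip: exp_add)
      ultimately show "exp (2 * \<tau> * exp (- 20)) * (u n)\<^sup>2 \<le> (exp (\<tau> * gauss n) * (shell_cutoff n * u n))\<^sup>2"
        unfolding power_mult_distrib by (simp add: mult_right_mono)
    qed
    also have "\<dots> \<le> (\<Sum>n\<in>?L. (exp (\<tau> * gauss n) * (shell_cutoff n * u n))\<^sup>2)"
      by (intro sum_mono2 finite_lattice_ball h(1)) (auto simp: lattice_ball_def)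
    finally show ?thesis .
  qed
  moreover have "1 * h^4 \<le> \<tau>^3 * h^4" using \<tau>(1) by (intro mult_right_mono one_le_power) auto
  ultimately have "1 * h^4 * X \<le> \<tau>^3 * h^4 * (\<Sum>n\<in>?L. (exp (\<tau> * gauss n) * (shell_cutoff n * u n))\<^sup>2)"
    using \<tau>(1) by (intro mult_mono) (auto simp: X_def intro!: sum_nonneg mult_nonneg_nonneg)
  then have "exp (- 540) / 4 * (h^4 * X) \<le> exp (- 540) / 4 * (\<tau>^3 * h^4 * (\<Sum>n\<in>?L. (exp (\<tau> * gauss n) * (shell_cutoff n * u n))\<^sup>2))"
    by (intro mult_left_mono) auto
  also have "\<dots> \<le> 3 * (\<Sum>n\<in>?L. (exp (\<tau> * gauss n) * commutator_rest h B u n)\<^sup>2)"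
    using \<tau>(1) by (intro localized_estimate[where B = B and V = V, OF h(1,2) _ \<tau>(2,3) \<epsilon>] BV eq) auto
  also have "\<dots> \<le> 3 * (\<Sum>n\<in>?L. ?C * (exp (2 * \<tau>) * (cutoff (1/5) (11/50) n * ?W n) + ?\<rho> * (cutoff 3 (7/2) n * ?W n)))"
    using \<tau>(1) by (intro mult_left_mono sum_mono commutator_localized h conjunct1[OF BV]) (auto simp: lattice_ball_def)
  also have "\<dots> = 3 * (?C * (exp (2 * \<tau>) * (\<Sum>n\<in>?L. cutoff (1/5) (11/50) n * ?W n) + ?\<rho> * (\<Sum>n\<in>?L. cutoff 3 (7/2) n * ?W n)))"
    by (simp only: sum_distrib_left[where A = ?L] sum.distrib distrib_left)
  also have "\<dots> \<le> 3 * (?C * (exp (2 * \<tau>) * (energy_const ?d M * h\<^sup>2 * (\<Sum>n\<in>lattice_ball h (1/2). (u n)\<^sup>2))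
      + ?\<rho> * (energy_const ?d M * h\<^sup>2 * (\<Sum>n\<in>lattice_ball h 2. (u n)\<^sup>2))))"
  proof (intro mult_left_mono add_mono)
    \<comment> \<open>The energy cutoffs end at squared radii 0.22 and 3.5, so a collar of width
      \<open>h\<close> still fits inside the balls of radius 1/2 and 2.\<close>
    have "11/50 \<le> (1/2 - 1/1000 :: real)\<^sup>2" "7/2 \<le> (2 - 1/1000 :: real)\<^sup>2" by (simp_all add: power2_eq_square)
    moreover have "(1/2 - 1/1000)\<^sup>2 \<le> (1/2 - h)\<^sup>2" "(2 - 1/1000)\<^sup>2 \<le> (2 - h)\<^sup>2" using h by (intro power_mono; simp)+
    ultimately have r: "11/50 \<le> (1/2 - h)\<^sup>2" "7/2 \<le> (2 - h)\<^sup>2" by linarith+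
    show "(\<Sum>n\<in>?L. cutoff (1/5) (11/50) n * ?W n) \<le> energy_const ?d M * h\<^sup>2 * (\<Sum>n\<in>lattice_ball h (1/2). (u n)\<^sup>2)"
      by (rule cutoff_energy[where B = B and V = V]) (use h M BV eq r(1) in auto)
    show "(\<Sum>n\<in>?L. cutoff 3 (7/2) n * ?W n) \<le> energy_const ?d M * h\<^sup>2 * (\<Sum>n\<in>lattice_ball h 2. (u n)\<^sup>2)"
      by (rule cutoff_energy[where B = B and V = V]) (use h M BV eq r(2) in auto)
  qed auto
  also have "\<dots> = 9 * ?d * (500000 * (1 + M))\<^sup>2 * energy_const ?d M * (h^4 * Y)"
    unfolding Y_def by (simp add: distrib_left distrib_right mult.assoc mult.commute mult.left_commute eval_nat_numeral)
  finally have i: "4 * exp 540 * (exp (- 540) / 4 * (h^4 * X)) \<le> 4 * exp 540 * (9 * ?d * (500000 * (1 + M))\<^sup>2 * energy_const ?d M * (h^4 * Y))"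
    by (intro mult_left_mono) auto
  have e1: "4 * exp 540 * (exp (- 540) / 4 * (h^4 * X)) = h^4 * X" by (simp add: exp_minus field_simps)
  have e2: "4 * exp 540 * (9 * ?d * (500000 * (1 + M))\<^sup>2 * energy_const ?d M * (h^4 * Y)) = h^4 * (three_ball_const ?d M * Y)"
    by (simp add: three_ball_const_def)
  have "h^4 * X \<le> h^4 * (three_ball_const ?d M * Y)" using i unfolding e1 e2 .
  then show ?thesis using h(1) unfolding X_def Y_def by simp
qed

theorem theorem1:
  fixes B :: "real \<Rightarrow> real ^ 'n::finite \<Rightarrow> real ^ 'n"
    and V :: "real \<Rightarrow> real ^ 'n \<Rightarrow> real"
  assumes "\<exists>M. \<forall>h\<in>{0<..<1}. \<forall>n\<in>lattice h. norm (B h n) \<le> M \<and> \<bar>V h n\<bar> \<le> M"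
  shows "\<exists>h0 \<delta>0 c1 c2 \<tau>0 C :: real.
    0 < h0 \<and> h0 < 1 \<and> 0 < \<delta>0 \<and> \<delta>0 < 1 \<and> c1 > 0 \<and> c2 > 0 \<and> \<tau>0 > 1 \<and> C > 0 \<and>
    (\<forall>h\<in>{0<..<h0}. \<forall>\<tau>\<in>{\<tau>0<..<\<delta>0 / h}. \<forall>u :: real ^ 'n \<Rightarrow> real.
      (\<forall>n\<in>lattice_ball h 4. magnetic_schroedinger h (B h) (V h) u n = 0) \<longrightarrow>
      L2_set u (lattice_ball h 1) \<le>
        C * (exp (c1 * \<tau>) * L2_set u (lattice_ball h (1 / 2))
             + exp (- c2 * \<tau>) * L2_set u (lattice_ball h 2)))"
proof -
  obtain M0 where M0: "\<forall>h\<in>{0<..<1}. \<forall>n\<in>lattice h. norm (B h n) \<le> M0 \<and> \<bar>V h n\<bar> \<le> M0"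
    using assms by blast
  define M where "M = max 0 M0"
  have BV: "norm (B h n) \<le> M \<and> \<bar>V h n\<bar> \<le> M" if "h \<in> {0<..<1}" "n \<in> lattice h" for h n
    using M0 that by (force simp: M_def)
  have M: "0 \<le> M" by (simp add: M_def)
  define d where "d = real CARD('n)"
  have d: "1 \<le> d" using one_le_card_finite[where 'a = 'n] by (simp add: d_def Suc_le_eq)
  \<comment> \<open>\<open>Q\<close> adds up all smallness conditions so that one \<epsilon> meets
    them: 492 = 4 * 123 accounts for the quarter on the right, and 1000 forces \<epsilon> \<le>
    1/1000.\<close>
  define Q where "Q = 400000 * d ^ 4 * weight_const ^ 8 + 492 * d\<^sup>2 * M\<^sup>2 * weight_const\<^sup>2 + 1000"
  define \<epsilon> where "\<epsilon> = exp (- 540) / Q"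
  have Q: "1000 \<le> Q" using d by (auto simp: Q_def weight_const_def)
  have \<epsilon>Q: "Q * \<epsilon> = exp (- 540)" using Q by (simp add: \<epsilon>_def)
  have \<epsilon>0: "0 < \<epsilon>" using Q by (simp add: \<epsilon>_def)
  have \<epsilon>1: "400000 * real CARD('n) ^ 4 * weight_const ^ 8 * \<epsilon> \<le> exp (- 540)"
    "123 * (real CARD('n))\<^sup>2 * M\<^sup>2 * weight_const\<^sup>2 * \<epsilon> \<le> exp (- 540) / 4" "1000 * \<epsilon> \<le> exp (- 540)"
  proof -
    have "400000 * d ^ 4 * weight_const ^ 8 \<le> Q" "492 * d\<^sup>2 * M\<^sup>2 * weight_const\<^sup>2 \<le> Q"
      using d by (auto simp: Q_def weight_const_def)
    then have "400000 * d ^ 4 * weight_const ^ 8 * \<epsilon> \<le> Q * \<epsilon>" "492 * d\<^sup>2 * M\<^sup>2 * weight_const\<^sup>2 * \<epsilon> \<le> Q * \<epsilon>" "1000 * \<epsilon> \<le> Q * \<epsilon>"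
      using \<epsilon>0 Q by (auto intro!: mult_right_mono)
    then show "400000 * real CARD('n) ^ 4 * weight_const ^ 8 * \<epsilon> \<le> exp (- 540)"
    "123 * (real CARD('n))\<^sup>2 * M\<^sup>2 * weight_const\<^sup>2 * \<epsilon> \<le> exp (- 540) / 4" "1000 * \<epsilon> \<le> exp (- 540)"
      unfolding \<epsilon>Q d_def by simp_all
  qed
  have "exp (- 540) \<le> (1::real)" by simp
  then have \<epsilon>s: "\<epsilon> \<le> 1/1000" using \<epsilon>1(3) by linarith
  \<comment> \<open>The drop of the weight between the unit sphere and radius 7/5, inside of which
    the outer part of the commutator vanishes.\<close>
  define c2 :: real where "c2 = exp (- 20) - exp (- 20 * (49/25))"
  have c2: "0 < c2" by (simp add: c2_def)
  \<comment> \<open>The summand 1 accounts for the ball of radius 1/2, which the shell estimate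
    leaves out and which is bounded by itself.\<close>
  define A where "A = 1 + three_ball_const d M"
  have A: "1 \<le> A" using d M by (simp add: A_def three_ball_const_def energy_const_def)
  have main: "L2_set u (lattice_ball h 1) \<le>
        sqrt A * (exp (1 * \<tau>) * L2_set u (lattice_ball h (1 / 2)) + exp (- c2 * \<tau>) * L2_set u (lattice_ball h 2))"
    if h: "h \<in> {0<..<\<epsilon>}" and \<tau>: "\<tau> \<in> {1 / \<epsilon><..<\<epsilon> / h}" and eq: "\<forall>n\<in>lattice_ball h 4. magnetic_schroedinger h (B h) (V h) u n = 0"
    for h \<tau> and u :: "real ^ 'n \<Rightarrow> real"
  proof -
    have h0: "0 < h" "h \<le> \<epsilon>" "h \<le> 1/1000" using h \<epsilon>s by auto
    have \<tau>\<epsilon>: "\<tau> * h \<le> \<epsilon>" "1 \<le> \<tau> * \<epsilon>" using \<tau> h0 \<epsilon>0 by (auto simp: field_simps)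
    have \<tau>1: "1 \<le> \<tau>"
    proof -
      have "1 \<le> 1 / \<epsilon>" using \<epsilon>0 \<epsilon>s by simp
      then show ?thesis using \<tau> by simp
    qed
    let ?U = "\<lambda>r. \<Sum>n\<in>lattice_ball h r. (u n)\<^sup>2"
    have fin: "finite (lattice_ball h r :: (real ^ 'n) set)" for r by (rule finite_lattice_ball[OF h0(1)])
    have U0: "0 \<le> ?U r" for r by (intro sum_nonneg) auto
    define Z where "Z = (\<Sum>n\<in>lattice_ball h 1 - lattice_ball h (1/2). (u n)\<^sup>2)"
    have UZ: "?U 1 = Z + ?U (1/2)" unfolding Z_def by (intro sum.subset_diff fin) (auto simp: lattice_ball_def)
    have "exp (2 * \<tau> * exp (- 20)) * Z \<le> three_ball_const d M * (exp (2 * \<tau>) * ?U (1/2) + exp (2 * \<tau> * exp (- 20 * (49/25))) * ?U 2)"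
      unfolding Z_def d_def
    proof (rule shell_estimate[OF h0 \<tau>1 \<tau>\<epsilon> \<epsilon>1(1,2) M])
      fix n :: "real ^ 'n" assume "n \<in> lattice_ball h 3"
      then show "norm (B h n) \<le> M \<and> \<bar>V h n\<bar> \<le> M" "magnetic_schroedinger h (B h) (V h) u n = 0"
        using h0 eq by (auto simp: lattice_ball_def intro!: BV)
    qed
    \<comment> \<open>Dividing by the weight of the unit sphere makes the outer factor decay; the
      inner factor, already at most \<open>exp (2 * \<tau>)\<close>, only improves.\<close>
    then have "exp (- (2 * \<tau> * exp (- 20))) * (exp (2 * \<tau> * exp (- 20)) * Z) \<le>
       exp (- (2 * \<tau> * exp (- 20))) * (three_ball_const d M * (exp (2 * \<tau>) * ?U (1/2) + exp (2 * \<tau> * exp (- 20 * (49/25))) * ?U 2))"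
      by (intro mult_left_mono) auto
    also have "\<dots> = three_ball_const d M * (exp (2 * \<tau> - 2 * \<tau> * exp (- 20)) * ?U (1/2) + exp (- 2 * c2 * \<tau>) * ?U 2)"
    proof -
      have "exp (2 * \<tau> - 2 * \<tau> * exp (- 20)) = exp (- (2 * \<tau> * exp (- 20))) * exp (2 * \<tau>)"
        "exp (- 2 * c2 * \<tau>) = exp (- (2 * \<tau> * exp (- 20))) * exp (2 * \<tau> * exp (- 20 * (49/25)))"
        unfolding exp_add[symmetric] c2_def by (simp_all add: algebra_simps)
      then show ?thesis by (simp only: distrib_left mult.assoc mult.left_commute)
    qed
    also have "exp (- (2 * \<tau> * exp (- 20))) * (exp (2 * \<tau> * exp (- 20)) * Z) = Z"
      unfolding mult.assoc[symmetric] exp_add[symmetric] by simp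
    also have "three_ball_const d M * (exp (2 * \<tau> - 2 * \<tau> * exp (- 20)) * ?U (1/2) + exp (- 2 * c2 * \<tau>) * ?U 2)
      \<le> three_ball_const d M * (exp (2 * \<tau>) * ?U (1/2) + exp (- 2 * c2 * \<tau>) * ?U 2)"
      using \<tau>1 U0 A by (intro mult_left_mono add_right_mono mult_right_mono) (auto simp: A_def three_ball_const_def energy_const_def M d)
    finally have Z: "Z \<le> three_ball_const d M * (exp (2 * \<tau>) * ?U (1/2) + exp (- 2 * c2 * \<tau>) * ?U 2)" .
    have U: "?U (1/2) \<le> exp (2 * \<tau>) * ?U (1/2) + exp (- 2 * c2 * \<tau>) * ?U 2"
    proof -
      have "1 * ?U (1/2) \<le> exp (2 * \<tau>) * ?U (1/2)" using \<tau>1 U0 by (intro mult_right_mono) auto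
      moreover have "0 \<le> exp (- 2 * c2 * \<tau>) * ?U 2" using U0 by (intro mult_nonneg_nonneg) auto
      ultimately show ?thesis by linarith
    qed
    have "?U 1 \<le> A * (exp (2 * \<tau>) * ?U (1/2) + exp (- 2 * c2 * \<tau>) * ?U 2)"
      using add_mono[OF U Z] unfolding UZ A_def distrib_right[of 1] mult_1 by (simp only: add.commute)
    then have "sqrt (?U 1) \<le> sqrt (A * (exp (2 * \<tau>) * ?U (1/2) + exp (- 2 * c2 * \<tau>) * ?U 2))"
      by (rule real_sqrt_le_mono)
    also have "\<dots> = sqrt A * sqrt (exp (2 * \<tau>) * ?U (1/2) + exp (- 2 * c2 * \<tau>) * ?U 2)" by (rule real_sqrt_mult)
    also have "\<dots> \<le> sqrt A * (sqrt (exp (2 * \<tau>) * ?U (1/2)) + sqrt (exp (- 2 * c2 * \<tau>) * ?U 2))"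
      using A U0 by (intro mult_left_mono sqrt_add_le_add_sqrt mult_nonneg_nonneg) auto
    also have "sqrt (exp (2 * \<tau>) * ?U (1/2)) = exp (1 * \<tau>) * sqrt (?U (1/2))"
    proof -
      have "exp (2 * \<tau>) = (exp \<tau>)\<^sup>2" by (simp add: power2_eq_square flip: exp_add)
      then show ?thesis by (simp add: real_sqrt_mult)
    qed
    also have "sqrt (exp (- 2 * c2 * \<tau>) * ?U 2) = exp (- c2 * \<tau>) * sqrt (?U 2)"
    proof -
      have "exp (- 2 * c2 * \<tau>) = (exp (- c2 * \<tau>))\<^sup>2" by (simp add: power2_eq_square flip: exp_add)
      then show ?thesis by (simp add: real_sqrt_mult)
    qed
    finally show ?thesis unfolding L2_set_def .
  qed
  show ?thesis
  proof (intro exI conjI ballI allI impI)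
    \<comment> \<open>Witnesses: h0 and \<delta>0 are both \<epsilon>, c1 is 1 since the weight
      never exceeds 1, \<tau>0 is \<open>1 / \<epsilon>\<close>, and C is \<open>sqrt A\<close>
      because the estimate was proved for squared norms.\<close>
    show "0 < \<epsilon>" "\<epsilon> < 1" "0 < \<epsilon>" "\<epsilon> < 1" "(0::real) < 1" "0 < c2" "1 < 1 / \<epsilon>" "0 < sqrt A"
      using \<epsilon>0 \<epsilon>s c2 A by auto
  qed (rule main)
qed

end
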